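(* Let $G$ be a finitely generated subgroup of $PL_+(I)$. Then $G$ is non-soluble if and only if Brin's group $B$ embeds in $G$ (that is, $G$ has a subgroup isomorphic to $B$).
   Context: $PL_+(I)$ is the group of orientation-preserving piecewise-linear homeomorphisms of $I=[0,1]$ with finitely many breaks in slope. Write $g^h=h^{-1}gh$ and $[g,h]=g^{-1}h^{-1}gh$. Brin's group $B$ is the group given by the presentation $$B=\langle \{w_i \mid i\in\mathbb{Z}\},\, s \mid w_i^s=w_{i+1}\ (i\in\mathbb{Z}),\ [w_i^{w_k^m},w_j]=1\ (i<k,\ j<k,\ m\in\mathbb{Z}\setminus\{0\})\rangle .$$ *)

theory Defs
  imports "HOL-Analysis.Analysis" "HOL-Algebra.Algebra"
begin

section \<open>The group \<open>PL\<^sub>+(I)\<close>\<close>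

text \<open>\<open>S\<close> contains all breakpoints of \<open>f\<close>. Asking for an affine formula on the closed interval
  rather than the open one makes no difference, since this is only used for continuous \<open>f\<close>.\<close>

definition piecewise_linear_on :: "real \<Rightarrow> real \<Rightarrow> (real \<Rightarrow> real) \<Rightarrow> bool" where
  "piecewise_linear_on p q f \<longleftrightarrow>
    (\<exists>S. finite S \<and>
      (\<forall>a b. p \<le> a \<and> a < b \<and> b \<le> q \<and> {a<..<b} \<inter> S = {} \<longrightarrow>
        (\<exists>m c. \<forall>x\<in>{a..b}. f x = m * x + c)))"

text \<open>As in \<^const>\<open>BijGroup\<close>, maps of the interval are extensional, so that distinct elements
  differ at some point of the interval. Products are compositions of functions; writing maps on the
  right instead gives the opposite group, which is isomorphic to this one via inversion.\<close>

definition PL_plus :: "(real \<Rightarrow> real) monoid" where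
  "PL_plus = (BijGroup {0..1})
     \<lparr>carrier := {f \<in> extensional {0..1}.
        (\<exists>g. homeomorphism {0..1} {0..1} f g) \<and>
        strict_mono_on {0..1} f \<and>
        piecewise_linear_on 0 1 f}\<rparr>"

lemma PL_plus_subgroup: "subgroup (carrier PL_plus) (BijGroup {0..1})"
proof -
  let ?I = "{0..1::real}"
  have B: "f \<in> Bij ?I" if "f \<in> carrier PL_plus" for f
  proof -
    from that obtain g where h: "homeomorphism ?I ?I f g" and e: "f \<in> extensional ?I"
      by (auto simp: PL_plus_def)
    have "bij_betw f ?I ?I"
      by (rule bij_betw_byWitness[where f' = g]) (use h in \<open>auto simp: homeomorphism_def\<close>)
    with e show ?thesis by (simp add: Bij_def)
  qed
  show ?thesis
  proof (rule group.subgroupI[OF group_BijGroup])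
    show "carrier PL_plus \<subseteq> carrier (BijGroup ?I)"
      using B by (auto simp: BijGroup_def)
  next
    have "(\<lambda>x\<in>?I. x) \<in> carrier PL_plus"
    proof -
      have "homeomorphism ?I ?I (\<lambda>x\<in>?I. x) (\<lambda>x. x)"
        by (rule homeomorphism_cong[OF homeomorphism_ident]) auto
      moreover have "strict_mono_on ?I (\<lambda>x\<in>?I. x)"
        by (auto simp: strict_mono_on_def)
      moreover have "piecewise_linear_on 0 1 (\<lambda>x\<in>?I. x)"
        unfolding piecewise_linear_on_def
        by (intro exI[of _ "{}"] conjI allI impI exI[of _ 1] exI[of _ 0]) auto
      ultimately show ?thesis by (auto simp: PL_plus_def)
    qed
    then show "carrier PL_plus \<noteq> {}" by blast
  next
    fix f assume f: "f \<in> carrier PL_plus"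
    let ?k = "restrict (inv_into ?I f) ?I"
    have inv: "inv\<^bsub>BijGroup ?I\<^esub> f = ?k"
      using B[OF f] by (rule inv_BijGroup)
    have bij: "bij_betw f ?I ?I" using B[OF f] by (simp add: Bij_def)
    have kf: "?k (f x) = x" "f x \<in> ?I" if "x \<in> ?I" for x
      using bij that bij_betw_apply[OF bij that] by (auto simp: bij_betw_def)
    have fk: "f (?k y) = y" "?k y \<in> ?I" if "y \<in> ?I" for y
      using bij_betw_inv_into_right[OF bij that] bij_betw_apply[OF bij_betw_inv_into[OF bij] that] that by auto
    obtain g where h: "homeomorphism ?I ?I f g" and mono: "strict_mono_on ?I f"
      and pl: "piecewise_linear_on 0 1 f"
      using f by (auto simp: PL_plus_def)
    have "homeomorphism ?I ?I g f" using h by (rule homeomorphism_symD)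
    moreover have "?k y = g y" if "y \<in> ?I" for y
      using fk[OF that] h unfolding homeomorphism_def by metis
    ultimately have 1: "homeomorphism ?I ?I ?k f"
      using homeomorphism_cong[of ?I ?I g f ?I ?I ?k f] by auto
    have less: "?k x < ?k y" if "x \<in> ?I" "y \<in> ?I" "x < y" for x y
      using strict_mono_on_less[OF mono fk(2)[OF that(1)] fk(2)[OF that(2)]]
        fk(1)[OF that(1)] fk(1)[OF that(2)] that(3) by simp
    then have 2: "strict_mono_on ?I ?k" by (auto simp: strict_mono_on_def)
    from pl obtain S where S: "finite S" and aff: "\<And>a b. \<lbrakk>0 \<le> a; a < b; b \<le> 1; {a<..<b} \<inter> S = {}\<rbrakk>
        \<Longrightarrow> \<exists>m c. \<forall>x\<in>{a..b}. f x = m * x + c"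
      unfolding piecewise_linear_on_def by blast
    have 3: "piecewise_linear_on 0 1 ?k"
      unfolding piecewise_linear_on_def
    proof (intro exI[of _ "f ` S"] conjI allI impI)
      show "finite (f ` S)" using S by simp
    next
      fix a b assume "0 \<le> a \<and> a < b \<and> b \<le> 1 \<and> {a<..<b} \<inter> f ` S = {}"
      then have ab: "0 \<le> a" "a < b" "b \<le> 1" "{a<..<b} \<inter> f ` S = {}" by auto
      then have I: "a \<in> ?I" "b \<in> ?I" by auto
      have "{?k a<..<?k b} \<inter> S = {}"
      proof (rule ccontr)
        assume "{?k a<..<?k b} \<inter> S \<noteq> {}"
        then obtain s where s: "s \<in> S" "?k a < s" "s < ?k b" by auto
        then have "s \<in> ?I" using fk(2)[OF I(1)] fk(2)[OF I(2)] by auto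
        then have "a < f s" "f s < b"
          using strict_mono_onD[OF mono fk(2)[OF I(1)] _ s(2)] fk(1)[OF I(1)]
            strict_mono_onD[OF mono _ fk(2)[OF I(2)] s(3)] fk(1)[OF I(2)] by auto
        then show False using ab(4) s(1) by auto
      qed
      then obtain m c where mc: "\<forall>x\<in>{?k a..?k b}. f x = m * x + c"
        using aff[of "?k a" "?k b"] fk(2)[OF I(1)] fk(2)[OF I(2)] less[OF I ab(2)] by auto
      have "f (?k a) = m * ?k a + c" "f (?k b) = m * ?k b + c"
        using mc less[OF I ab(2)] by auto
      then have "m \<noteq> 0" using fk(1)[OF I(1)] fk(1)[OF I(2)] ab(2) by auto
      have "?k y = (1/m) * y + (- c/m)" if "y \<in> {a..b}" for y
      proof -
        have yI: "y \<in> ?I" using that ab by auto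
        have "?k a \<le> ?k y" using less[OF I(1) yI] that by (cases "a = y") auto
        moreover have "?k y \<le> ?k b" using less[OF yI I(2)] that by (cases "y = b") auto
        ultimately have "f (?k y) = m * ?k y + c" using mc by auto
        then have "y = m * ?k y + c" using fk(1)[OF yI] by simp
        then have "?k y = (y - c) / m" using \<open>m \<noteq> 0\<close> by (simp add: field_simps)
        then show ?thesis by (simp add: diff_divide_distrib)
      qed
      then show "\<exists>m c. \<forall>x\<in>{a..b}. ?k x = m * x + c" by blast
    qed
    show "inv\<^bsub>BijGroup ?I\<^esub> f \<in> carrier PL_plus"
      using 1 2 3 unfolding inv by (auto simp: PL_plus_def)
  next
    fix f g assume f: "f \<in> carrier PL_plus" and g: "g \<in> carrier PL_plus"
    have m: "f \<otimes>\<^bsub>BijGroup ?I\<^esub> g = compose ?I f g"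
      using B[OF f] B[OF g] by (simp add: BijGroup_def)
    obtain f' g' where h: "homeomorphism ?I ?I f f'" "homeomorphism ?I ?I g g'"
      using f g by (auto simp: PL_plus_def)
    have mono: "strict_mono_on ?I f" "strict_mono_on ?I g"
      using f g by (auto simp: PL_plus_def)
    have gI: "g x \<in> ?I" if "x \<in> ?I" for x using h(2) that by (auto simp: homeomorphism_def)
    have "homeomorphism ?I ?I (f \<circ> g) (g' \<circ> f')"
      using h(2,1) by (rule homeomorphism_compose)
    then have 1: "homeomorphism ?I ?I (compose ?I f g) (g' \<circ> f')"
      by (rule homeomorphism_cong) (auto simp: compose_def)
    have 2: "strict_mono_on ?I (compose ?I f g)"
    proof (rule strict_mono_onI)
      fix x y assume "x \<in> ?I" "y \<in> ?I" "x < y"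
      then show "compose ?I f g x < compose ?I f g y"
        using strict_mono_onD[OF mono(1) gI gI] strict_mono_onD[OF mono(2)]
        by (simp add: compose_def)
    qed
    obtain S where S: "finite S" and aff: "\<And>a b. \<lbrakk>0 \<le> a; a < b; b \<le> 1; {a<..<b} \<inter> S = {}\<rbrakk>
        \<Longrightarrow> \<exists>m c. \<forall>x\<in>{a..b}. f x = m * x + c"
      using f unfolding PL_plus_def piecewise_linear_on_def by auto
    obtain T where T: "finite T" and agg: "\<And>a b. \<lbrakk>0 \<le> a; a < b; b \<le> 1; {a<..<b} \<inter> T = {}\<rbrakk>
        \<Longrightarrow> \<exists>m c. \<forall>x\<in>{a..b}. g x = m * x + c"
      using g unfolding PL_plus_def piecewise_linear_on_def by auto
    have 3: "piecewise_linear_on 0 1 (compose ?I f g)"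
      unfolding piecewise_linear_on_def
    proof (intro exI[of _ "T \<union> g' ` S"] conjI allI impI)
      show "finite (T \<union> g' ` S)" using S T by simp
    next
      fix a b assume "0 \<le> a \<and> a < b \<and> b \<le> 1 \<and> {a<..<b} \<inter> (T \<union> g' ` S) = {}"
      then have ab: "0 \<le> a" "a < b" "b \<le> 1" "{a<..<b} \<inter> T = {}" "{a<..<b} \<inter> g' ` S = {}" by auto
      then have I: "a \<in> ?I" "b \<in> ?I" by auto
      have lt: "g a < g b" using strict_mono_onD[OF mono(2) I ab(2)] .
      have "{g a<..<g b} \<inter> S = {}"
      proof (rule ccontr)
        assume "{g a<..<g b} \<inter> S \<noteq> {}"
        then obtain s where s: "s \<in> S" "g a < s" "s < g b" by auto
        then have "s \<in> ?I" using gI[OF I(1)] gI[OF I(2)] by auto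
        then have g's: "g' s \<in> ?I" "g (g' s) = s" using h(2) by (auto simp: homeomorphism_def)
        then have "a < g' s" "g' s < b"
          using s(2,3) strict_mono_on_less[OF mono(2) I(1) g's(1)]
            strict_mono_on_less[OF mono(2) g's(1) I(2)] g's(2) by simp_all
        then show False using ab(5) s(1) by auto
      qed
      then obtain m c where mc: "\<forall>x\<in>{g a..g b}. f x = m * x + c"
        using aff[of "g a" "g b"] gI[OF I(1)] gI[OF I(2)] lt by auto
      obtain n d where nd: "\<forall>x\<in>{a..b}. g x = n * x + d" using agg[OF ab(1-4)] by blast
      have "compose ?I f g x = (m * n) * x + (m * d + c)" if x: "x \<in> {a..b}" for x
      proof -
        have xI: "x \<in> ?I" using x ab by auto
        have "g a \<le> g x" using strict_mono_onD[OF mono(2) I(1) xI] x by (cases "a = x") auto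
        moreover have "g x \<le> g b" using strict_mono_onD[OF mono(2) xI I(2)] x by (cases "x = b") auto
        ultimately have "f (g x) = m * g x + c" using mc by auto
        then show ?thesis using nd x xI by (simp add: compose_def algebra_simps)
      qed
      then show "\<exists>m c. \<forall>x\<in>{a..b}. compose ?I f g x = m * x + c" by blast
    qed
    have 4: "compose ?I f g \<in> extensional ?I" by (rule compose_extensional)
    show "f \<otimes>\<^bsub>BijGroup ?I\<^esub> g \<in> carrier PL_plus"
      unfolding m PL_plus_def using 1 2 3 4 by auto
  qed
qed

lemma group_PL_plus: "group PL_plus"
proof -
  have "PL_plus = (BijGroup {0..1})\<lparr>carrier := carrier PL_plus\<rparr>"
    by (simp add: PL_plus_def)
  then show ?thesis
    using subgroup.subgroup_is_group[OF PL_plus_subgroup group_BijGroup] by simp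
qed


section \<open>Free groups and presentations\<close>

text \<open>A word is a list of letters; \<open>(x, True)\<close> stands for the generator \<open>x\<close> and \<open>(x, False)\<close> for its
  formal inverse. The generators are all the elements of the type \<open>'x\<close>.\<close>

inductive word_eq :: "('x \<times> bool) list \<Rightarrow> ('x \<times> bool) list \<Rightarrow> bool" where
  cancel: "word_eq (u @ (x, e) # (x, \<not> e) # v) (u @ v)"
| refl: "word_eq u u"
| sym: "word_eq u v \<Longrightarrow> word_eq v u"
| trans: "word_eq u v \<Longrightarrow> word_eq v w \<Longrightarrow> word_eq u w"

definition free_group :: "('x \<times> bool) list set monoid" where
  "free_group =
    \<lparr>carrier = UNIV // {(u, v). word_eq u v},
     mult = (\<lambda>A B. \<Union>u\<in>A. \<Union>v\<in>B. {w. word_eq (u @ v) w}),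
     one = {w. word_eq [] w}\<rparr>"

definition free_gen :: "'x \<Rightarrow> ('x \<times> bool) list set" where
  "free_gen x = {w. word_eq [(x, True)] w}"

definition normal_closure :: "('a, 'b) monoid_scheme \<Rightarrow> 'a set \<Rightarrow> 'a set" where
  "normal_closure G R = generate G {g \<otimes>\<^bsub>G\<^esub> r \<otimes>\<^bsub>G\<^esub> inv\<^bsub>G\<^esub> g | g r. g \<in> carrier G \<and> r \<in> R}"

text \<open>Relators are elements of the free group; a relation \<open>u = v\<close> is entered as the relator
  \<open>u v\<^sup>-\<^sup>1\<close>.\<close>

definition presented_group :: "('x \<times> bool) list set set \<Rightarrow> ('x \<times> bool) list set set monoid" where
  "presented_group R = free_group Mod normal_closure free_group R"

lemma word_eq_append1: "word_eq u u' \<Longrightarrow> word_eq (u @ v) (u' @ v)"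
proof (induction rule: word_eq.induct)
  case (cancel u x e w)
  show ?case using word_eq.cancel[of u x e "w @ v"] by simp
qed (auto intro: word_eq.intros)

lemma word_eq_append2: "word_eq v v' \<Longrightarrow> word_eq (u @ v) (u @ v')"
proof (induction rule: word_eq.induct)
  case (cancel w x e v)
  show ?case using word_eq.cancel[of "u @ w" x e v] by simp
qed (auto intro: word_eq.intros)

lemma word_eq_append: "word_eq u u' \<Longrightarrow> word_eq v v' \<Longrightarrow> word_eq (u @ v) (u' @ v')"
  by (meson word_eq_append1 word_eq_append2 word_eq.trans)

lemma word_eq_inverse: "word_eq (map (\<lambda>(x, e). (x, \<not> e)) (rev w) @ w) []"
proof (induction w)
  case (Cons a w)
  obtain x e where a: "a = (x, e)" by force
  have "word_eq (map (\<lambda>(x, e). (x, \<not> e)) (rev w) @ (x, \<not> e) # (x, \<not> \<not> e) # w)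
      (map (\<lambda>(x, e). (x, \<not> e)) (rev w) @ w)"
    by (rule word_eq.cancel)
  with Cons.IH show ?case by (auto simp: a intro: word_eq.trans)
qed (simp add: word_eq.refl)

lemma carrier_free_group: "carrier free_group = range (\<lambda>u. {w. word_eq u w})"
  by (auto simp: free_group_def quotient_def)

lemma one_free_group: "\<one>\<^bsub>free_group\<^esub> = {w. word_eq [] w}"
  by (simp add: free_group_def)

lemma mult_free_group:
  "{w. word_eq u w} \<otimes>\<^bsub>free_group\<^esub> {w. word_eq v w} = {w. word_eq (u @ v) w}"
  by (auto simp: free_group_def)
     (meson word_eq_append word_eq.refl word_eq.sym word_eq.trans)+

lemma group_free_group: "group free_group"
proof (rule groupI)
  fix A :: "('a \<times> bool) list set" assume "A \<in> carrier free_group"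
  then obtain u where A: "A = {w. word_eq u w}" by (auto simp: carrier_free_group)
  let ?v = "map (\<lambda>(x, e). (x, \<not> e)) (rev u)"
  have "{w. word_eq (?v @ u) w} = {w. word_eq [] w}"
    using word_eq_inverse[of u] by (auto intro: word_eq.sym word_eq.trans)
  then show "\<exists>B\<in>carrier free_group. B \<otimes>\<^bsub>free_group\<^esub> A = \<one>\<^bsub>free_group\<^esub>"
    unfolding A one_free_group carrier_free_group using mult_free_group[of ?v u] by auto
qed (auto simp: carrier_free_group one_free_group mult_free_group)

lemma free_gen_closed: "free_gen x \<in> carrier free_group"
  by (auto simp: free_gen_def carrier_free_group)

lemma (in group) normal_closure_normal:
  assumes "R \<subseteq> carrier G"
  shows "normal_closure G R \<lhd> G"
  unfolding normal_closure_def
proof (rule normal_generateI)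
  let ?C = "{g \<otimes> r \<otimes> inv g | g r. g \<in> carrier G \<and> r \<in> R}"
  show "?C \<subseteq> carrier G" using assms by auto
  fix h g assume "h \<in> ?C" and g: "g \<in> carrier G"
  then obtain k r where k: "k \<in> carrier G" "r \<in> R" "h = k \<otimes> r \<otimes> inv k" by auto
  then have r: "r \<in> carrier G" using assms by auto
  have "g \<otimes> h \<otimes> inv g = (g \<otimes> k) \<otimes> r \<otimes> inv (g \<otimes> k)"
    using g k r by (simp add: m_assoc inv_mult_group)
  then show "g \<otimes> h \<otimes> inv g \<in> ?C" using g k(1,2) by blast
qed

lemma group_presented_group:
  assumes "R \<subseteq> carrier free_group"
  shows "group (presented_group R)"
  unfolding presented_group_def
  using group.normal_closure_normal[OF group_free_group assms] by (rule normal.factorgroup_is_group)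


section \<open>Brin's group\<close>

definition conjugate :: "('a, 'b) monoid_scheme \<Rightarrow> 'a \<Rightarrow> 'a \<Rightarrow> 'a" where
  "conjugate G g h = inv\<^bsub>G\<^esub> h \<otimes>\<^bsub>G\<^esub> g \<otimes>\<^bsub>G\<^esub> h"

definition commutator :: "('a, 'b) monoid_scheme \<Rightarrow> 'a \<Rightarrow> 'a \<Rightarrow> 'a" where
  "commutator G g h = inv\<^bsub>G\<^esub> g \<otimes>\<^bsub>G\<^esub> inv\<^bsub>G\<^esub> h \<otimes>\<^bsub>G\<^esub> g \<otimes>\<^bsub>G\<^esub> h"

datatype brin_gen = W int | S

definition brin_relators :: "(brin_gen \<times> bool) list set set" where
  "brin_relators =
    (let F = free_group; w = (\<lambda>i. free_gen (W i)); s = free_gen S in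
      {conjugate F (w i) s \<otimes>\<^bsub>F\<^esub> inv\<^bsub>F\<^esub> (w (i + 1)) | i. True} \<union>
      {commutator F (conjugate F (w i) (w k [^]\<^bsub>F\<^esub> m)) (w j) | i j k (m::int).
         i < k \<and> j < k \<and> m \<noteq> 0})"

definition brin_group :: "(brin_gen \<times> bool) list set set monoid" where
  "brin_group = presented_group brin_relators"

lemma group_brin_group: "group brin_group"
  unfolding brin_group_def
proof (rule group_presented_group)
  interpret group "free_group :: (brin_gen \<times> bool) list set monoid" by (rule group_free_group)
  show "brin_relators \<subseteq> carrier free_group"
    by (auto simp: brin_relators_def Let_def conjugate_def commutator_def free_gen_closed)
qed

end

theory Submission
  imports Defs
begin

text \<open>Call an interval an orbital of a set of maps if it is a component of the support. The proof
  distinguishes whether some orbital \<open>(p, q)\<close> of a finitely generated subgroup has its left end in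
  common with a strictly smaller orbital \<open>(p, b)\<close> of an element.

  If this never happens, orbitals of elements that meet are equal or strictly nested, and the
  translates of an orbital are pairwise equal or disjoint. Commutators are trivial near the ends of
  orbitals, so a nontrivial element of the \<open>n\<close>-th derived subgroup sits at the bottom of a strictly
  nested tower of \<open>n + 1\<close> orbitals. Each level of the tower contains a breakpoint of some element
  whose group orbit misses the next level, and breakpoints form finitely many group orbits when the
  group is finitely generated. Hence the group is soluble.

  If it happens for the group \<open>H\<close>, every compact subinterval of \<open>(p, q)\<close> can be pushed by \<open>H\<close> to the
  left of any point of the orbit of \<open>b\<close> and arbitrarily close to it. Take a compactly supported \<open>w\<close>
  that moves such a point \<open>z\<close> and is nontrivial on as few orbitals of \<open>H\<close> as possible, and an \<open>s\<close>
  contracting a large interval into a small one next to \<open>z\<close>. On \<open>(p, q)\<close> the conjugates of \<open>w\<close> by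
  powers of \<open>s\<close> satisfy Brin's relations because their supports are displaced. For a maximal choice
  of \<open>(p, q)\<close>, minimality of \<open>w\<close> forces displacement on every other orbital on which \<open>w\<close> is
  nontrivial: otherwise a commutator of conjugates of \<open>w\<close> would be trivial on that orbital. The
  resulting homomorphism is injective, since a relation can be read off level by level from the
  nested supports.\<close>

section \<open>Piecewise linear actions on the line\<close>

text \<open>The obstacle in the crossing case is that an element acts on all orbitals of the group
  at once. On \<open>(p, q)\<close> supports can be displaced at will, but elsewhere the conjugating
  element is out of control, and the relations may fail there. The relation \<open>governs\<close>
  measures this: one orbital governs another if displacing a large enough interval of the first
  forces displacement of any given interval of the second. It is a preorder, so a maximal
  \<open>(p, q)\<close> makes sense. Minimality of \<open>w\<close> leaves only active orbitals that
  govern \<open>(p, q)\<close>, and maximality turns this around: \<open>(p, q)\<close> governs them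
  all. The commutation relations, for all exponents, then reduce to one criterion:
  \<open>h w h^-1\<close> commutes with \<open>w\<close> as soon as \<open>h\<close> displaces one
  interval \<open>[c, d]\<close> of \<open>(p, q)\<close>. Injectivity is tested on
  \<open>(p, q)\<close> alone. Maps act on the left, so \<open>w_{-n} = s^n w s^-n\<close> has a
  support that shrinks as \<open>n\<close> grows, and the negative generators have the structure of
  an iterated wreath product of infinite cyclic groups.\<close>

definition affine_near :: "(real \<Rightarrow> real) \<Rightarrow> real \<Rightarrow> bool" where
  "affine_near f x \<longleftrightarrow> (\<exists>m c. \<forall>\<^sub>F y in nhds x. f y = m * y + c)"

text \<open>Piecewise linearity mostly enters through this fact: a moved point cannot lie between
  two fixed points inside an interval of affinity.\<close>

lemma affine_two_fixed_points:
  fixes m c :: real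
  assumes "m * a + c = a" "m * b + c = b" "a \<noteq> b"
  shows "m * y + c = y"
proof -
  have "(m - 1) * (a - b) = 0" using assms by (simp add: algebra_simps)
  then have "m = 1" using assms by simp
  then show ?thesis using assms by simp
qed

text \<open>The maps are extended by the identity to the whole line, which removes all membership
  conditions. The action is kept abstract so that its reflection in \<open>1/2\<close> is again an
  instance; left-hand versions of lemmas then follow from right-hand ones.\<close>

locale pl_action = group L for L (structure) +
  fixes act :: "'a \<Rightarrow> real \<Rightarrow> real" (infixr "\<rhd>" 72)
  assumes act_mult: "\<lbrakk>f \<in> carrier L; g \<in> carrier L\<rbrakk> \<Longrightarrow> (f \<otimes> g) \<rhd> x = f \<rhd> g \<rhd> x"
    and act_one: "\<one> \<rhd> x = x"
    and act_mono: "\<lbrakk>f \<in> carrier L; x < y\<rbrakk> \<Longrightarrow> f \<rhd> x < f \<rhd> y"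
    and act_outside: "\<lbrakk>f \<in> carrier L; x \<le> 0 \<or> 1 \<le> x\<rbrakk> \<Longrightarrow> f \<rhd> x = x"
    and faithful: "\<lbrakk>f \<in> carrier L; \<And>x. f \<rhd> x = x\<rbrakk> \<Longrightarrow> f = \<one>"
    and germ_right: "f \<in> carrier L \<Longrightarrow> \<exists>e>0. \<exists>m c. \<forall>y\<in>{x..x + e}. f \<rhd> y = m * y + c"
    and germ_left: "f \<in> carrier L \<Longrightarrow> \<exists>e>0. \<exists>m c. \<forall>y\<in>{x - e..x}. f \<rhd> y = m * y + c"
    and finite_breaks: "f \<in> carrier L \<Longrightarrow> finite {x. \<not> affine_near (\<lambda>x. f \<rhd> x) x}"
begin

lemma act_inv1 [simp]: "f \<in> carrier L \<Longrightarrow> inv f \<rhd> f \<rhd> x = x"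
  by (metis act_mult act_one inv_closed l_inv)

lemma act_inv2 [simp]: "f \<in> carrier L \<Longrightarrow> f \<rhd> inv f \<rhd> x = x"
  by (metis act_mult act_one inv_closed r_inv)

lemma act_less_iff [simp]: "f \<in> carrier L \<Longrightarrow> f \<rhd> x < f \<rhd> y \<longleftrightarrow> x < y"
  by (metis act_mono linorder_less_linear order_less_imp_not_less)

lemma act_le_iff [simp]: "f \<in> carrier L \<Longrightarrow> f \<rhd> x \<le> f \<rhd> y \<longleftrightarrow> x \<le> y"
  by (meson act_less_iff linorder_not_less)

lemma act_eq_iff [simp]: "f \<in> carrier L \<Longrightarrow> f \<rhd> x = f \<rhd> y \<longleftrightarrow> x = y"
  by (metis act_inv1)

lemma inv_act_eq: "f \<in> carrier L \<Longrightarrow> inv f \<rhd> x = y \<longleftrightarrow> x = f \<rhd> y"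
  by (metis act_inv1 act_inv2)

lemma inv_act_less: "f \<in> carrier L \<Longrightarrow> inv f \<rhd> x < y \<longleftrightarrow> x < f \<rhd> y"
  by (metis act_inv2 act_less_iff)

lemma less_inv_act: "f \<in> carrier L \<Longrightarrow> x < inv f \<rhd> y \<longleftrightarrow> f \<rhd> x < y"
  by (metis act_inv2 act_less_iff)

lemma act_continuous: "f \<in> carrier L \<Longrightarrow> continuous_on UNIV ((\<rhd>) f)"
proof (rule continuous_onI_mono)
  assume f: "f \<in> carrier L"
  have "range ((\<rhd>) f) = UNIV" using f by (metis act_inv2 surjI)
  then show "open (range ((\<rhd>) f))" by simp
qed (auto)

lemma act_isCont: "f \<in> carrier L \<Longrightarrow> isCont ((\<rhd>) f) x"
  using act_continuous continuous_on_eq_continuous_at by blast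

lemma reflect: "pl_action L (\<lambda>f x. 1 - f \<rhd> (1 - x))"
proof unfold_locales
  fix f x assume f: "f \<in> carrier L"
  from germ_left[OF f, of "1 - x"] obtain e m c where e: "e > 0"
    and *: "\<And>y. y \<in> {1 - x - e..1 - x} \<Longrightarrow> f \<rhd> y = m * y + c" by blast
  show "\<exists>e>0. \<exists>m c. \<forall>y\<in>{x..x + e}. 1 - f \<rhd> (1 - y) = m * y + c"
    by (rule exI[of _ e], intro conjI e exI[of _ m] exI[of _ "1 - m - c"])
       (use * in \<open>auto simp: algebra_simps\<close>)
  from germ_right[OF f, of "1 - x"] obtain e m c where e: "e > 0"
    and *: "\<And>y. y \<in> {1 - x..1 - x + e} \<Longrightarrow> f \<rhd> y = m * y + c" by blast
  show "\<exists>e>0. \<exists>m c. \<forall>y\<in>{x - e..x}. 1 - f \<rhd> (1 - y) = m * y + c"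
    by (rule exI[of _ e], intro conjI e exI[of _ m] exI[of _ "1 - m - c"])
       (use * in \<open>auto simp: algebra_simps\<close>)
  have "affine_near (\<lambda>x. 1 - f \<rhd> (1 - x)) x" if "affine_near (\<lambda>x. f \<rhd> x) (1 - x)" for x
  proof -
    from that obtain m c where *: "\<forall>\<^sub>F y in nhds (1 - x). f \<rhd> y = m * y + c"
      unfolding affine_near_def by blast
    have "filterlim (\<lambda>y. 1 - y) (nhds (1 - x)) (nhds x)" by (intro tendsto_intros filterlim_ident)
    from eventually_compose_filterlim[OF * this]
    have "\<forall>\<^sub>F y in nhds x. 1 - f \<rhd> (1 - y) = m * y + (1 - m - c)"
      by eventually_elim (simp add: algebra_simps)
    then show ?thesis unfolding affine_near_def by blast
  qed
  then have "{x. \<not> affine_near (\<lambda>x. 1 - f \<rhd> (1 - x)) x} \<subseteq> (\<lambda>x. 1 - x) ` {x. \<not> affine_near (\<lambda>x. f \<rhd> x) x}"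
    by (intro subsetI image_eqI[of _ _ "1 - x" for x]) auto
  then show "finite {x. \<not> affine_near (\<lambda>x. 1 - f \<rhd> (1 - x)) x}"
    using finite_breaks[OF f] finite_surj by blast
qed (auto simp: act_mult act_one act_outside, metis add.commute add_diff_cancel_left' diff_add_cancel faithful)

section \<open>Germs at fixed points\<close>

lemma germ_fixed_right:
  assumes f: "f \<in> carrier L" and p: "f \<rhd> p = p"
  obtains m where "m > 0" "\<forall>\<^sub>F x in at_right p. f \<rhd> x = p + m * (x - p)"
proof -
  from germ_right[OF f, of p] obtain e m c where e: "e > 0"
    and *: "\<And>y. y \<in> {p..p + e} \<Longrightarrow> f \<rhd> y = m * y + c" by blast
  have c: "c = p - m * p" using *[of p] p e by simp
  have eq: "f \<rhd> y = p + m * (y - p)" if "y \<in> {p..p + e}" for y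
    using *[OF that] c by (simp add: algebra_simps)
  have "f \<rhd> p < f \<rhd> (p + e)" using f e by simp
  then have "m * e > 0" using eq[of "p + e"] p e by simp
  then have "m > 0" using e by (simp add: zero_less_mult_iff)
  moreover have "\<forall>\<^sub>F x in at_right p. f \<rhd> x = p + m * (x - p)"
    unfolding eventually_at_right_field by (intro exI[of _ "p + e"]) (use e eq in auto)
  ultimately show ?thesis by (rule that)
qed

lemma filterlim_act_right:
  assumes f: "f \<in> carrier L" and p: "f \<rhd> p = p"
  shows "filterlim ((\<rhd>) f) (at_right p) (at_right p)"
  unfolding filterlim_at
proof
  have "filterlim ((\<rhd>) f) (nhds (f \<rhd> p)) (at p)" using act_isCont[OF f, of p] by (simp add: isCont_def)
  then show "filterlim ((\<rhd>) f) (nhds p) (at_right p)" using p by (simp add: filterlim_at_split)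
  show "\<forall>\<^sub>F x in at_right p. f \<rhd> x \<in> {p<..} \<and> f \<rhd> x \<noteq> p"
    using eventually_at_right_less[of p] by eventually_elim (use act_mono[OF f] p in force)
qed

text \<open>The germ is linear about \<open>p\<close>: with slope 1 it is the identity, with any
  other slope no point close to the right of \<open>p\<close> is fixed. Oscillation between fixed
  and moved points is excluded.\<close>

lemma germ_dichotomy:
  assumes f: "f \<in> carrier L" and p: "f \<rhd> p = p"
  shows "(\<forall>\<^sub>F x in at_right p. f \<rhd> x = x) \<or> (\<forall>\<^sub>F x in at_right p. f \<rhd> x \<noteq> x)"
proof -
  obtain m where m: "m > 0" "\<forall>\<^sub>F x in at_right p. f \<rhd> x = p + m * (x - p)"
    using germ_fixed_right[OF f p] .
  show ?thesis
  proof (cases "m = 1")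
    case True
    with m(2) show ?thesis by (auto elim!: eventually_mono)
  next
    case False
    have "\<forall>\<^sub>F x in at_right p. f \<rhd> x \<noteq> x"
      using m(2) eventually_at_right_less[of p]
    proof eventually_elim
      case (elim x)
      have "(m - 1) * (x - p) \<noteq> 0" using False elim by simp
      then show ?case using elim by (simp add: algebra_simps)
    qed
    then show ?thesis ..
  qed
qed

text \<open>Linear germs about the same fixed point compose by multiplying slopes, hence
  commute.\<close>

lemma commutator_germ_right:
  assumes f: "f \<in> carrier L" "f \<rhd> p = p" and g: "g \<in> carrier L" "g \<rhd> p = p"
  shows "\<forall>\<^sub>F x in at_right p. (f \<otimes> g \<otimes> inv f \<otimes> inv g) \<rhd> x = x"
proof -
  obtain m where m: "\<forall>\<^sub>F x in at_right p. f \<rhd> x = p + m * (x - p)"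
    using germ_fixed_right[OF f] by blast
  obtain n where n: "\<forall>\<^sub>F x in at_right p. g \<rhd> x = p + n * (x - p)"
    using germ_fixed_right[OF g] by blast
  have "\<forall>\<^sub>F x in at_right p. f \<rhd> g \<rhd> x = g \<rhd> f \<rhd> x"
    using m n eventually_compose_filterlim[OF m filterlim_act_right[OF g]]
      eventually_compose_filterlim[OF n filterlim_act_right[OF f]]
    by eventually_elim simp
  \<comment> \<open>The germ identity is substituted at \<open>inv f inv g x\<close>, which also
    tends to \<open>p\<close> from the right; there \<open>g f\<close> returns
    \<open>x\<close>.\<close>
  moreover have "filterlim ((\<rhd>) (inv f \<otimes> inv g)) (at_right p) (at_right p)"
    by (rule filterlim_act_right) (use f g in \<open>auto simp: act_mult inv_act_eq\<close>)
  ultimately have "\<forall>\<^sub>F x in at_right p. f \<rhd> g \<rhd> (inv f \<otimes> inv g) \<rhd> x = g \<rhd> f \<rhd> (inv f \<otimes> inv g) \<rhd> x"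
    by (rule eventually_compose_filterlim)
  then show ?thesis
    by eventually_elim (use f g in \<open>simp add: act_mult m_assoc\<close>)
qed

lemma commutator_germ_left:
  assumes f: "f \<in> carrier L" "f \<rhd> p = p" and g: "g \<in> carrier L" "g \<rhd> p = p"
  obtains e where "e > 0" "\<And>x. p - e < x \<Longrightarrow> x < p \<Longrightarrow> (f \<otimes> g \<otimes> inv f \<otimes> inv g) \<rhd> x = x"
proof -
  interpret R: pl_action L "\<lambda>f x. 1 - f \<rhd> (1 - x)" by (rule reflect)
  have "\<forall>\<^sub>F x in at_right (1 - p). 1 - (f \<otimes> g \<otimes> inv f \<otimes> inv g) \<rhd> (1 - x) = x"
    using R.commutator_germ_right[of f "1 - p" g] f g by simp
  then obtain b where b: "b > 1 - p"
    "\<And>y. 1 - p < y \<Longrightarrow> y < b \<Longrightarrow> 1 - (f \<otimes> g \<otimes> inv f \<otimes> inv g) \<rhd> (1 - y) = y"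
    unfolding eventually_at_right_field by blast
  have "(f \<otimes> g \<otimes> inv f \<otimes> inv g) \<rhd> x = x" if "p - (b - (1 - p)) < x" "x < p" for x
    using b(2)[of "1 - x"] that by simp
  with b(1) that[of "b - (1 - p)"] show ?thesis by simp
qed

section \<open>Orbitals and group orbits inside them\<close>

definition orb :: "'a set \<Rightarrow> real \<Rightarrow> real \<Rightarrow> bool" where
  "orb A p q \<longleftrightarrow> 0 \<le> p \<and> p < q \<and> q \<le> 1 \<and> (\<forall>f\<in>A. f \<rhd> p = p \<and> f \<rhd> q = q) \<and>
    (\<forall>x. p < x \<and> x < q \<longrightarrow> (\<exists>f\<in>A. f \<rhd> x \<noteq> x))"

lemma generate_fixed:
  assumes "A \<subseteq> carrier L" "h \<in> generate L A" "\<And>f. f \<in> A \<Longrightarrow> f \<rhd> x = x"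
  shows "h \<rhd> x = x"
  using assms(2)
proof induction
  case (eng h1 h2)
  then show ?case using generate_in_carrier[OF assms(1)] by (simp add: act_mult)
qed (use assms in \<open>auto simp: act_one inv_act_eq\<close>)

text \<open>The ends are the nearest common fixed points on either side of \<open>x\<close>. They
  exist because the common fixed set is closed and contains everything outside the open unit
  interval.\<close>

lemma orb_exists:
  assumes A: "A \<subseteq> carrier L" and f: "f \<in> A" "f \<rhd> x \<noteq> x"
  obtains p q where "orb A p q" "p < x" "x < q"
proof -
  define F where "F = {y. \<forall>f\<in>A. f \<rhd> y = y}"
  have F: "F = (\<Inter>f\<in>A. {y. f \<rhd> y = y})" by (auto simp: F_def)
  have cl: "closed F" unfolding F
    by (rule closed_INT, intro ballI closed_Collect_eq act_continuous continuous_on_id)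
      (use A in auto)
  have out: "y \<in> F" if "y \<le> 0 \<or> 1 \<le> y" for y
    using act_outside that A by (auto simp: F_def)
  have x: "x \<notin> F" "0 < x" "x < 1" using f out[of x] by (auto simp: F_def not_le[symmetric])
  define p where "p = Sup (F \<inter> {..x})"
  define q where "q = Inf (F \<inter> {x..})"
  have p: "p \<in> F \<inter> {..x}" unfolding p_def
    by (rule closed_contains_Sup) (use cl out[of 0] x in \<open>auto intro!: closed_Int\<close>)
  have q: "q \<in> F \<inter> {x..}" unfolding q_def
    by (rule closed_contains_Inf) (use cl out[of 1] x in \<open>auto intro!: closed_Int\<close>)
  have "0 \<le> p" unfolding p_def using out[of 0] x by (intro cSup_upper) auto
  moreover have "q \<le> 1" unfolding q_def using out[of 1] x by (intro cInf_lower) auto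
  moreover have "y \<notin> F" if "p < y" "y < q" for y
  proof
    assume "y \<in> F"
    show False
    proof (cases "y \<le> x")
      case True
      then have "y \<le> p" unfolding p_def using \<open>y \<in> F\<close> by (intro cSup_upper) auto
      with that show False by simp
    next
      case False
      then have "q \<le> y" unfolding q_def using \<open>y \<in> F\<close> by (intro cInf_lower) auto
      with that show False by simp
    qed
  qed
  moreover have "p < x" "x < q" using p q x by (auto simp: less_le)
  ultimately have "orb A p q" using p q unfolding orb_def by (auto simp: F_def)
  with \<open>p < x\<close> \<open>x < q\<close> show ?thesis by (rule that[rotated])
qed

lemma orb_avoids_fixed:
  "\<lbrakk>orb A a b; \<And>f. f \<in> A \<Longrightarrow> f \<rhd> y = y\<rbrakk> \<Longrightarrow> y \<le> a \<or> b \<le> y"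
  unfolding orb_def by (meson not_le)

lemma orb_within:
  assumes "orb A a b" "orb Z p q" "Z \<subseteq> carrier L" "A \<subseteq> generate L Z" "a < x" "x < b" "p < x" "x < q"
  shows "p \<le> a \<and> b \<le> q"
proof -
  have "f \<rhd> p = p" "f \<rhd> q = q" if "f \<in> A" for f
    using generate_fixed[OF assms(3), of f] assms(2,4) that unfolding orb_def by blast+
  with orb_avoids_fixed[OF assms(1), of p] orb_avoids_fixed[OF assms(1), of q] show ?thesis
    using assms(5-) by force
qed

lemma orb_unique:
  assumes "orb A p q" "orb A p' q'" "A \<subseteq> carrier L" "p < x" "x < q" "p' < x" "x < q'"
  shows "p' = p \<and> q' = q"
  using orb_within[OF assms(1,2,3) _ assms(4-)] orb_within[OF assms(2,1,3) _ assms(6,7,4,5)]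
    generate.incl[of _ A L] by (meson order_antisym subsetI)

lemma orb_preserved:
  assumes "orb A p q" "A \<subseteq> carrier L" "h \<in> generate L A" "p < x" "x < q"
  shows "p < h \<rhd> x" "h \<rhd> x < q"
proof -
  have h: "h \<in> carrier L" "h \<rhd> p = p" "h \<rhd> q = q"
    using generate_in_carrier[OF assms(2,3)] generate_fixed[OF assms(2,3)] assms(1) by (auto simp: orb_def)
  show "p < h \<rhd> x" "h \<rhd> x < q" using act_mono[OF h(1) assms(4)] act_mono[OF h(1) assms(5)] h by auto
qed

text \<open>Otherwise the infimum of the orbit would be a point inside the orbital that no element
  can lower, although some generator or its inverse does.\<close>

lemma orbit_down:
  assumes A: "A \<subseteq> carrier L" and o: "orb A p q" and x: "p < x" "x < q" and y: "p < y"
  obtains h where "h \<in> generate L A" "h \<rhd> x < y"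
proof (rule ccontr)
  assume "\<not> thesis"
  with that have ge: "y \<le> h \<rhd> x" if "h \<in> generate L A" for h using that by (meson not_le)
  let ?O = "(\<lambda>h. h \<rhd> x) ` generate L A"
  define i where "i = Inf ?O"
  have one: "\<one> \<in> generate L A" by (rule generate.one)
  have ne: "?O \<noteq> {}" using one by auto
  have bdd: "bdd_below ?O" using ge by (auto intro!: bdd_belowI)
  have lb: "i \<le> h \<rhd> x" if "h \<in> generate L A" for h
    unfolding i_def using that bdd by (auto intro!: cInf_lower)
  have "y \<le> i" unfolding i_def by (rule cInf_greatest[OF ne]) (use ge in auto)
  then have "p < i" using y by simp
  moreover have "i < q" using lb[OF one] x by (simp add: act_one)
  ultimately obtain f where f: "f \<in> A" "f \<rhd> i \<noteq> i" using o unfolding orb_def by blast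
  obtain g where g: "g \<in> generate L A" "g \<rhd> i < i"
  proof (cases "f \<rhd> i < i")
    case True then show ?thesis using that generate.incl[OF f(1)] by blast
  next
    case False
    then have "inv f \<rhd> i < i" using f A by (auto simp: inv_act_less)
    then show ?thesis using that generate.inv[OF f(1)] by blast
  qed
  have gc: "g \<in> carrier L" using generate_in_carrier[OF A g(1)] .
  \<comment> \<open>Orbit points close to \<open>i\<close> are carried below \<open>i\<close> by
    \<open>g\<close>.\<close>
  have "i < inv g \<rhd> i" using g gc by (simp add: less_inv_act)
  then obtain h where h: "h \<in> generate L A" "h \<rhd> x < inv g \<rhd> i"
    using cInf_lessD[OF ne, of "inv g \<rhd> i"] unfolding i_def by auto
  have "(g \<otimes> h) \<rhd> x < i" using h gc generate_in_carrier[OF A h(1)] by (simp add: act_mult less_inv_act)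
  moreover have "g \<otimes> h \<in> generate L A" using g h by (blast intro: generate.eng)
  ultimately show False using lb by force
qed

lemma orbit_up:
  assumes A: "A \<subseteq> carrier L" and o: "orb A p q" and x: "p < x" "x < q" and y: "y < q"
  obtains h where "h \<in> generate L A" "y < h \<rhd> x"
proof -
  interpret R: pl_action L "\<lambda>f x. 1 - f \<rhd> (1 - x)" by (rule reflect)
  have "\<exists>f\<in>A. 1 - f \<rhd> (1 - z) \<noteq> z" if "1 - q < z" "z < 1 - p" for z
  proof -
    have "p < 1 - z" "1 - z < q" using that by auto
    then obtain f where "f \<in> A" "f \<rhd> (1 - z) \<noteq> 1 - z" using o unfolding orb_def by blast
    then show ?thesis by (intro bexI[of _ f]) auto
  qed
  then have "R.orb A (1 - q) (1 - p)" using o unfolding orb_def R.orb_def by simp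
  then obtain h where "h \<in> generate L A" "1 - h \<rhd> (1 - (1 - x)) < 1 - y"
    using R.orbit_down[OF A, of "1 - q" "1 - p" "1 - x" "1 - y"] x y by auto
  then show ?thesis using that by simp
qed

lemma orb_inv: "f \<in> carrier L \<Longrightarrow> orb {inv f} a b \<longleftrightarrow> orb {f} a b"
  unfolding orb_def by (simp add: inv_act_eq) metis

lemma orb_conj:
  assumes "h \<in> carrier L" "f \<in> carrier L" "orb {f} a b"
  shows "orb {h \<otimes> f \<otimes> inv h} (h \<rhd> a) (h \<rhd> b)"
proof -
  have "0 \<le> h \<rhd> a" using assms act_le_iff[of h 0 a] act_outside[of h 0] by (simp add: orb_def)
  moreover have "h \<rhd> b \<le> 1" using assms act_le_iff[of h b 1] act_outside[of h 1] by (simp add: orb_def)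
  moreover have "(h \<otimes> f \<otimes> inv h) \<rhd> x \<noteq> x" if "h \<rhd> a < x" "x < h \<rhd> b" for x
  proof -
    have "a < inv h \<rhd> x" "inv h \<rhd> x < b" using that assms by (auto simp: less_inv_act inv_act_less)
    then have "f \<rhd> inv h \<rhd> x \<noteq> inv h \<rhd> x" using assms by (auto simp: orb_def)
    then show ?thesis using assms by (metis act_inv2 act_eq_iff act_mult inv_closed m_closed)
  qed
  ultimately show ?thesis using assms unfolding orb_def by (auto simp: act_mult)
qed

lemma orb_realized:
  assumes f: "f \<in> carrier L" "\<forall>\<^sub>F x in at_right p. f \<rhd> x \<noteq> x" "f \<rhd> p = p"
  obtains b where "orb {f} p b"
proof -
  obtain e where e: "e > p" "\<And>x. p < x \<Longrightarrow> x < e \<Longrightarrow> f \<rhd> x \<noteq> x"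
    using f(2) unfolding eventually_at_right_field by blast
  define x where "x = (p + e) / 2"
  have x: "p < x" "x < e" using e by (auto simp: x_def)
  obtain a b where o: "orb {f} a b" "a < x" "x < b"
    using orb_exists[of "{f}" f x] f e x by blast
  have "a \<le> p" using e(2)[of a] o x by (force simp: orb_def)
  moreover have "p \<le> a" using orb_avoids_fixed[OF o(1), of p] f o x by auto
  ultimately show ?thesis using o that by simp
qed

text \<open>If all germs at \<open>p\<close> were trivial, finiteness of \<open>Y\<close> would give
  a common interval of fixed points to the right of \<open>p\<close>. So some germ is nontrivial,
  and by the dichotomy it moves every point near \<open>p\<close>.\<close>

lemma finite_orb_realized:
  assumes Y: "finite Y" "Y \<subseteq> carrier L" and o: "orb Y p q"
  obtains y b where "y \<in> Y" "orb {y} p b" "b \<le> q" "\<forall>\<^sub>F x in at_right p. y \<rhd> x \<noteq> x"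
proof -
  have fp: "y \<rhd> p = p" if "y \<in> Y" for y using that o by (auto simp: orb_def)
  have "\<exists>y\<in>Y. \<not> (\<forall>\<^sub>F x in at_right p. y \<rhd> x = x)"
  proof (rule ccontr)
    assume "\<not> ?thesis"
    then have "\<forall>\<^sub>F x in at_right p. \<forall>y\<in>Y. y \<rhd> x = x" using Y by (simp add: eventually_ball_finite)
    then obtain e where e: "e > p" "\<And>x y. p < x \<Longrightarrow> x < e \<Longrightarrow> y \<in> Y \<Longrightarrow> y \<rhd> x = x"
      unfolding eventually_at_right_field by blast
    obtain x where x: "p < x" "x < min e q" using e o dense[of p "min e q"] by (auto simp: orb_def)
    then have "\<exists>y\<in>Y. y \<rhd> x \<noteq> x" using o by (auto simp: orb_def)
    then show False using e x by auto
  qed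
  then obtain y where y: "y \<in> Y" "\<forall>\<^sub>F x in at_right p. y \<rhd> x \<noteq> x"
    using germ_dichotomy fp Y by blast
  then obtain b where b: "orb {y} p b" using orb_realized fp Y by blast
  have "b \<le> q" using orb_avoids_fixed[OF b, of q] o y by (auto simp: orb_def)
  with that y b show ?thesis by blast
qed

end

section \<open>Towers of orbitals and solubility\<close>

context pl_action begin

lemma fixed_point_between:
  assumes "h \<in> carrier L" "a \<le> h \<rhd> a" "h \<rhd> b \<le> b" "a \<le> b"
  obtains d where "a \<le> d" "d \<le> b" "h \<rhd> d = d"
proof -
  have "continuous_on {a..b} (\<lambda>y. y - h \<rhd> y)"
    by (intro continuous_intros continuous_on_subset[OF act_continuous]) (use assms in auto)
  then obtain d where "a \<le> d" "d \<le> b" "d - h \<rhd> d = 0"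
    using IVT'[of "\<lambda>y. y - h \<rhd> y" a 0 b] assms by auto
  then show ?thesis using that by auto
qed

section \<open>Elements supported away from the ends of all orbitals\<close>

definition compactly_supported :: "'a set \<Rightarrow> 'a set" where
  "compactly_supported Y = {w \<in> generate L Y. \<forall>p q. orb Y p q \<longrightarrow>
     (\<exists>u v. p < u \<and> u \<le> v \<and> v < q \<and> (\<forall>x. p < x \<and> x < q \<and> w \<rhd> x \<noteq> x \<longrightarrow> u \<le> x \<and> x \<le> v))}"

lemma compactly_supportedD:
  assumes "w \<in> compactly_supported Y" "orb Y p q"
  obtains u v where "p < u" "u \<le> v" "v < q"
    "\<And>x. \<lbrakk>p < x; x < q; w \<rhd> x \<noteq> x\<rbrakk> \<Longrightarrow> u \<le> x \<and> x \<le> v"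
  using assms unfolding compactly_supported_def by blast

lemma compactly_supported_subset: "compactly_supported Y \<subseteq> generate L Y"
  unfolding compactly_supported_def by blast

lemma compactly_supported_inv:
  assumes Y: "Y \<subseteq> carrier L" and w: "w \<in> compactly_supported Y"
  shows "inv w \<in> compactly_supported Y"
proof -
  have c: "w \<in> generate L Y" "w \<in> carrier L"
    using w generate_in_carrier[OF Y] by (auto simp: compactly_supported_def)
  have "inv w \<rhd> x \<noteq> x \<longleftrightarrow> w \<rhd> x \<noteq> x" for x using c by (metis inv_act_eq)
  then show ?thesis using w generate_m_inv_closed[OF Y c(1)] unfolding compactly_supported_def by simp
qed

lemma compactly_supported_mult:
  assumes Y: "Y \<subseteq> carrier L" and w: "w \<in> compactly_supported Y" and z: "z \<in> compactly_supported Y"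
  shows "w \<otimes> z \<in> compactly_supported Y"
  unfolding compactly_supported_def
proof (intro CollectI conjI allI impI)
  have c: "w \<in> generate L Y" "z \<in> generate L Y" using w z compactly_supported_subset by auto
  then show "w \<otimes> z \<in> generate L Y" by (rule generate.eng)
  fix p q assume o: "orb Y p q"
  obtain u v where uv: "p < u" "u \<le> v" "v < q" "\<And>x. \<lbrakk>p < x; x < q; w \<rhd> x \<noteq> x\<rbrakk> \<Longrightarrow> u \<le> x \<and> x \<le> v"
    using compactly_supportedD[OF w o] by blast
  obtain s t where st: "p < s" "s \<le> t" "t < q" "\<And>x. \<lbrakk>p < x; x < q; z \<rhd> x \<noteq> x\<rbrakk> \<Longrightarrow> s \<le> x \<and> x \<le> t"
    using compactly_supportedD[OF z o] by blast
  have "min u s \<le> x \<and> x \<le> max v t" if "p < x" "x < q" "(w \<otimes> z) \<rhd> x \<noteq> x" for x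
  proof (cases "z \<rhd> x = x")
    case True
    then have "w \<rhd> x \<noteq> x" using that c generate_in_carrier[OF Y] by (auto simp: act_mult)
    then show ?thesis using uv(4) that by force
  next
    case False
    then show ?thesis using st(4) that by force
  qed
  then show "\<exists>u v. p < u \<and> u \<le> v \<and> v < q \<and>
      (\<forall>x. p < x \<and> x < q \<and> (w \<otimes> z) \<rhd> x \<noteq> x \<longrightarrow> u \<le> x \<and> x \<le> v)"
    using uv st by (intro exI[of _ "min u s"] exI[of _ "max v t"]) auto
qed

lemma compactly_supported_conj:
  assumes Y: "Y \<subseteq> carrier L" and w: "w \<in> compactly_supported Y" and h: "h \<in> generate L Y"
  shows "h \<otimes> w \<otimes> inv h \<in> compactly_supported Y"
  unfolding compactly_supported_def
proof (intro CollectI conjI allI impI)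
  have wg: "w \<in> generate L Y" using w compactly_supported_subset by auto
  then show "h \<otimes> w \<otimes> inv h \<in> generate L Y" using h generate_m_inv_closed[OF Y h] by (blast intro: generate.eng)
  have c: "w \<in> carrier L" "h \<in> carrier L" using wg h generate_in_carrier[OF Y] by auto
  fix p q assume o: "orb Y p q"
  obtain u v where uv: "p < u" "u \<le> v" "v < q" "\<And>x. \<lbrakk>p < x; x < q; w \<rhd> x \<noteq> x\<rbrakk> \<Longrightarrow> u \<le> x \<and> x \<le> v"
    using compactly_supportedD[OF w o] by blast
  have "h \<rhd> u \<le> x \<and> x \<le> h \<rhd> v" if "p < x" "x < q" "(h \<otimes> w \<otimes> inv h) \<rhd> x \<noteq> x" for x
  proof -
    have "p < inv h \<rhd> x" "inv h \<rhd> x < q"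
      using orb_preserved[OF o Y generate_m_inv_closed[OF Y h]] that by auto
    moreover have "w \<rhd> inv h \<rhd> x \<noteq> inv h \<rhd> x" using that c by (auto simp: act_mult)
    ultimately have "u \<le> inv h \<rhd> x" "inv h \<rhd> x \<le> v" using uv(4) by auto
    then have "h \<rhd> u \<le> h \<rhd> inv h \<rhd> x" "h \<rhd> inv h \<rhd> x \<le> h \<rhd> v" using c(2) by (metis act_le_iff)+
    then show ?thesis using c by simp
  qed
  then show "\<exists>u v. p < u \<and> u \<le> v \<and> v < q \<and>
      (\<forall>x. p < x \<and> x < q \<and> (h \<otimes> w \<otimes> inv h) \<rhd> x \<noteq> x \<longrightarrow> u \<le> x \<and> x \<le> v)"
    using uv orb_preserved[OF o Y h, of u] orb_preserved[OF o Y h, of v] c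
    by (intro exI[of _ "h \<rhd> u"] exI[of _ "h \<rhd> v"]) auto
qed

text \<open>Both ends of an orbital are fixed by \<open>f\<close> and \<open>g\<close>, and
  one-sided germs at a common fixed point commute.\<close>

lemma compactly_supported_commutator:
  assumes Y: "Y \<subseteq> carrier L" and f: "f \<in> generate L Y" and g: "g \<in> generate L Y"
  shows "f \<otimes> g \<otimes> inv f \<otimes> inv g \<in> compactly_supported Y" (is "?w \<in> _")
  unfolding compactly_supported_def
proof (intro CollectI conjI allI impI)
  show "?w \<in> generate L Y" using f g generate_m_inv_closed[OF Y] by (blast intro: generate.eng)
  fix p q assume o: "orb Y p q"
  have fx: "h \<rhd> p = p" "h \<rhd> q = q" "h \<in> carrier L" if "h \<in> generate L Y" for h
    using generate_fixed[OF Y that] o that generate_in_carrier[OF Y] unfolding orb_def by blast+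
  have pq: "p < q" using o by (simp add: orb_def)
  obtain b where b: "b > p" "\<And>x. p < x \<Longrightarrow> x < b \<Longrightarrow> ?w \<rhd> x = x"
    using commutator_germ_right[of f p g] fx[OF f] fx[OF g] unfolding eventually_at_right_field by blast
  obtain e where e: "e > 0" "\<And>x. q - e < x \<Longrightarrow> x < q \<Longrightarrow> ?w \<rhd> x = x"
    using commutator_germ_left[of f q g] fx[OF f] fx[OF g] by blast
  \<comment> \<open>The midpoint ensures \<open>u \<le> v\<close>; the halves keep the bounds
    strictly inside \<open>(p, q)\<close>.\<close>
  let ?m = "(p + q) / 2"
  have "min ?m ((p + b) / 2) \<le> x \<and> x \<le> max ?m (q - e / 2)" if "p < x" "x < q" "?w \<rhd> x \<noteq> x" for x
  proof -
    have "b \<le> x" "x \<le> q - e" using b(2)[of x] e(2)[of x] that by force+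
    then show ?thesis using b(1) e(1) by auto
  qed
  then show "\<exists>u v. p < u \<and> u \<le> v \<and> v < q \<and> (\<forall>x. p < x \<and> x < q \<and> ?w \<rhd> x \<noteq> x \<longrightarrow> u \<le> x \<and> x \<le> v)"
    using pq b(1) e(1) by (intro exI[of _ "min ?m ((p + b) / 2)"] exI[of _ "max ?m (q - e / 2)"]) (auto simp: min_def max_def)
qed

text \<open>Terms of the derived series need not be finitely generated, but a single element
  involves only finitely many commutators, so a finite \<open>Y\<close> inside \<open>N\<close>
  suffices for it.\<close>

lemma derived_compactly_supported:
  assumes N: "subgroup N L" and g: "g \<in> derived L N"
  obtains Y where "finite Y" "Y \<subseteq> N" "g \<in> compactly_supported Y"
proof -
  have sub: "N \<subseteq> carrier L" using N by (rule subgroup.subset)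
  from g have "\<exists>Y. finite Y \<and> Y \<subseteq> N \<and>
      g \<in> generate L (derived_set L Y)"
    unfolding derived_def
  proof induction
    case one
    show ?case by (rule exI[of _ "{}"]) (auto intro: generate.one)
  next
    case (incl c)
    then obtain h k where "h \<in> N" "k \<in> N" "c = h \<otimes> k \<otimes> inv h \<otimes> inv k" by blast
    then show ?case by (intro exI[of _ "{h, k}"]) (auto intro: generate.incl)
  next
    case (inv c)
    then obtain h k where "h \<in> N" "k \<in> N" "c = h \<otimes> k \<otimes> inv h \<otimes> inv k" by blast
    then show ?case by (intro exI[of _ "{h, k}"]) (auto intro: generate.inv)
  next
    case (eng c d)
    then obtain Y Z where Y: "finite Y" "Y \<subseteq> N" "c \<in> generate L (derived_set L Y)"
      and Z: "finite Z" "Z \<subseteq> N" "d \<in> generate L (derived_set L Z)" by blast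
    let ?C = "derived_set L (Y \<union> Z)"
    have "c \<in> generate L ?C" by (rule subsetD[OF mono_generate Y(3)]) blast
    moreover have "d \<in> generate L ?C" by (rule subsetD[OF mono_generate Z(3)]) blast
    ultimately have "c \<otimes> d \<in> generate L ?C" by (rule generate.eng)
    then show ?case using Y Z by (intro exI[of _ "Y \<union> Z"]) auto
  qed
  then obtain Y where Y: "finite Y" "Y \<subseteq> N"
    and g: "g \<in> generate L (derived_set L Y)" by blast
  have Yc: "Y \<subseteq> carrier L" using Y sub by blast
  have comm: "c \<in> compactly_supported Y" if "c \<in> (derived_set L Y)" for c
  proof -
    from that obtain h k where "h \<in> Y" "k \<in> Y" "c = h \<otimes> k \<otimes> inv h \<otimes> inv k" by blast
    then show ?thesis
      using compactly_supported_commutator[OF Yc, of h k] generate.incl[of _ Y L] by simp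
  qed
  from g have "g \<in> compactly_supported Y"
  proof induction
    case one
    have "\<one> \<otimes> \<one> \<otimes> inv \<one> \<otimes> inv \<one> \<in> compactly_supported Y"
      by (intro compactly_supported_commutator[OF Yc] generate.one)
    then show ?case by simp
  next
    case (incl c)
    then show ?case by (rule comm)
  next
    case (inv c)
    then show ?case by (intro compactly_supported_inv[OF Yc] comm)
  next
    case (eng c d)
    then show ?case by (intro compactly_supported_mult[OF Yc])
  qed
  with Y that show ?thesis by blast
qed

text \<open>A one-sided variant of the transition chains of length two in the literature.\<close>

definition crossing :: bool where
  "crossing \<longleftrightarrow> (\<exists>Y f p q b. finite Y \<and> Y \<subseteq> carrier L \<and> f \<in> Y \<and> orb Y p q \<and> orb {f} p b \<and> b < q)"

section \<open>Nesting of orbitals in the absence of a crossing\<close>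

lemma orb_realized_if_not_crossing:
  assumes "\<not> crossing" "finite Y" "Y \<subseteq> carrier L" "orb Y p q"
  obtains y where "y \<in> Y" "orb {y} p q"
proof -
  obtain y b where "y \<in> Y" "orb {y} p b" "b \<le> q"
    using finite_orb_realized[OF assms(2-4)] by blast
  with assms that show ?thesis unfolding crossing_def by (metis order_le_less)
qed

text \<open>\<open>crossing\<close> speaks of left ends only. A shared right end is excluded by a
  commutator \<open>k\<close> that is trivial near \<open>b\<close> but moves \<open>a\<close>. The
  orbital of \<open>{f, k}\<close> around \<open>a\<close> reaches at least to \<open>b\<close>, and
  neither \<open>f\<close>, which fixes \<open>a\<close>, nor \<open>k\<close>, which fixes points
  just below \<open>b\<close>, can realize it.\<close>

lemma no_shared_right_end:
  assumes nc: "\<not> crossing" and f: "f \<in> carrier L" and g: "g \<in> carrier L"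
    and fo: "orb {f} a b" and og: "orb {g} c b" and "c < a"
  shows False
proof -
  have ab: "a < b" "f \<rhd> a = a" "f \<rhd> b = b" using fo by (auto simp: orb_def)
  have "g \<rhd> a \<noteq> a" using og \<open>c < a\<close> ab by (auto simp: orb_def)
  then obtain t where t: "t \<in> carrier L" "orb {t} c b" "t \<rhd> a < a"
    using g og orb_inv[OF g] inv_act_less[OF g, of a a] that by (metis inv_closed linorder_neqE)
  have tb: "t \<rhd> b = b" using t by (simp add: orb_def)
  define k where "k = inv f \<otimes> t \<otimes> inv (inv f) \<otimes> inv t"
  have k: "k \<in> carrier L" using f t by (simp add: k_def)
  obtain e where e: "e > 0" "\<And>x. b - e < x \<Longrightarrow> x < b \<Longrightarrow> k \<rhd> x = x"
    using commutator_germ_left[of "inv f" b t] f t tb ab unfolding k_def by (auto simp: inv_act_eq)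
  obtain y where y: "max a (b - e) < y" "y < b" using dense[of "max a (b - e)" b] ab e by auto
  have ky: "k \<rhd> y = y" using e y by simp
  \<comment> \<open>As \<open>inv t\<close> carries \<open>a\<close> into \<open>(a, b)\<close>, the
    conjugate of \<open>f\<close> by \<open>t\<close> moves \<open>a\<close>. Since \<open>f\<close>
    itself fixes \<open>a\<close>, the commutator moves \<open>a\<close> as well.\<close>
  have "a < inv t \<rhd> a" "inv t \<rhd> a < b" using t tb ab by (auto simp: less_inv_act inv_act_less)
  then have "f \<rhd> inv t \<rhd> a \<noteq> inv t \<rhd> a" using fo by (auto simp: orb_def)
  then have "t \<rhd> f \<rhd> inv t \<rhd> a \<noteq> a" using t by (metis act_inv1)
  then have ka: "k \<rhd> a \<noteq> a" using f t ab by (simp add: k_def act_mult inv_act_eq)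
  obtain p q where o: "orb {f, k} p q" "p < a" "a < q"
    using orb_exists[of "{f, k}" k a] f k ka by auto
  have "b \<le> q" using orb_avoids_fixed[OF fo, of q] o by (auto simp: orb_def)
  then have "y < q" "p < y" using y o by auto
  moreover obtain z where "z \<in> {f, k}" "orb {z} p q"
    using orb_realized_if_not_crossing[OF nc _ _ o(1)] f k by auto
  ultimately show False using ab ky o by (auto simp: orb_def)
qed

text \<open>The orbital of \<open>{f, g}\<close> around \<open>x\<close> is realized by one of the
  two, whose orbital therefore contains the other. A common left end with strict inclusion would be
  a crossing; a common right end is excluded by \<open>no_shared_right_end\<close>.\<close>

lemma orbs_nested:
  assumes nc: "\<not> crossing" and f: "f \<in> carrier L" and g: "g \<in> carrier L"
    and fo: "orb {f} a b" and og: "orb {g} c d" and x: "a < x" "x < b" "c < x" "x < d"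
  shows "(a = c \<and> b = d) \<or> (a < c \<and> d < b) \<or> (c < a \<and> b < d)"
proof -
  have main: "(a = c \<and> b = d) \<or> (a < c \<and> d < b)"
    if f: "f \<in> carrier L" and g: "g \<in> carrier L" and fo: "orb {f} a b" and og: "orb {g} c d"
      and o: "orb {f, g} a b" and x: "a < x" "x < b" "c < x" "x < d" for f g a b c d
  proof -
    have sub: "{g} \<subseteq> generate L {f, g}" by (auto intro: generate.incl)
    have le: "a \<le> c" "d \<le> b" using orb_within[OF og o _ sub] f g x by auto
    have "d = b" if "a = c"
      using nc le og o f g that unfolding crossing_def
      by (metis empty_subsetI finite.emptyI finite.insertI insertCI insert_subset order_le_less)
    moreover have "a = c" if "d = b"
      using no_shared_right_end[OF nc g f, of c b a] og fo that le by force
    ultimately show ?thesis using le by force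
  qed
  have "f \<rhd> x \<noteq> x" using fo x by (auto simp: orb_def)
  then obtain p q where o: "orb {f, g} p q" "p < x" "x < q"
    using orb_exists[of "{f, g}" f x] f g by auto
  obtain z where z: "z \<in> {f, g}" "orb {z} p q"
    using orb_realized_if_not_crossing[OF nc _ _ o(1)] f g by auto
  show ?thesis
  proof (cases "z = f")
    case True
    then have "p = a \<and> q = b" using orb_unique[OF fo, of p q x] z x o f by auto
    with main[OF f g fo og] o x show ?thesis by auto
  next
    case False
    then have "p = c \<and> q = d" using orb_unique[OF og, of p q x] z x o g by auto
    with main[OF g f og fo] o x show ?thesis by (auto simp: insert_commute)
  qed
qed

text \<open>The translate is an orbital of a conjugate, so nestedness applies. If \<open>h\<close>
  mapped \<open>[a, b]\<close> strictly inside, it would have a fixed point there, and the orbital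
  of \<open>h\<close> around \<open>a\<close> would end before \<open>b\<close>, overlapping
  \<open>(a, b)\<close> without nesting. The inverse treats expansion.\<close>

lemma translate_disjoint:
  assumes nc: "\<not> crossing" and h: "h \<in> carrier L" and g: "g \<in> carrier L"
    and og: "orb {g} a b" and x: "a < x" "x < b" "h \<rhd> a < x" "x < h \<rhd> b"
  shows "h \<rhd> a = a" "h \<rhd> b = b"
proof -
  have ab: "a < b" using x by simp
  have strict: False if h: "h \<in> carrier L" and s: "a < h \<rhd> a" "h \<rhd> b < b" for h
  proof -
    obtain d where d: "a \<le> d" "d \<le> b" "h \<rhd> d = d"
      using fixed_point_between[OF h, of a b] s ab by auto
    then have "d < b" using s by (auto simp: order_le_less)
    obtain c' d' where o: "orb {h} c' d'" "c' < a" "a < d'"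
      using orb_exists[of "{h}" h a] h s by auto
    have "d' \<le> d" using orb_avoids_fixed[OF o(1), of d] d o by auto
    moreover obtain y where "a < y" "y < d'" using dense o by blast
    ultimately show False using orbs_nested[OF nc h g o(1) og, of y] o \<open>d < b\<close> by auto
  qed
  have o: "orb {h \<otimes> g \<otimes> inv h} (h \<rhd> a) (h \<rhd> b)" by (rule orb_conj[OF h g og])
  have c: "h \<otimes> g \<otimes> inv h \<in> carrier L" using h g by simp
  have "(a = h \<rhd> a \<and> b = h \<rhd> b) \<or> (a < h \<rhd> a \<and> h \<rhd> b < b) \<or> (h \<rhd> a < a \<and> b < h \<rhd> b)"
    by (rule orbs_nested[OF nc g c og o x])
  moreover have "\<not> (h \<rhd> a < a \<and> b < h \<rhd> b)"
    using strict[of "inv h"] h by (auto simp: inv_act_less less_inv_act)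
  ultimately show "h \<rhd> a = a" "h \<rhd> b = b" using strict[OF h] by auto
qed

text \<open>If \<open>g\<close> fixed a point close to the left of \<open>e\<close>, affinity at
  \<open>e\<close> would make it trivial to the right of \<open>e\<close> as well. So another
  orbital ends where this one begins.\<close>

lemma adjacent_left_orb:
  assumes g: "g \<in> carrier L" and o: "orb {g} e e'" and aff: "affine_near ((\<rhd>) g) e"
  obtains d where "orb {g} d e"
proof -
  obtain m c where "\<forall>\<^sub>F y in nhds e. g \<rhd> y = m * y + c" using aff unfolding affine_near_def by blast
  then obtain r where r: "r > 0" "\<And>y. \<bar>y - e\<bar> < r \<Longrightarrow> g \<rhd> y = m * y + c"
    unfolding eventually_nhds_metric dist_real_def by blast
  have ge: "g \<rhd> e = e" "e < e'" using o by (auto simp: orb_def)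
  have moved: "g \<rhd> y \<noteq> y" if "e - r < y" "y < e" for y
  proof
    assume fx: "g \<rhd> y = y"
    obtain z where z: "e < z" "z < min e' (e + r)" using dense[of e "min e' (e + r)"] ge r by auto
    have "m * z + c = z" 
      by (rule affine_two_fixed_points[of m y c e]) (use r(2)[of y] r(2)[of e] that fx ge r(1) in auto)
    then have "g \<rhd> z = z" using r(2)[of z] z by auto
    then show False using o z by (auto simp: orb_def)
  qed
  obtain y where y: "e - r < y" "y < e" using dense[of "e - r" e] r by auto
  obtain p q where pq: "orb {g} p q" "p < y" "y < q"
    using orb_exists[of "{g}" g y] g moved y by blast
  have "q \<le> e" using orb_avoids_fixed[OF pq(1), of e] ge y pq by auto
  moreover have "\<not> q < e" using moved[of q] pq y by (auto simp: orb_def)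
  ultimately show ?thesis using that pq by simp
qed

text \<open>Walk to the left from \<open>a\<close> through orbitals of \<open>g\<close>: where
  \<open>g\<close> has no break at a left end, another orbital is adjacent, and its left end
  qualifies again. A walk that never stops accumulates at a point, against the affine right germ
  there.\<close>

lemma break_outside_translates:
  assumes nc: "\<not> crossing" and g0: "g0 \<in> carrier L" "orb {g0} p q"
    and g: "g \<in> carrier L" "orb {g} a b" and pa: "p < a" "b < q"
  obtains f x where "f \<in> carrier L" "p < x" "x < q" "\<not> affine_near ((\<rhd>) f) x"
    "\<And>h. h \<in> carrier L \<Longrightarrow> h \<rhd> x \<le> a \<or> b \<le> h \<rhd> x"
proof (rule ccontr)
  assume no: "\<not> thesis"
  note witness = that
  \<comment> \<open>Such an end is a break of the required kind unless \<open>g\<close> is affine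
    there.\<close>
  define E where "E = {e. p < e \<and> e < q \<and> (\<exists>e'. orb {g} e e') \<and>
    (\<forall>h\<in>carrier L. h \<rhd> e \<le> a \<or> b \<le> h \<rhd> e)}"
  have ab: "a < b" using g by (simp add: orb_def)
  have "h \<rhd> a \<le> a \<or> b \<le> h \<rhd> a" if h: "h \<in> carrier L" for h
  proof (rule ccontr)
    assume *: "\<not> ?thesis"
    obtain x where "h \<rhd> a < x" "x < min b (h \<rhd> b)"
      using dense[of "h \<rhd> a" "min b (h \<rhd> b)"] * ab h by auto
    then show False using translate_disjoint(1)[OF nc h g, of x] * by auto
  qed
  then have aE: "a \<in> E" using pa ab g unfolding E_def by force
  have down: "\<exists>d\<in>E. d < e" if e: "e \<in> E" for e
  proof -
    obtain e' where e': "orb {g} e e'" using e by (auto simp: E_def)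
    have "affine_near ((\<rhd>) g) e" using no witness[of g e] e g by (auto simp: E_def)
    then obtain d where d: "orb {g} d e" using adjacent_left_orb[OF g(1) e'] by blast
    have de: "d < e" using d by (simp add: orb_def)
    obtain x where x: "max d p < x" "x < e" using dense[of "max d p" e] de e by (auto simp: E_def)
    \<comment> \<open>Nestedness with the orbital \<open>(p, q)\<close> of \<open>g0\<close> keeps
      the walk inside.\<close>
    have "p < d" using orbs_nested[OF nc g0(1) g(1) g0(2) d, of x] x e by (auto simp: E_def)
    moreover have "h \<rhd> d \<le> a \<or> b \<le> h \<rhd> d" if h: "h \<in> carrier L" for h
    proof (rule ccontr)
      assume *: "\<not> ?thesis"
      have o: "orb {h \<otimes> g \<otimes> inv h} (h \<rhd> d) (h \<rhd> e)" by (rule orb_conj[OF h g(1) d])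
      obtain y where "h \<rhd> d < y" "y < min b (h \<rhd> e)"
        using dense[of "h \<rhd> d" "min b (h \<rhd> e)"] * de h by auto
      \<comment> \<open>A translate of \<open>(d, e)\<close> starting inside \<open>(a, b)\<close>
        is nested in it, so its right end enters \<open>(a, b)\<close> too, which
        \<open>e \<in> E\<close> forbids.\<close>
      then have "h \<rhd> e < b" using orbs_nested[OF nc g(1) _ g(2) o, of y] * h g by auto
      moreover have "a < h \<rhd> e" using * act_mono[OF h de] by auto
      ultimately show False using e h by (force simp: E_def)
    qed
    ultimately have "d \<in> E" using de e d unfolding E_def by auto
    with de show ?thesis by blast
  qed
  define m where "m = Inf E"
  have bdd: "bdd_below E" by (rule bdd_belowI[of _ p]) (auto simp: E_def)
  have m_less: "m < e" if "e \<in> E" for e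
    using down[OF that] cInf_lower[OF _ bdd] unfolding m_def by force
  obtain r s c where r: "r > 0" "\<And>y. y \<in> {m..m + r} \<Longrightarrow> g \<rhd> y = s * y + c"
    using germ_right[OF g(1), of m] by blast
  \<comment> \<open>Two members of \<open>E\<close> just to the right of \<open>m\<close> are fixed
    points of \<open>g\<close> in one interval of affinity, but \<open>g\<close> moves points
    between them.\<close>
  obtain e where e: "e \<in> E" "e < m + r"
    using cInf_lessD[of E "m + r"] aE r unfolding m_def by auto
  obtain d where d: "d \<in> E" "d < e" using down[OF e(1)] by blast
  have fx: "g \<rhd> d = d" "g \<rhd> e = e" using d e by (auto simp: E_def orb_def)
  obtain d' where d': "orb {g} d d'" using d by (auto simp: E_def)
  obtain y where y: "d < y" "y < min e d'" using dense[of d "min e d'"] d d' by (auto simp: orb_def)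
  have "s * y + c = y"
    by (rule affine_two_fixed_points[of s d c e])
      (use r(2)[of d] r(2)[of e] fx m_less[OF d(1)] m_less[OF e(1)] d(2) e(2) in auto)
  then have "g \<rhd> y = y" using r(2)[of y] y m_less[OF d(1)] e(2) by auto
  then show False using d' y by (auto simp: orb_def)
qed

section \<open>Breakpoints up to the group action and the solubility bound\<close>

lemma affine_near_inv:
  assumes f: "f \<in> carrier L" and aff: "affine_near ((\<rhd>) f) y"
  shows "affine_near ((\<rhd>) (inv f)) (f \<rhd> y)"
proof -
  obtain m c where mc: "\<forall>\<^sub>F z in nhds y. f \<rhd> z = m * z + c" using aff unfolding affine_near_def by blast
  have "m \<noteq> 0"
  proof
    assume "m = 0"
    then obtain r where r: "r > 0" "\<And>z. \<bar>z - y\<bar> < r \<Longrightarrow> f \<rhd> z = c"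
      using mc unfolding eventually_nhds_metric dist_real_def by auto
    then have "f \<rhd> y = c" "f \<rhd> (y + r / 2) = c" by auto
    then have "y + r / 2 = y" using act_eq_iff[OF f] by metis
    then show False using r by simp
  qed
  have "filterlim ((\<rhd>) (inv f)) (nhds (inv f \<rhd> f \<rhd> y)) (nhds (f \<rhd> y))"
    using act_isCont[of "inv f" "f \<rhd> y"] f unfolding continuous_at tendsto_at_iff_tendsto_nhds by simp
  then have "filterlim ((\<rhd>) (inv f)) (nhds y) (nhds (f \<rhd> y))" using f by simp
  from eventually_compose_filterlim[OF mc this]
  have "\<forall>\<^sub>F z in nhds (f \<rhd> y). inv f \<rhd> z = (1 / m) * z + (- c / m)"
    by eventually_elim (use f \<open>m \<noteq> 0\<close> in \<open>simp add: field_simps\<close>)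
  then show ?thesis unfolding affine_near_def by blast
qed

lemma affine_near_mult:
  assumes f: "f \<in> carrier L" and g: "g \<in> carrier L"
    and aff: "affine_near ((\<rhd>) g) x" "affine_near ((\<rhd>) f) (g \<rhd> x)"
  shows "affine_near ((\<rhd>) (f \<otimes> g)) x"
proof -
  obtain m c where mc: "\<forall>\<^sub>F z in nhds (g \<rhd> x). f \<rhd> z = m * z + c" using aff unfolding affine_near_def by blast
  obtain n d where nd: "\<forall>\<^sub>F z in nhds x. g \<rhd> z = n * z + d" using aff unfolding affine_near_def by blast
  have "filterlim ((\<rhd>) g) (nhds (g \<rhd> x)) (nhds x)"
    using act_isCont[OF g, of x] unfolding continuous_at tendsto_at_iff_tendsto_nhds .
  from eventually_compose_filterlim[OF mc this] nd
  have "\<forall>\<^sub>F z in nhds x. (f \<otimes> g) \<rhd> z = (m * n) * z + (m * d + c)"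
    by eventually_elim (use f g in \<open>simp add: act_mult algebra_simps\<close>)
  then show ?thesis unfolding affine_near_def by blast
qed

text \<open>By the chain rule a break of \<open>f g\<close> at \<open>x\<close> is a break of
  \<open>g\<close> at \<open>x\<close> or of \<open>f\<close> at \<open>g x\<close>. Hence every
  break of every element is moved by the group to a break of one of the finitely many
  generators.\<close>

lemma break_orbits_finite:
  assumes X: "finite A" "A \<subseteq> carrier L"
  obtains F where "finite F"
    "\<And>g x. \<lbrakk>g \<in> generate L A; \<not> affine_near ((\<rhd>) g) x\<rbrakk> \<Longrightarrow> \<exists>h\<in>generate L A. h \<rhd> x \<in> F"
proof
  define F where "F = (\<Union>f\<in>A. {x. \<not> affine_near ((\<rhd>) f) x})"
  show "finite F" unfolding F_def using X finite_breaks by blast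
  fix g x assume "g \<in> generate L A" "\<not> affine_near ((\<rhd>) g) x"
  then show "\<exists>h\<in>generate L A. h \<rhd> x \<in> F"
  proof (induction arbitrary: x)
    case one
    have "\<forall>\<^sub>F y in nhds x. \<one> \<rhd> y = 1 * y + 0" by (simp add: act_one)
    then have "affine_near ((\<rhd>) \<one>) x" unfolding affine_near_def by blast
    with one show ?case by blast
  next
    case (incl f)
    then have "\<one> \<rhd> x \<in> F" by (auto simp: F_def act_one)
    then show ?case by (blast intro: generate.one)
  next
    case (inv f)
    have f: "f \<in> carrier L" using inv X by blast
    then have "\<not> affine_near ((\<rhd>) f) (inv f \<rhd> x)" using affine_near_inv[OF f, of "inv f \<rhd> x"] inv by auto
    then have "inv f \<rhd> x \<in> F" using inv by (auto simp: F_def)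
    then show ?case using inv by (blast intro: generate.inv)
  next
    case (eng f g)
    have c: "f \<in> carrier L" "g \<in> carrier L" using eng generate_in_carrier[OF X(2)] by auto
    show ?case
    proof (cases "affine_near ((\<rhd>) g) x")
      case True
      then have "\<not> affine_near ((\<rhd>) f) (g \<rhd> x)" using affine_near_mult[OF c] eng.prems by blast
      then obtain h where h: "h \<in> generate L A" "h \<rhd> g \<rhd> x \<in> F" using eng.IH(1) by blast
      then have "(h \<otimes> g) \<rhd> x \<in> F" using c generate_in_carrier[OF X(2)] by (simp add: act_mult)
      then show ?thesis using h eng by (blast intro: generate.eng)
    qed (use eng in blast)
  qed
qed

text \<open>The support of \<open>g\<close> stays away from the ends of the surrounding orbital of a
  finite \<open>Y\<close>. Without crossing that orbital belongs to a single member of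
  \<open>Y\<close>, and \<open>Y\<close> lies in \<open>N\<close>.\<close>

lemma larger_orb_in_group:
  assumes nc: "\<not> crossing" and N: "subgroup N L" and g: "g \<in> derived L N" "orb {g} a b"
  obtains k p q where "k \<in> N" "orb {k} p q" "p < a" "b < q"
proof -
  obtain Y where Y: "finite Y" "Y \<subseteq> N" "g \<in> compactly_supported Y"
    using derived_compactly_supported[OF N g(1)] .
  have Yc: "Y \<subseteq> carrier L" using Y subgroup.subset[OF N] by blast
  have gg: "g \<in> generate L Y" using Y compactly_supported_subset by blast
  have gc: "g \<in> carrier L" using generate_in_carrier[OF Yc gg] .
  obtain x where x: "a < x" "x < b" using dense[of a b] g by (auto simp: orb_def)
  then have "g \<rhd> x \<noteq> x" using g by (auto simp: orb_def)
  then obtain y where "y \<in> Y" "y \<rhd> x \<noteq> x" using generate_fixed[OF Yc gg] by blast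
  then obtain p q where pq: "orb Y p q" "p < x" "x < q" using orb_exists[OF Yc] by blast
  obtain u v where uv: "p < u" "u \<le> v" "v < q" "\<And>x. \<lbrakk>p < x; x < q; g \<rhd> x \<noteq> x\<rbrakk> \<Longrightarrow> u \<le> x \<and> x \<le> v"
    using compactly_supportedD[OF Y(3) pq(1)] by blast
  have sub: "p \<le> a \<and> b \<le> q" using orb_within[OF g(2) pq(1) Yc _ x pq(2,3)] gg by blast
  have moved: "u \<le> z \<and> z \<le> v" if "a < z" "z < b" for z
    using uv(4)[of z] that sub g(2) by (auto simp: orb_def)
  have "p < a"
  proof (rule ccontr)
    assume "\<not> p < a"
    then obtain z where "a < z" "z < min u b" using dense[of a "min u b"] sub uv x by auto
    then show False using moved[of z] by auto
  qed
  moreover have "b < q"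
  proof (rule ccontr)
    assume "\<not> b < q"
    then obtain z where "max v a < z" "z < b" using dense[of "max v a" b] sub uv x by auto
    then show False using moved[of z] by auto
  qed
  moreover obtain y where "y \<in> Y" "orb {y} p q"
    using orb_realized_if_not_crossing[OF nc Y(1) Yc pq(1)] .
  ultimately show ?thesis using that Y by blast
qed

theorem solvable_if_not_crossing:
  assumes nc: "\<not> crossing" and X: "finite A" "A \<subseteq> carrier L" "generate L A = carrier L"
  shows "solvable L"
proof -
  obtain F where F: "finite F"
    "\<And>g x. \<lbrakk>g \<in> carrier L; \<not> affine_near ((\<rhd>) g) x\<rbrakk> \<Longrightarrow> \<exists>h\<in>carrier L. h \<rhd> x \<in> F"
    using break_orbits_finite[OF X(1,2)] X(3) by metis
  \<comment> \<open>\<open>T\<close> holds one representative for each level passed. That its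
    translates avoid \<open>(a, b)\<close> is the invariant that makes the next representative,
    which comes from inside, a new one.\<close>
  have tower: "\<exists>T\<subseteq>F. card T = n \<and> (\<forall>s\<in>T. \<forall>h\<in>carrier L. h \<rhd> s \<le> a \<or> b \<le> h \<rhd> s)"
    if "g \<in> (derived L ^^ n) (carrier L)" "orb {g} a b" for n g a b
    using that
  proof (induction n arbitrary: g a b)
    case 0
    then show ?case by (intro exI[of _ "{}"]) auto
  next
    case (Suc n)
    let ?N = "(derived L ^^ n) (carrier L)"
    have N: "subgroup ?N L" by (rule exp_of_derived_is_subgroup[OF subgroup_self])
    have gN: "g \<in> derived L ?N" using Suc.prems by simp
    obtain k p q where k: "k \<in> ?N" "orb {k} p q" "p < a" "b < q"
      using larger_orb_in_group[OF nc N gN Suc.prems(2)] .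
    have c: "k \<in> carrier L" "g \<in> carrier L"
      using k subgroup.subset[OF N] derived_in_carrier[OF subgroup.subset[OF N]] gN by auto
    obtain T where T: "T \<subseteq> F" "card T = n" "\<And>s h. \<lbrakk>s \<in> T; h \<in> carrier L\<rbrakk> \<Longrightarrow> h \<rhd> s \<le> p \<or> q \<le> h \<rhd> s"
      using Suc.IH[OF k(1,2)] by blast
    obtain f x where x: "f \<in> carrier L" "p < x" "x < q" "\<not> affine_near ((\<rhd>) f) x"
      "\<And>h. h \<in> carrier L \<Longrightarrow> h \<rhd> x \<le> a \<or> b \<le> h \<rhd> x"
      using break_outside_translates[OF nc c(1) k(2) c(2) Suc.prems(2) k(3,4)] by blast
    obtain h where h: "h \<in> carrier L" "h \<rhd> x \<in> F" using F(2)[OF x(1,4)] by blast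
    have "h \<rhd> x \<notin> T"
    proof
      assume "h \<rhd> x \<in> T"
      then have "inv h \<rhd> h \<rhd> x \<le> p \<or> q \<le> inv h \<rhd> h \<rhd> x" using T(3) h by blast
      then show False using h x by simp
    qed
    moreover have "finite T" using T(1) F(1) finite_subset by blast
    moreover have "k \<rhd> h \<rhd> x \<le> a \<or> b \<le> k \<rhd> h \<rhd> x" if "k \<in> carrier L" for k
      using x(5)[of "k \<otimes> h"] h that by (simp add: act_mult)
    moreover have "k \<rhd> s \<le> a \<or> b \<le> k \<rhd> s" if "k \<in> carrier L" "s \<in> T" for k s
      using T(3)[OF that(2,1)] k by auto
    ultimately show ?case using T h by (intro exI[of _ "insert (h \<rhd> x) T"]) auto
  qed
  \<comment> \<open>One step more than \<open>F\<close> has members: a nontrivial element here would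
    yield \<open>card F + 1\<close> distinct members of \<open>F\<close>.\<close>
  let ?N = "(derived L ^^ Suc (card F)) (carrier L)"
  have N: "subgroup ?N L" by (rule exp_of_derived_is_subgroup[OF subgroup_self])
  have "g = \<one>" if g: "g \<in> ?N" for g
  proof (rule ccontr)
    assume "g \<noteq> \<one>"
    have gc: "g \<in> carrier L" using g subgroup.subset[OF N] by blast
    then obtain x where "g \<rhd> x \<noteq> x" using faithful \<open>g \<noteq> \<one>\<close> by blast
    then obtain a b where "orb {g} a b" using orb_exists[of "{g}" g x] gc by blast
    then obtain T where "T \<subseteq> F" "card T = Suc (card F)" using tower[OF g] by blast
    then show False using card_mono[OF F(1), of T] by simp
  qed
  then have "?N = {\<one>}" using subgroup.one_closed[OF N] by blast
  then show ?thesis using solvable_iff_trivial_derived_seq by blast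
qed

end

section \<open>Displacement of intervals\<close>

context pl_action begin

definition displaces :: "'a \<Rightarrow> real \<Rightarrow> real \<Rightarrow> bool" where
  "displaces h u v \<longleftrightarrow> h \<rhd> v < u \<or> v < h \<rhd> u"

lemma displaces_inv: "h \<in> carrier L \<Longrightarrow> displaces (inv h) u v \<longleftrightarrow> displaces h u v"
  by (auto simp: displaces_def inv_act_less less_inv_act)

lemma displaces_mono:
  "\<lbrakk>h \<in> carrier L; displaces h u v; u \<le> u'; v' \<le> v\<rbrakk> \<Longrightarrow> displaces h u' v'"
  unfolding displaces_def by (meson act_le_iff le_less_trans less_le_trans)

lemma not_displaces_fixed:
  "\<lbrakk>h \<in> carrier L; h \<rhd> d = d; u \<le> d; d \<le> v\<rbrakk> \<Longrightarrow> \<not> displaces h u v"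
  unfolding displaces_def using act_le_iff[of h u d] act_le_iff[of h d v] by auto

text \<open>Replace \<open>w\<close> by its inverse if necessary so that it raises \<open>z\<close>,
  and take \<open>x\<close> so close below \<open>z\<close> that one application carries it beyond
  \<open>z\<close>. Further applications only raise it.\<close>

lemma displaced_by_powers:
  assumes w: "w \<in> carrier L" "w \<rhd> z \<noteq> z" and c: "c < z"
  obtains x where "c < x" "x < z" "\<And>m::int. m \<noteq> 0 \<Longrightarrow> displaces (w [^] m) x z"
proof -
  obtain t where t: "t = w \<or> t = inv w" "t \<rhd> z > z" "t \<in> carrier L"
  proof (cases "w \<rhd> z > z")
    case True
    then show ?thesis using that w by blast
  next
    case False
    then have "inv w \<rhd> z > z" using w by (simp add: less_inv_act)
    then show ?thesis using that w by blast
  qed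
  have "inv t \<rhd> z < z" using t by (simp add: inv_act_less)
  then obtain x where x: "max c (inv t \<rhd> z) < x" "x < z" using dense[of "max c (inv t \<rhd> z)" z] c by auto
  then have tx: "z < t \<rhd> x" using t by (simp add: inv_act_less)
  have up: "z < t [^] Suc n \<rhd> x" for n
  proof (induction n)
    case 0
    then show ?case using tx t by simp
  next
    case (Suc n)
    have "x < t [^] Suc n \<rhd> x" using Suc x by simp
    then have "t \<rhd> x < t \<rhd> t [^] Suc n \<rhd> x" using t by simp
    then have "t \<rhd> x < t [^] Suc (Suc n) \<rhd> x" using t nat_pow_Suc2[of t "Suc n"] by (simp add: act_mult)
    then show ?case using tx by simp
  qed
  have "displaces (w [^] m) x z" if m0: "m \<noteq> 0" for m :: int
  proof -
    obtain n where n: "nat \<bar>m\<bar> = Suc n" using m0 by (cases "nat \<bar>m\<bar>") auto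
    have d: "displaces (t [^] Suc n) x z" using up unfolding displaces_def by blast
    have ti: "inv (w [^] Suc n) = inv w [^] Suc n" using w by (simp only: nat_pow_inv)
    have "displaces (w [^] Suc n) x z"
      using t(1) d ti displaces_inv[of "w [^] Suc n"] w by (metis nat_pow_closed)
    moreover have "w [^] m = w [^] Suc n \<or> w [^] m = inv (w [^] Suc n)"
      using n m0 by (cases "m < 0") (simp_all add: int_pow_def2)
    ultimately show ?thesis using displaces_inv[of "w [^] Suc n"] w by (metis nat_pow_closed)
  qed
  then show ?thesis using that x by auto
qed

lemma act_commute_closure:
  assumes u: "u \<in> carrier L" and v: "v \<in> carrier L"
    and D: "\<And>x. x \<in> D \<Longrightarrow> u \<rhd> v \<rhd> x = v \<rhd> u \<rhd> x" and y: "y \<in> closure D"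
  shows "u \<rhd> v \<rhd> y = v \<rhd> u \<rhd> y"
proof -
  have cont: "continuous_on UNIV (\<lambda>x. u \<rhd> v \<rhd> x)" "continuous_on UNIV (\<lambda>x. v \<rhd> u \<rhd> x)"
    using continuous_on_compose2[OF act_continuous[OF u] act_continuous[OF v]]
      continuous_on_compose2[OF act_continuous[OF v] act_continuous[OF u]] by auto
  have "closed {x. u \<rhd> v \<rhd> x = v \<rhd> u \<rhd> x}" by (rule closed_Collect_eq[OF cont])
  then have "closure D \<subseteq> {x. u \<rhd> v \<rhd> x = v \<rhd> u \<rhd> x}" by (intro closure_minimal) (use D in auto)
  with y show ?thesis by blast
qed

text \<open>The ends are limits of points of \<open>D\<close>, so \<open>v\<close> sends them to
  fixed points of \<open>u\<close>. If an end moved, some \<open>t\<close> among \<open>v\<close>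
  and its inverse would carry \<open>(a, b)\<close> beyond \<open>b\<close>. The intervals
  \<open>t^n (a, b)\<close> then accumulate from the left at a point, each with fixed ends and an
  inner point moved by \<open>u\<close>, against the affine germ of \<open>u\<close>. Commutation is
  assumed only on \<open>D\<close> because the application tests a commutator on a single group
  orbit.\<close>

lemma commuting_fixes_orb_ends:
  assumes u: "u \<in> carrier L" and v: "v \<in> carrier L"
    and inv: "\<And>x. x \<in> D \<Longrightarrow> u \<rhd> x \<in> D \<and> inv u \<rhd> x \<in> D \<and> v \<rhd> x \<in> D \<and> inv v \<rhd> x \<in> D"
    and comm: "\<And>x. x \<in> D \<Longrightarrow> u \<rhd> v \<rhd> x = v \<rhd> u \<rhd> x"
    and o: "orb {u} a b" and z: "z \<in> D" "a < z" "z < b"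
  shows "v \<rhd> a = a \<and> v \<rhd> b = b"
proof (rule ccontr)
  assume no: "\<not> (v \<rhd> a = a \<and> v \<rhd> b = b)"
  have uab: "u \<rhd> a = a" "u \<rhd> b = b" "a < b" "b \<le> 1" using o by (auto simp: orb_def)
  have uc: "{u} \<subseteq> carrier L" using u by simp
  have gD: "g \<rhd> z \<in> D" if "g \<in> generate L {u}" for g
    using that
  proof -
    have "\<forall>x\<in>D. g \<rhd> x \<in> D" using that
      by induction (use inv generate_in_carrier[OF uc] in \<open>auto simp: act_one act_mult\<close>)
    then show ?thesis using z by blast
  qed
  \<comment> \<open>The orbit of \<open>z\<close> under \<open>u\<close> stays in \<open>D\<close>
    and comes arbitrarily near both ends.\<close>
  have acl: "a \<in> closure D"
  proof (rule closure_approachable[THEN iffD2], intro allI impI)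
    fix e :: real assume "e > 0"
    then obtain g where g: "g \<in> generate L {u}" "g \<rhd> z < a + e"
      using orbit_down[OF uc o z(2,3), of "a + e"] by auto
    then have "a < g \<rhd> z" using orb_preserved[OF o uc _ z(2,3)] by blast
    then show "\<exists>y\<in>D. dist y a < e" using g gD by (intro bexI[of _ "g \<rhd> z"]) (auto simp: dist_real_def)
  qed
  have bcl: "b \<in> closure D"
  proof (rule closure_approachable[THEN iffD2], intro allI impI)
    fix e :: real assume "e > 0"
    then obtain g where g: "g \<in> generate L {u}" "b - e < g \<rhd> z"
      using orbit_up[OF uc o z(2,3), of "b - e"] by auto
    then have "g \<rhd> z < b" using orb_preserved[OF o uc _ z(2,3)] by blast
    then show "\<exists>y\<in>D. dist y b < e" using g gD by (intro bexI[of _ "g \<rhd> z"]) (auto simp: dist_real_def)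
  qed
  have ends: "u \<rhd> t \<rhd> a = t \<rhd> a" "u \<rhd> t \<rhd> b = t \<rhd> b"
    if "t \<in> carrier L" "\<And>x. x \<in> D \<Longrightarrow> u \<rhd> t \<rhd> x = t \<rhd> u \<rhd> x" for t
    using act_commute_closure[OF u that(1) that(2) acl] act_commute_closure[OF u that(1) that(2) bcl] uab by auto
  have commi: "u \<rhd> inv v \<rhd> x = inv v \<rhd> u \<rhd> x" if "x \<in> D" for x
    using comm[of "inv v \<rhd> x"] inv[OF that] v by (metis act_inv1 act_inv2)
  \<comment> \<open>Fixed points of \<open>u\<close> do not lie inside \<open>(a, b)\<close>, so an
    end that moves has to jump over the whole orbital.\<close>
  have step: "b \<le> t \<rhd> a" if t: "t \<in> carrier L" "\<And>x. x \<in> D \<Longrightarrow> u \<rhd> t \<rhd> x = t \<rhd> u \<rhd> x"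
    "\<And>x. x \<in> D \<Longrightarrow> u \<rhd> inv t \<rhd> x = inv t \<rhd> u \<rhd> x" and lt: "a < t \<rhd> a \<or> b < t \<rhd> b" for t
    using lt
  proof
    assume "a < t \<rhd> a"
    then show ?thesis using orb_avoids_fixed[OF o, of "t \<rhd> a"] ends(1)[OF t(1,2)] by auto
  next
    assume "b < t \<rhd> b"
    then have "inv t \<rhd> b < b" using t by (simp add: inv_act_less)
    then have "inv t \<rhd> b \<le> a" using orb_avoids_fixed[OF o, of "inv t \<rhd> b"] ends(2)[of "inv t"] t by auto
    then show ?thesis using t by (metis act_inv2 act_le_iff)
  qed
  obtain t where t: "t \<in> carrier L" "b \<le> t \<rhd> a" "\<And>x. x \<in> D \<Longrightarrow> u \<rhd> t \<rhd> x = t \<rhd> u \<rhd> x"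
    "\<And>x. x \<in> D \<Longrightarrow> t \<rhd> x \<in> D"
  proof (cases "a < v \<rhd> a \<or> b < v \<rhd> b")
    case True
    then have "b \<le> v \<rhd> a" by (intro step v comm commi)
    then show ?thesis using that[of v] v comm inv by blast
  next
    case False
    then have "v \<rhd> a < a \<or> v \<rhd> b < b" using no by linarith
    then have "a < inv v \<rhd> a \<or> b < inv v \<rhd> b" using v by (simp add: less_inv_act)
    then have "b \<le> inv v \<rhd> a" using step[of "inv v"] v comm commi by simp
    then show ?thesis using that[of "inv v"] v commi inv by blast
  qed
  have tn: "t [^] n \<in> carrier L" for n :: nat using t by simp
  have tnD: "t [^] n \<rhd> x \<in> D \<and> u \<rhd> t [^] n \<rhd> x = t [^] n \<rhd> u \<rhd> x" if "x \<in> D" for n :: nat and x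
    using that
  proof (induction n arbitrary: x)
    case (Suc n)
    have "t \<rhd> x \<in> D" using t Suc by blast
    then show ?case using Suc.IH[of "t \<rhd> x"] t(3)[OF Suc.prems] t(1) by (simp add: act_mult)
  qed (simp add: act_one)
  define Xs where "Xs = range (\<lambda>n::nat. t [^] n \<rhd> a)"
  define s where "s = Sup Xs"
  have bdd: "bdd_above Xs"
    unfolding Xs_def by (rule bdd_aboveI2[of _ _ 1]) (metis act_le_iff act_outside order_refl tn uab(3,4) less_le_trans less_imp_le)
  obtain e m c where e: "e > 0" "\<And>y. y \<in> {s - e..s} \<Longrightarrow> u \<rhd> y = m * y + c"
    using germ_left[OF u, of s] by blast
  have "Xs \<noteq> {}" by (simp add: Xs_def)
  then have "\<exists>y\<in>Xs. s - e < y" using less_cSup_iff[OF _ bdd, of "s - e"] e by (simp add: s_def)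
  then obtain n :: nat where n: "s - e < t [^] n \<rhd> a" unfolding Xs_def by blast
  have n1: "t [^] Suc n \<rhd> a \<le> s"
    unfolding s_def by (rule cSup_upper[OF _ bdd]) (unfold Xs_def, rule rangeI)
  have lt: "t [^] n \<rhd> a < t [^] n \<rhd> z" using tn z by simp
  have "t [^] n \<rhd> z < t [^] n \<rhd> b" using tn z by simp
  also have "\<dots> \<le> t [^] n \<rhd> t \<rhd> a" using tn t by simp
  finally have lt2: "t [^] n \<rhd> z < t [^] Suc n \<rhd> a" using t by (simp add: act_mult)
  have fx: "u \<rhd> t [^] k \<rhd> a = t [^] k \<rhd> a" for k :: nat
    using ends(1)[OF tn] tnD by blast
  have "m * (t [^] n \<rhd> z) + c = t [^] n \<rhd> z"
    by (rule affine_two_fixed_points[of m "t [^] n \<rhd> a" c "t [^] Suc n \<rhd> a"])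
      (use e(2)[of "t [^] n \<rhd> a"] e(2)[of "t [^] Suc n \<rhd> a"] n n1 lt lt2 fx[of n] fx[of "Suc n"] in auto)
  then have "u \<rhd> t [^] n \<rhd> z = t [^] n \<rhd> z" using e(2)[of "t [^] n \<rhd> z"] n n1 lt lt2 by auto
  then have "t [^] n \<rhd> u \<rhd> z = t [^] n \<rhd> z" using tnD[OF z(1)] by simp
  then have "u \<rhd> z = z" using act_eq_iff[OF tn] by simp
  then show False using o z by (auto simp: orb_def)
qed

lemma commute_at:
  assumes "u \<in> carrier L" "v \<in> carrier L"
    and "u \<rhd> y = y \<or> v \<rhd> y = y" "u \<rhd> v \<rhd> y = v \<rhd> y \<or> v \<rhd> v \<rhd> y = v \<rhd> y"
      "u \<rhd> u \<rhd> y = u \<rhd> y \<or> v \<rhd> u \<rhd> y = u \<rhd> y"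
  shows "u \<rhd> v \<rhd> y = v \<rhd> u \<rhd> y"
  using assms by (metis act_eq_iff)

definition active :: "'a \<Rightarrow> real \<Rightarrow> real \<Rightarrow> bool" where
  "active w p q \<longleftrightarrow> (\<exists>x. p < x \<and> x < q \<and> w \<rhd> x \<noteq> x)"

end

text \<open>The group generated by \<open>Y\<close> may be smaller than \<open>L\<close>: a crossing
  only supplies some finite subset of the group.\<close>

locale pl_fin_gen = pl_action +
  fixes Y :: "'a set"
  assumes fin: "finite Y" and Y: "Y \<subseteq> carrier L"
begin

abbreviation "H \<equiv> generate L Y"

lemma H_carrier: "h \<in> H \<Longrightarrow> h \<in> carrier L"
  using generate_in_carrier[OF Y] .

lemma H_inv: "h \<in> H \<Longrightarrow> inv h \<in> H"
  using generate_m_inv_closed[OF Y] .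

lemma H_one: "\<one> \<in> H"
  by (rule generate.one)

lemma H_mult: "\<lbrakk>g \<in> H; h \<in> H\<rbrakk> \<Longrightarrow> g \<otimes> h \<in> H"
  by (rule generate.eng)

lemma H_generate: "f \<in> H \<Longrightarrow> generate L {f} \<subseteq> H"
  using generate_subgroup_incl[OF _ generate_is_subgroup[OF Y]] by simp

lemma H_preserves:
  assumes "orb Y p q" "h \<in> H" "p < x" "x < q"
  shows "p < h \<rhd> x" "h \<rhd> x < q"
  using orb_preserved[OF assms(1) Y assms(2-)] by auto

lemma affine_intervals:
  obtains e where "e > 0" "\<And>f. f \<in> Y \<Longrightarrow> \<exists>m c. \<forall>y\<in>{z..z + e}. f \<rhd> y = m * y + c"
    "\<And>f. f \<in> Y \<Longrightarrow> \<exists>m c. \<forall>y\<in>{z - e..z}. f \<rhd> y = m * y + c"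
proof -
  have "\<exists>e>0. \<forall>f\<in>Y. (\<exists>m c. \<forall>y\<in>{z..z + e}. f \<rhd> y = m * y + c) \<and> (\<exists>m c. \<forall>y\<in>{z - e..z}. f \<rhd> y = m * y + c)"
    using fin Y
  proof (induction Y)
    case empty
    then show ?case by (intro exI[of _ 1]) auto
  next
    case (insert f Z)
    obtain e where e: "e > 0" "\<forall>f\<in>Z. (\<exists>m c. \<forall>y\<in>{z..z + e}. f \<rhd> y = m * y + c) \<and> (\<exists>m c. \<forall>y\<in>{z - e..z}. f \<rhd> y = m * y + c)"
      using insert by auto
    obtain r m c where r: "r > 0" "\<forall>y\<in>{z..z + r}. f \<rhd> y = m * y + c" using germ_right[of f z] insert by auto
    obtain l m' c' where l: "l > 0" "\<forall>y\<in>{z - l..z}. f \<rhd> y = m' * y + c'" using germ_left[of f z] insert by auto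
    let ?e = "min e (min r l)"
    have "(\<exists>m c. \<forall>y\<in>{z..z + ?e}. g \<rhd> y = m * y + c) \<and> (\<exists>m c. \<forall>y\<in>{z - ?e..z}. g \<rhd> y = m * y + c)"
      if g: "g \<in> insert f Z" for g
    proof (cases "g = f")
      case True
      have "\<forall>y\<in>{z..z + ?e}. g \<rhd> y = m * y + c" "\<forall>y\<in>{z - ?e..z}. g \<rhd> y = m' * y + c'"
        using r l True by auto
      then show ?thesis by blast
    next
      case False
      then obtain m c m' c' where "\<forall>y\<in>{z..z + e}. g \<rhd> y = m * y + c" "\<forall>y\<in>{z - e..z}. g \<rhd> y = m' * y + c'"
        using e g by blast
      then have "\<forall>y\<in>{z..z + ?e}. g \<rhd> y = m * y + c" "\<forall>y\<in>{z - ?e..z}. g \<rhd> y = m' * y + c'" by auto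
      then show ?thesis by blast
    qed
    then show ?case using e r l by (intro exI[of _ ?e]) auto
  qed
  then show ?thesis using that by blast
qed

lemma orb_left_end_isolated:
  assumes aff: "\<And>f. f \<in> Y \<Longrightarrow> \<exists>m k. \<forall>y\<in>{c..d}. f \<rhd> y = m * y + k"
    and o: "orb Y p q" "orb Y p' q'" and p: "c \<le> p" "p' \<le> d" "p < p'"
  shows False
proof -
  obtain x where x: "p < x" "x < min q p'" using dense[of p "min q p'"] o p by (auto simp: orb_def)
  then obtain f where f: "f \<in> Y" "f \<rhd> x \<noteq> x" using o(1) by (auto simp: orb_def)
  obtain m k where mk: "\<forall>y\<in>{c..d}. f \<rhd> y = m * y + k" using aff[OF f(1)] by blast
  have "f \<rhd> p = p" "f \<rhd> p' = p'" using o f by (auto simp: orb_def)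
  then have "m * x + k = x"
    using affine_two_fixed_points[of m p k p' x] mk p by auto
  then show False using mk f x p by auto
qed

text \<open>At an accumulation point of left ends all generators would be affine on a common
  interval on either side, and such an interval holds at most one left end.\<close>

lemma finite_orbs: "finite {(p, q). orb Y p q}"
proof -
  let ?E = "{p. \<exists>q. orb Y p q}"
  have "finite ?E"
  proof (rule ccontr)
    assume inf: "infinite ?E"
    have "?E \<subseteq> {0..1}" by (auto simp: orb_def)
    then obtain z where z: "z islimpt ?E"
      using Heine_Borel_imp_Bolzano_Weierstrass[of "{0..1::real}" ?E] inf by auto
    obtain e where e: "e > 0" "\<And>f. f \<in> Y \<Longrightarrow> \<exists>m c. \<forall>y\<in>{z..z + e}. f \<rhd> y = m * y + c"
      "\<And>f. f \<in> Y \<Longrightarrow> \<exists>m c. \<forall>y\<in>{z - e..z}. f \<rhd> y = m * y + c"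
      using affine_intervals[of z] by blast
    have "infinite (?E \<inter> ball z e)" using z e by (simp add: islimpt_eq_infinite_ball)
    moreover have "?E \<inter> ball z e \<subseteq> (?E \<inter> {z..z + e}) \<union> (?E \<inter> {z - e..z})"
      by (auto simp: ball_def dist_real_def)
    moreover have fin1: "finite (?E \<inter> {c..d})"
      if aff: "\<And>f. f \<in> Y \<Longrightarrow> \<exists>m k. \<forall>y\<in>{c..d}. f \<rhd> y = m * y + k" for c d
    proof -
      have "x = y" if xy: "x \<in> ?E \<inter> {c..d}" "y \<in> ?E \<inter> {c..d}" for x y
      proof -
        obtain q q' where "orb Y x q" "orb Y y q'" "c \<le> x" "x \<le> d" "c \<le> y" "y \<le> d" using xy by auto
        then have "\<not> x < y" "\<not> y < x" using orb_left_end_isolated[OF aff] by blast+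
        then show ?thesis by simp
      qed
      then have "\<exists>x. ?E \<inter> {c..d} \<subseteq> {x}" by blast
      then show ?thesis by (meson finite.simps finite_subset)
    qed
    ultimately show False using e(2,3) by (meson finite_Un finite_subset)
  qed
  moreover have "inj_on fst {(p, q). orb Y p q}"
  proof (rule inj_onI, clarsimp)
    fix p q q' assume o: "orb Y p q" "orb Y p q'"
    obtain x where "p < x" "x < min q q'" using dense[of p "min q q'"] o by (auto simp: orb_def)
    then show "q = q'" using orb_unique[OF o Y, of x] by auto
  qed
  moreover have "fst ` {(p, q). orb Y p q} \<subseteq> ?E" by auto
  ultimately show ?thesis using inj_on_finite by blast
qed

section \<open>Comparing orbitals by displacement\<close>

definition governs :: "real \<times> real \<Rightarrow> real \<times> real \<Rightarrow> bool" where
  "governs = (\<lambda>(p, q) (p', q'). \<forall>u' v'. p' < u' \<and> u' \<le> v' \<and> v' < q' \<longrightarrow>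
     (\<exists>u v. p < u \<and> u \<le> v \<and> v < q \<and> (\<forall>h\<in>H. displaces h u v \<longrightarrow> displaces h u' v')))"

lemma governsD:
  "\<lbrakk>governs (p, q) (p', q'); p' < u'; u' \<le> v'; v' < q'\<rbrakk> \<Longrightarrow>
    \<exists>u v. p < u \<and> u \<le> v \<and> v < q \<and> (\<forall>h\<in>H. displaces h u v \<longrightarrow> displaces h u' v')"
  unfolding governs_def by auto

lemma governs_refl: "governs P P"
  unfolding governs_def by (cases P) auto

lemma governs_trans: "\<lbrakk>governs P Q; governs Q R\<rbrakk> \<Longrightarrow> governs P R"
  unfolding governs_def by (cases P; cases Q; cases R) (simp, metis)

text \<open>Three moves: \<open>h\<close> brings \<open>[u, v]\<close> below \<open>b\<close>, an
  element generated by \<open>f\<close> pushes it up against \<open>b\<close> inside the orbital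
  \<open>(p, b)\<close>, and \<open>k\<close> carries it next to \<open>k b\<close>. This is what
  the inner end \<open>b\<close> is good for.\<close>

lemma contract:
  assumes o: "orb Y p q" and f: "f \<in> H" "orb {f} p b" "b < q" and k: "k \<in> H"
    and x: "p < x" "x < k \<rhd> b" and uv: "p < u" "u \<le> v" "v < q"
  obtains s where "s \<in> H" "x < s \<rhd> u" "s \<rhd> v < k \<rhd> b"
proof -
  have pb: "p < b" using f by (simp add: orb_def)
  have fc: "{f} \<subseteq> carrier L" using H_carrier f by blast
  obtain h where h: "h \<in> H" "h \<rhd> v < b" using orbit_down[OF Y o, of v b] uv pb by auto
  have hc: "h \<in> carrier L" "k \<in> carrier L" using h k H_carrier by auto
  have hu: "p < h \<rhd> u" "h \<rhd> u \<le> h \<rhd> v" "p < h \<rhd> v"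
    using H_preserves[OF o h(1)] uv hc by auto
  have "inv k \<rhd> x < b" using x hc by (simp add: inv_act_less)
  then obtain g where g: "g \<in> generate L {f}" "inv k \<rhd> x < g \<rhd> h \<rhd> u"
    using orbit_up[OF fc f(2), of "h \<rhd> u" "inv k \<rhd> x"] hu h by auto
  have gH: "g \<in> H" "g \<in> carrier L" using g H_generate[OF f(1)] H_carrier by auto
  have "g \<rhd> h \<rhd> v < b" using orb_preserved[OF f(2) fc g(1)] hu h by auto
  then have "(k \<otimes> g \<otimes> h) \<rhd> v < k \<rhd> b" using gH hc by (simp add: act_mult)
  moreover have "x < (k \<otimes> g \<otimes> h) \<rhd> u" using g gH hc by (simp add: act_mult inv_act_less)
  ultimately show ?thesis using that[of "k \<otimes> g \<otimes> h"] k gH h H_mult by blast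
qed

lemma active_conj:
  assumes o: "orb Y p q" and w: "w \<in> H" "h \<in> H" and act: "active (h \<otimes> w \<otimes> inv h) p q"
  shows "active w p q"
proof -
  obtain x where x: "p < x" "x < q" "(h \<otimes> w \<otimes> inv h) \<rhd> x \<noteq> x" using act by (auto simp: active_def)
  then have "w \<rhd> inv h \<rhd> x \<noteq> inv h \<rhd> x" using w H_carrier by (auto simp: act_mult)
  then show ?thesis using H_preserves[OF o H_inv[OF w(2)]] x unfolding active_def by blast
qed

lemma active_commutator:
  assumes "orb Y p q" and u: "u \<in> H" "v \<in> H" and act: "active (u \<otimes> v \<otimes> inv u \<otimes> inv v) p q"
  shows "active u p q \<or> active v p q"
proof (rule ccontr)
  assume "\<not> ?thesis"
  then have fx: "u \<rhd> x = x" "v \<rhd> x = x" if "p < x" "x < q" for x using that by (auto simp: active_def)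
  have c: "u \<in> carrier L" "v \<in> carrier L" using u H_carrier by auto
  then have "inv u \<rhd> x = x" "inv v \<rhd> x = x" if "p < x" "x < q" for x using fx[OF that] by (simp_all add: inv_act_eq)
  then show False using act fx c by (auto simp: active_def act_mult)
qed

lemma commutator_inactive:
  assumes o: "orb Y p q" and u: "u \<in> H" and v: "v \<in> H"
    and disj: "\<And>x. \<lbrakk>p < x; x < q\<rbrakk> \<Longrightarrow> u \<rhd> x = x \<or> v \<rhd> x = x"
  shows "\<not> active (u \<otimes> v \<otimes> inv u \<otimes> inv v) p q"
proof
  assume "active (u \<otimes> v \<otimes> inv u \<otimes> inv v) p q"
  then obtain x where x: "p < x" "x < q" "(u \<otimes> v \<otimes> inv u \<otimes> inv v) \<rhd> x \<noteq> x" by (auto simp: active_def)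
  have c: "u \<in> carrier L" "v \<in> carrier L" using u v H_carrier by auto
  have comm: "u \<rhd> v \<rhd> y = v \<rhd> u \<rhd> y" if y: "p < y" "y < q" for y
    by (rule commute_at[OF c disj[OF y] disj[OF H_preserves[OF o v y]] disj[OF H_preserves[OF o u y]]])
  have "p < inv u \<rhd> inv v \<rhd> x" "inv u \<rhd> inv v \<rhd> x < q"
    using x H_preserves[OF o H_inv] u v by auto
  from comm[OF this] x(3) show False using c by (simp add: act_mult)
qed

end

context pl_fin_gen begin

text \<open>The orbital of \<open>w\<close> around \<open>k b\<close> contains an interval ending at
  \<open>k b\<close>, into which \<open>[u, v]\<close> can be contracted. Conjugating by the inverse
  of the contraction spreads the orbital over \<open>[u, v]\<close> and keeps a point of the orbit
  of \<open>b\<close> in it.\<close>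

lemma expanded_conjugate:
  assumes o: "orb Y p q" and f: "f \<in> H" "orb {f} p b" "b < q"
    and w: "w \<in> compactly_supported Y" and k: "k \<in> H" "w \<rhd> k \<rhd> b \<noteq> k \<rhd> b"
    and uv: "p < u" "u \<le> v" "v < q"
  obtains s l a c where "s \<in> H" "l \<in> H" "orb {s \<otimes> w \<otimes> inv s} a c"
    "a < u" "v < c" "a < l \<rhd> b" "l \<rhd> b < c"
proof -
  have wH: "w \<in> H" using w compactly_supported_subset by blast
  have wc: "w \<in> carrier L" "k \<in> carrier L" using wH k H_carrier by auto
  obtain a c where ac: "orb {w} a c" "a < k \<rhd> b" "k \<rhd> b < c"
    using orb_exists[of "{w}" w "k \<rhd> b"] wc k by auto
  have "p < b" using f by (simp add: orb_def)
  then have "p < k \<rhd> b" using H_preserves[OF o k(1)] f by auto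
  then obtain x where x: "max a p < x" "x < k \<rhd> b" using dense[of "max a p" "k \<rhd> b"] ac by auto
  then obtain r where r: "r \<in> H" "x < r \<rhd> u" "r \<rhd> v < k \<rhd> b"
    using contract[OF o f k(1) _ _ uv, of x] by auto
  have rc: "r \<in> carrier L" using r H_carrier by auto
  have "orb {inv r \<otimes> w \<otimes> inv (inv r)} (inv r \<rhd> a) (inv r \<rhd> c)"
    using orb_conj[of "inv r" w a c] rc wc ac by simp
  moreover have "inv r \<rhd> a < u" "v < inv r \<rhd> c" using r x ac rc by (auto simp: inv_act_less less_inv_act)
  moreover have "inv r \<rhd> a < (inv r \<otimes> k) \<rhd> b" "(inv r \<otimes> k) \<rhd> b < inv r \<rhd> c"
    using rc wc ac by (auto simp: act_mult)
  ultimately show ?thesis using that[of "inv r" "inv r \<otimes> k" "inv r \<rhd> a" "inv r \<rhd> c"] r k H_inv H_mult by blast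
qed

text \<open>Commuting elements have equal or disjoint orbitals, and a translate of an orbital cannot
  coincide with two different ones; so one of two candidate commutators is nontrivial.\<close>

lemma kill_orbital:
  assumes o: "orb Y p q" and f: "f \<in> H" "orb {f} p b" "b < q"
    and w: "w \<in> compactly_supported Y" and k: "k \<in> H" "w \<rhd> k \<rhd> b \<noteq> k \<rhd> b"
    and o': "orb Y p' q'" and ngov: "\<not> governs (p', q') (p, q)"
  obtains w' l where "w' \<in> compactly_supported Y" "l \<in> H" "w' \<rhd> l \<rhd> b \<noteq> l \<rhd> b"
    "\<not> active w' p' q'" "\<And>r t. \<lbrakk>orb Y r t; active w' r t\<rbrakk> \<Longrightarrow> active w r t"
proof -
  have wH: "w \<in> H" using w compactly_supported_subset by blast
  have wc: "w \<in> carrier L" using wH H_carrier by auto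
  obtain u v where uv: "p < u" "u \<le> v" "v < q" and
    far: "\<And>u' v'. \<lbrakk>p' < u'; u' \<le> v'; v' < q'\<rbrakk> \<Longrightarrow> \<exists>h\<in>H. displaces h u' v' \<and> \<not> displaces h u v"
    using ngov unfolding governs_def by auto
  obtain s1 l1 a1 c1 where 1: "s1 \<in> H" "l1 \<in> H" "orb {s1 \<otimes> w \<otimes> inv s1} a1 c1"
    "a1 < u" "v < c1" "a1 < l1 \<rhd> b" "l1 \<rhd> b < c1"
    using expanded_conjugate[OF o f w k uv] by blast
  define U1 where "U1 = s1 \<otimes> w \<otimes> inv s1"
  have s1c: "s1 \<in> carrier L" using 1 H_carrier by auto
  obtain su sv where sup: "p < su" "su \<le> sv" "sv < q"
    "\<And>x. \<lbrakk>p < x; x < q; w \<rhd> x \<noteq> x\<rbrakk> \<Longrightarrow> su \<le> x \<and> x \<le> sv"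
    using compactly_supportedD[OF w o] by blast
  \<comment> \<open>A point \<open>y\<close> fixed by \<open>U1\<close> is prepared; the orbital of
    the second conjugate will be made to contain it, so that the two orbitals differ.\<close>
  obtain y0 where y0: "p < y0" "y0 < su" using dense sup by blast
  then have wy0: "w \<rhd> y0 = y0" using sup(2-4) by force
  define y where "y = s1 \<rhd> y0"
  have y: "p < y" "y < q" using H_preserves[OF o 1(1), of y0] y0 sup by (auto simp: y_def)
  have U1y: "U1 \<rhd> y = y" using s1c wc wy0 by (simp add: U1_def y_def act_mult)
  obtain s2 l2 a2 c2 where 2: "s2 \<in> H" "l2 \<in> H" "orb {s2 \<otimes> w \<otimes> inv s2} a2 c2"
    "a2 < min u y" "max v y < c2" "a2 < l2 \<rhd> b" "l2 \<rhd> b < c2"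
  proof -
    have "p < min u y" "min u y \<le> max v y" "max v y < q" using uv y by auto
    from expanded_conjugate[OF o f w k this] that show ?thesis by blast
  qed
  define U2 where "U2 = s2 \<otimes> w \<otimes> inv s2"
  have U: "U1 \<in> compactly_supported Y" "U2 \<in> compactly_supported Y"
    unfolding U1_def U2_def by (rule compactly_supported_conj[OF Y w], fact)+
  then have UH: "U1 \<in> H" "U2 \<in> H" using compactly_supported_subset by blast+
  obtain m1 n1 where mn1: "p' < m1" "m1 \<le> n1" "n1 < q'" "\<And>x. \<lbrakk>p' < x; x < q'; U1 \<rhd> x \<noteq> x\<rbrakk> \<Longrightarrow> m1 \<le> x \<and> x \<le> n1"
    using compactly_supportedD[OF U(1) o'] by blast
  obtain m2 n2 where mn2: "p' < m2" "m2 \<le> n2" "n2 < q'" "\<And>x. \<lbrakk>p' < x; x < q'; U2 \<rhd> x \<noteq> x\<rbrakk> \<Longrightarrow> m2 \<le> x \<and> x \<le> n2"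
    using compactly_supportedD[OF U(2) o'] by blast
  \<comment> \<open>Failure of \<open>governs\<close>: on \<open>(p', q')\<close> the element
    \<open>h\<close> displaces an interval carrying both supports, but on \<open>(p, q)\<close> it
    leaves \<open>[u, v]\<close> overlapping its image.\<close>
  obtain h where h: "h \<in> H" "displaces h (min m1 m2) (max n1 n2)" "\<not> displaces h u v"
  proof -
    have "p' < min m1 m2" "min m1 m2 \<le> max n1 n2" "max n1 n2 < q'" using mn1 mn2 by auto
    from far[OF this] that show ?thesis by blast
  qed
  have hc: "h \<in> carrier L" using h H_carrier by auto
  have inactive: "\<not> active (U1 \<otimes> (h \<otimes> U \<otimes> inv h) \<otimes> inv U1 \<otimes> inv (h \<otimes> U \<otimes> inv h)) p' q'"
    if UU: "U = U1 \<or> U = U2" for U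
  proof (rule commutator_inactive[OF o' UH(1)])
    have "U \<in> H" using UU UH by blast
    then show "h \<otimes> U \<otimes> inv h \<in> H" by (intro H_mult H_inv h(1))
    fix x assume x: "p' < x" "x < q'"
    have Uc: "U \<in> carrier L" using UU UH H_carrier by blast
    show "U1 \<rhd> x = x \<or> (h \<otimes> U \<otimes> inv h) \<rhd> x = x"
    proof (rule ccontr)
      assume "\<not> ?thesis"
      then have mv: "U1 \<rhd> x \<noteq> x" "U \<rhd> inv h \<rhd> x \<noteq> inv h \<rhd> x" using Uc hc by (auto simp: act_mult)
      have "min m1 m2 \<le> inv h \<rhd> x \<and> inv h \<rhd> x \<le> max n1 n2"
        using UU mn1(4) mn2(4) mv(2) H_preserves[OF o' H_inv[OF h(1)] x] by fastforce
      then have "h \<rhd> min m1 m2 \<le> x" "x \<le> h \<rhd> max n1 n2" using hc by (metis act_inv2 act_le_iff)+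
      moreover have "min m1 m2 \<le> x" "x \<le> max n1 n2" using mn1(4)[OF x mv(1)] by auto
      ultimately show False using h(2) unfolding displaces_def by linarith
    qed
  qed
  \<comment> \<open>The new element has to move a point of the orbit of \<open>b\<close>, so
    triviality of the commutators is tested on this orbit only.\<close>
  define D where "D = {x. \<exists>l\<in>H. x = l \<rhd> b}"
  have D: "g \<rhd> x \<in> D" if "x \<in> D" "g \<in> H" for g x
    using that H_mult H_carrier unfolding D_def by (auto simp: act_mult[symmetric])
  \<comment> \<open>If the commutator is trivial on \<open>D\<close>, the orbitals
    \<open>(a1, c1)\<close> and \<open>h (a, c)\<close> have ends fixed by each other's map, so they
    are equal or disjoint. They meet, because \<open>(a1, c1)\<close> and \<open>(a, c)\<close>
    contain \<open>[u, v]\<close> and \<open>h\<close> does not displace it.\<close>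
  have same: "h \<rhd> a = a1 \<and> h \<rhd> c = c1"
    if UU: "U \<in> H" "orb {U} a c" "l \<in> H" "a < l \<rhd> b" "l \<rhd> b < c" "a < u" "v < c"
      and triv: "\<And>x. x \<in> D \<Longrightarrow> (U1 \<otimes> (h \<otimes> U \<otimes> inv h) \<otimes> inv U1 \<otimes> inv (h \<otimes> U \<otimes> inv h)) \<rhd> x = x"
    for U a c l
  proof -
    let ?V = "h \<otimes> U \<otimes> inv h"
    have V: "?V \<in> H" by (intro H_mult H_inv UU(1) h(1))
    have car: "U \<in> carrier L" "?V \<in> carrier L" "U1 \<in> carrier L" "l \<in> carrier L" "l1 \<in> carrier L"
      using UU V UH 1 H_carrier by auto
    have comm: "U1 \<rhd> ?V \<rhd> x = ?V \<rhd> U1 \<rhd> x" if x: "x \<in> D" for x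
    proof -
      have "(?V \<otimes> U1) \<rhd> x \<in> D" using D[OF x] V UH H_mult by blast
      from triv[OF this] show ?thesis using car by (simp add: act_mult)
    qed
    have oV: "orb {?V} (h \<rhd> a) (h \<rhd> c)" by (rule orb_conj[OF hc car(1) UU(2)])
    have oU: "orb {U1} a1 c1" using 1 by (simp add: U1_def)
    have inD: "g \<rhd> x \<in> D \<and> inv g \<rhd> x \<in> D" if "x \<in> D" "g \<in> H" for g x
      using D that H_inv by blast
    have "l1 \<rhd> b \<in> D" using 1 unfolding D_def by blast
    then have V1: "?V \<rhd> a1 = a1 \<and> ?V \<rhd> c1 = c1"
      using commuting_fixes_orb_ends[OF car(3,2) _ comm oU _ 1(6,7)] inD UH(1) V by blast
    have "h \<rhd> l \<rhd> b \<in> D" using D[OF _ h(1)] UU(3) unfolding D_def by blast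
    moreover have "h \<rhd> a < h \<rhd> l \<rhd> b" "h \<rhd> l \<rhd> b < h \<rhd> c" using UU hc by auto
    ultimately have "U1 \<rhd> h \<rhd> a = h \<rhd> a \<and> U1 \<rhd> h \<rhd> c = h \<rhd> c"
      using commuting_fixes_orb_ends[OF car(2,3) _ comm[symmetric] oV] inD UH(1) V by blast
    with V1 have out: "a1 \<le> h \<rhd> a \<or> h \<rhd> c \<le> a1" "c1 \<le> h \<rhd> a \<or> h \<rhd> c \<le> c1"
      "h \<rhd> a \<le> a1 \<or> c1 \<le> h \<rhd> a" "h \<rhd> c \<le> a1 \<or> c1 \<le> h \<rhd> c"
      using orb_avoids_fixed[OF oV, of a1] orb_avoids_fixed[OF oV, of c1]
        orb_avoids_fixed[OF oU, of "h \<rhd> a"] orb_avoids_fixed[OF oU, of "h \<rhd> c"] by auto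
    have "h \<rhd> a < h \<rhd> u" "h \<rhd> v < h \<rhd> c" "h \<rhd> u \<le> h \<rhd> v" "h \<rhd> u \<le> v" "u \<le> h \<rhd> v"
      using UU hc uv h(3) by (auto simp: displaces_def)
    then show ?thesis using out 1(4,5) uv by linarith
  qed
  let ?w = "\<lambda>U. U1 \<otimes> (h \<otimes> U \<otimes> inv h) \<otimes> inv U1 \<otimes> inv (h \<otimes> U \<otimes> inv h)"
  have "\<exists>U\<in>{U1, U2}. \<exists>x\<in>D. ?w U \<rhd> x \<noteq> x"
  proof (rule ccontr)
    \<comment> \<open>Otherwise \<open>h\<close> carries both orbitals to \<open>(a1, c1)\<close>;
      they coincide and contain the point \<open>y\<close> fixed by \<open>U1\<close>.\<close>
    assume triv: "\<not> ?thesis"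
    have "h \<rhd> a1 = a1 \<and> h \<rhd> c1 = c1"
      by (rule same[of U1 a1 c1 l1]) (use 1 UH triv in \<open>auto simp: U1_def\<close>)
    moreover have "h \<rhd> a2 = a1 \<and> h \<rhd> c2 = c1"
      by (rule same[of U2 a2 c2 l2]) (use 2 UH triv in \<open>auto simp: U2_def\<close>)
    ultimately have "a2 = a1" "c2 = c1" using hc by (metis act_eq_iff)+
    then have "a1 < y" "y < c1" using 2 by auto
    then show False using U1y 1(3) by (auto simp: U1_def orb_def)
  qed
  then obtain U x where U12: "U = U1 \<or> U = U2" and x: "x \<in> D" "?w U \<rhd> x \<noteq> x" by auto
  then obtain l where l: "l \<in> H" "x = l \<rhd> b" by (auto simp: D_def)
  have Us: "U \<in> compactly_supported Y" using U12 U by auto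
  have V: "h \<otimes> U \<otimes> inv h \<in> compactly_supported Y" by (rule compactly_supported_conj[OF Y Us h(1)])
  have UVH: "U \<in> H" "h \<otimes> U \<otimes> inv h \<in> H" using Us V compactly_supported_subset by blast+
  show ?thesis
  proof (rule that[of "?w U" l])
    show "?w U \<in> compactly_supported Y" by (rule compactly_supported_commutator[OF Y UH(1) UVH(2)])
    show "?w U \<rhd> l \<rhd> b \<noteq> l \<rhd> b" using x l by simp
    show "\<not> active (?w U) p' q'" by (rule inactive[OF U12])
    fix r t assume rt: "orb Y r t" "active (?w U) r t"
    then have "active U1 r t \<or> active U r t"
      using active_commutator[OF rt(1) UH(1) UVH(2)] active_conj[OF rt(1) UVH(1) h(1)] by blast
    then have "active U1 r t \<or> active U2 r t" using U12 by blast
    then show "active w r t"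
      unfolding U1_def U2_def using active_conj[OF rt(1) wH 1(1)] active_conj[OF rt(1) wH 2(1)] by blast
  qed (rule l)
qed

text \<open>An \<open>h\<close> is built that fixes a point of \<open>[x, b]\<close> and acts
  nontrivially near \<open>p'\<close>. If its orbital at \<open>p'\<close> filled
  \<open>(p', q')\<close>, elements generated by \<open>h\<close> would displace any compact
  interval there without ever displacing \<open>[x, b]\<close>, contrary to
  \<open>governs\<close>.\<close>

lemma governs_imp_inner_end:
  assumes o: "orb Y p q" and f: "f \<in> H" "orb {f} p b" "b < q"
    and o': "orb Y p' q'" and gov: "governs (p', q') (p, q)"
  shows "\<exists>g\<in>H. \<exists>b'<q'. orb {g} p' b'"
proof (rule ccontr)
  assume none: "\<not> ?thesis"
  have pb: "p < b" using f by (simp add: orb_def)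
  obtain x where x: "p < x" "x < b" using dense pb by blast
  obtain t where t: "t \<in> Y" "\<forall>\<^sub>F y in at_right p'. t \<rhd> y \<noteq> y"
    using finite_orb_realized[OF fin Y o'] by blast
  have tH: "t \<in> H" "t \<in> carrier L" "t \<rhd> p' = p'" using t Y o' generate.incl by (auto simp: orb_def)
  have tx: "p < t \<rhd> x" "t \<rhd> x < t \<rhd> b" "t \<rhd> b < q"
    using H_preserves[OF o tH(1)] x f pb tH by auto
  \<comment> \<open>Contracting the hull of \<open>[x, b]\<close> and its image under
    \<open>t\<close> into \<open>(x, b)\<close> makes both \<open>s\<close> and \<open>s t\<close>
    map \<open>[x, b]\<close> into its interior. As \<open>t\<close> has a nontrivial germ at
    \<open>p'\<close>, at least one of the two has one.\<close>
  obtain s where s: "s \<in> H" "x < s \<rhd> min x (t \<rhd> x)" "s \<rhd> max b (t \<rhd> b) < b"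
  proof -
    have "p < min x (t \<rhd> x)" "min x (t \<rhd> x) \<le> max b (t \<rhd> b)" "max b (t \<rhd> b) < q" using x tx f by auto
    from contract[OF o f H_one x(1) _ this] x(2) that show ?thesis by (auto simp only: act_one)
  qed
  have sc: "s \<in> carrier L" using s H_carrier by auto
  have sp: "s \<rhd> p' = p'" using generate_fixed[OF Y s(1)] o' by (auto simp: orb_def)
  have le: "s \<rhd> min x (t \<rhd> x) \<le> s \<rhd> x" "s \<rhd> min x (t \<rhd> x) \<le> s \<rhd> t \<rhd> x"
    "s \<rhd> b \<le> s \<rhd> max b (t \<rhd> b)" "s \<rhd> t \<rhd> b \<le> s \<rhd> max b (t \<rhd> b)"
    using sc by auto
  obtain h where h: "h \<in> H" "x < h \<rhd> x" "h \<rhd> b < b" "\<forall>\<^sub>F y in at_right p'. h \<rhd> y \<noteq> y"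
  proof (cases "\<forall>\<^sub>F y in at_right p'. s \<rhd> y \<noteq> y")
    case True
    then show ?thesis using that[of s] s le by linarith
  next
    case False
    then have "\<forall>\<^sub>F y in at_right p'. s \<rhd> y = y" using germ_dichotomy[OF sc sp] by blast
    then have "\<forall>\<^sub>F y in at_right p'. s \<rhd> t \<rhd> y = t \<rhd> y"
      by (rule eventually_compose_filterlim) (rule filterlim_act_right[OF tH(2,3)])
    with t(2) have "\<forall>\<^sub>F y in at_right p'. (s \<otimes> t) \<rhd> y \<noteq> y"
      by eventually_elim (use sc tH in \<open>simp add: act_mult\<close>)
    moreover have "x < (s \<otimes> t) \<rhd> x" "(s \<otimes> t) \<rhd> b < b"
      unfolding act_mult[OF sc tH(2)] using s le by linarith+
    ultimately show ?thesis using that[of "s \<otimes> t"] s tH H_mult by blast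
  qed
  have hc: "h \<in> carrier L" using h H_carrier by auto
  have hp: "h \<rhd> p' = p'" "h \<rhd> q' = q'" using generate_fixed[OF Y h(1)] o' by (auto simp: orb_def)
  obtain b' where b': "orb {h} p' b'" using orb_realized[OF hc h(4) hp(1)] by blast
  have "p' < q'" using o' by (simp add: orb_def)
  then have "b' \<le> q'" using orb_avoids_fixed[OF b', of q'] hp by auto
  moreover have "\<not> b' < q'" using none h(1) b' by blast
  ultimately have "b' = q'" by simp
  with b' have oh: "orb {h} p' q'" by simp
  obtain d where d: "x \<le> d" "d \<le> b" "h \<rhd> d = d" using fixed_point_between[OF hc, of x b] h x by auto
  obtain u v where uv: "p' < u" "u \<le> v" "v < q'" "\<forall>g\<in>H. displaces g u v \<longrightarrow> displaces g x b"
    using governsD[OF gov x(1) less_imp_le[OF x(2)] f(3)] by blast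
  have hs: "{h} \<subseteq> carrier L" using hc by simp
  obtain g where g: "g \<in> generate L {h}" "v < g \<rhd> u" using orbit_up[OF hs oh, of u v] uv by auto
  have gH: "g \<in> H" "g \<in> carrier L" using g H_generate[OF h(1)] H_carrier by auto
  have "g \<rhd> d = d" using generate_fixed[OF hs g(1)] d by auto
  then have "\<not> displaces g x b" using not_displaces_fixed gH d by blast
  moreover have "displaces g u v" using g by (simp add: displaces_def)
  ultimately show False using uv gH by blast
qed

text \<open>By minimality every orbital on which \<open>w\<close> is active governs
  \<open>(p, q)\<close>. This gives it an inner end, so it takes part in the maximal choice and is
  governed by \<open>(p, q)\<close> in turn.\<close>

lemma ex_governed_element:
  assumes "orb Y p0 q0" "f0 \<in> H" "orb {f0} p0 b0" "b0 < q0"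
  obtains p q f b w k where "orb Y p q" "f \<in> H" "orb {f} p b" "b < q"
    "w \<in> compactly_supported Y" "k \<in> H" "w \<rhd> k \<rhd> b \<noteq> k \<rhd> b"
    "\<And>p' q'. \<lbrakk>orb Y p' q'; active w p' q'\<rbrakk> \<Longrightarrow> governs (p, q) (p', q')"
proof -
  define C where "C = {(p, q). orb Y p q \<and> (\<exists>f\<in>H. \<exists>b<q. orb {f} p b)}"
  have finC: "finite C" by (rule finite_subset[OF _ finite_orbs]) (auto simp: C_def)
  have "(p0, q0) \<in> C" using assms by (auto simp: C_def)
  define n where "n P = card {Q \<in> C. governs P Q}" for P
  have "\<exists>P\<in>C. \<forall>Q\<in>C. n Q \<le> n P"
  proof -
    have ne: "n ` C \<noteq> {}" "finite (n ` C)" using \<open>(p0, q0) \<in> C\<close> finC by auto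
    obtain P where "P \<in> C" "n P = Max (n ` C)" using Max_in[OF ne(2,1)] by auto
    moreover have "n Q \<le> Max (n ` C)" if "Q \<in> C" for Q using Max_ge[OF ne(2)] that by blast
    ultimately show ?thesis by (intro bexI[of _ P]) auto
  qed
  then obtain P where P: "P \<in> C" "\<And>Q. Q \<in> C \<Longrightarrow> n Q \<le> n P" by blast
  \<comment> \<open>\<open>Q\<close> governs all that \<open>P\<close> governs and cannot govern
    more in number, so the two sets agree. As \<open>Q\<close> governs itself, \<open>P\<close>
    governs \<open>Q\<close>.\<close>
  have max: "governs P Q" if Q: "Q \<in> C" "governs Q P" for Q
  proof -
    have "{R \<in> C. governs P R} \<subseteq> {R \<in> C. governs Q R}" using governs_trans[OF Q(2)] by blast
    moreover have "card {R \<in> C. governs Q R} \<le> card {R \<in> C. governs P R}" using P(2)[OF Q(1)] by (simp add: n_def)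
    ultimately have "{R \<in> C. governs P R} = {R \<in> C. governs Q R}"
      using finC by (intro card_seteq) auto
    then show ?thesis using Q governs_refl by blast
  qed
  obtain p q where pq: "P = (p, q)" by (cases P)
  obtain f b where o: "orb Y p q" and f: "f \<in> H" "orb {f} p b" "b < q" using P(1) by (auto simp: C_def pq)
  define good where "good w \<longleftrightarrow> w \<in> compactly_supported Y \<and> (\<exists>k\<in>H. w \<rhd> k \<rhd> b \<noteq> k \<rhd> b)" for w
  define m where "m w = card {(p, q). orb Y p q \<and> active w p q}" for w
  \<comment> \<open>The commutator of \<open>g\<close> and \<open>f\<close> sends
    \<open>f g b\<close> to \<open>g b\<close>, because \<open>f\<close> fixes \<open>b\<close>;
    these points differ since \<open>f\<close> moves \<open>g b\<close>.\<close>
  have "\<exists>w. good w"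
  proof -
    have pb: "p < b" using f by (simp add: orb_def)
    obtain g where g: "g \<in> H" "g \<rhd> b < b" using orbit_down[OF Y o, of b b] pb f by auto
    have c: "f \<in> carrier L" "g \<in> carrier L" using f g H_carrier by auto
    have "p < g \<rhd> b" using H_preserves[OF o g(1)] pb f by auto
    then have "f \<rhd> g \<rhd> b \<noteq> g \<rhd> b" using f(2) g by (auto simp: orb_def)
    moreover have "f \<rhd> b = b" using f by (simp add: orb_def)
    ultimately have "(g \<otimes> f \<otimes> inv g \<otimes> inv f) \<rhd> (f \<otimes> g) \<rhd> b \<noteq> (f \<otimes> g) \<rhd> b"
      using c by (simp add: act_mult)
    then show ?thesis
      using compactly_supported_commutator[OF Y g(1) f(1)] H_mult[OF f(1) g(1)] unfolding good_def by blast
  qed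
  then obtain w where w: "good w" "\<And>w'. good w' \<Longrightarrow> m w \<le> m w'"
    using ex_has_least_nat[of good _ m] by blast
  obtain k where wk: "w \<in> compactly_supported Y" "k \<in> H" "w \<rhd> k \<rhd> b \<noteq> k \<rhd> b" using w(1) by (auto simp: good_def)
  have "governs (p, q) (p', q')" if o': "orb Y p' q'" "active w p' q'" for p' q'
  proof -
    have "governs (p', q') (p, q)"
    proof (rule ccontr)
      assume "\<not> ?thesis"
      then obtain w' l where w': "w' \<in> compactly_supported Y" "l \<in> H" "w' \<rhd> l \<rhd> b \<noteq> l \<rhd> b"
        "\<not> active w' p' q'" "\<And>r t. \<lbrakk>orb Y r t; active w' r t\<rbrakk> \<Longrightarrow> active w r t"
        using kill_orbital[OF o f wk o'(1)] by metis
      have "m w' < m w" unfolding m_def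
      proof (rule psubset_card_mono)
        show "finite {(p, q). orb Y p q \<and> active w p q}" by (rule finite_subset[OF _ finite_orbs]) auto
        show "{(p, q). orb Y p q \<and> active w' p q} \<subset> {(p, q). orb Y p q \<and> active w p q}"
          using w'(4,5) o' by blast
      qed
      moreover have "good w'" using w' by (auto simp: good_def)
      ultimately show False using w(2) by force
    qed
    moreover from this have "(p', q') \<in> C" using governs_imp_inner_end[OF o f o'(1)] o' by (simp add: C_def)
    ultimately show ?thesis using max pq by blast
  qed
  with o f wk that show ?thesis by blast
qed

text \<open>\<open>[c, d]\<close> is taken so large that displacing it separates \<open>w\<close>
  from its conjugate on all active orbitals at once. This is possible because these are finitely
  many and all governed by \<open>(p, q)\<close>.\<close>

lemma ex_contracting_pair:
  assumes "orb Y p0 q0" "f0 \<in> H" "orb {f0} p0 b0" "b0 < q0"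
  obtains w s p q c d x z where "w \<in> H" "s \<in> H" "orb Y p q" "p < c" "c \<le> x" "x < z" "z \<le> d" "d < q"
    "x < s \<rhd> c" "s \<rhd> d < z" "w \<rhd> z \<noteq> z"
    "\<And>y. \<lbrakk>p < y; y < q; w \<rhd> y \<noteq> y\<rbrakk> \<Longrightarrow> c \<le> y \<and> y \<le> d"
    "\<And>m::int. m \<noteq> 0 \<Longrightarrow> displaces (w [^] m) x z"
    "\<And>h. \<lbrakk>h \<in> H; displaces h c d\<rbrakk> \<Longrightarrow> (h \<otimes> w \<otimes> inv h) \<otimes> w = w \<otimes> (h \<otimes> w \<otimes> inv h)"
proof -
  obtain p q f b w k where o: "orb Y p q" and f: "f \<in> H" "orb {f} p b" "b < q"
    and w: "w \<in> compactly_supported Y" and k: "k \<in> H" "w \<rhd> k \<rhd> b \<noteq> k \<rhd> b"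
    and gov: "\<And>p' q'. \<lbrakk>orb Y p' q'; active w p' q'\<rbrakk> \<Longrightarrow> governs (p, q) (p', q')"
    using ex_governed_element[OF assms] by blast
  have wH: "w \<in> H" using w compactly_supported_subset by blast
  have wc: "w \<in> carrier L" using wH H_carrier by auto
  define z where "z = k \<rhd> b"
  have pb: "p < b" using f by (simp add: orb_def)
  have z: "p < z" "z < q" "w \<rhd> z \<noteq> z" using H_preserves[OF o k(1)] pb f k by (auto simp: z_def)
  obtain x where x: "p < x" "x < z" "\<And>m::int. m \<noteq> 0 \<Longrightarrow> displaces (w [^] m) x z"
    using displaced_by_powers[OF wc z(3,1)] by blast
  obtain su sv where sup: "p < su" "su \<le> sv" "sv < q"
    "\<And>x. \<lbrakk>p < x; x < q; w \<rhd> x \<noteq> x\<rbrakk> \<Longrightarrow> su \<le> x \<and> x \<le> sv"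
    using compactly_supportedD[OF w o] by blast
  define Act where "Act = {(p', q'). orb Y p' q' \<and> active w p' q'}"
  have finA: "finite Act" by (rule finite_subset[OF _ finite_orbs]) (auto simp: Act_def)
  have "\<exists>u v. p < u \<and> u \<le> v \<and> v < q \<and> (\<forall>h\<in>H. displaces h u v \<longrightarrow>
      (\<forall>y. fst Q < y \<and> y < snd Q \<longrightarrow> w \<rhd> y = y \<or> (h \<otimes> w \<otimes> inv h) \<rhd> y = y))" if Q: "Q \<in> Act" for Q
  proof -
    obtain p' q' where Q': "Q = (p', q')" "orb Y p' q'" "active w p' q'" using Q by (auto simp: Act_def)
    obtain m n where mn: "p' < m" "m \<le> n" "n < q'"
      "\<And>x. \<lbrakk>p' < x; x < q'; w \<rhd> x \<noteq> x\<rbrakk> \<Longrightarrow> m \<le> x \<and> x \<le> n"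
      using compactly_supportedD[OF w Q'(2)] by blast
    obtain u v where uv: "p < u" "u \<le> v" "v < q" "\<And>h. \<lbrakk>h \<in> H; displaces h u v\<rbrakk> \<Longrightarrow> displaces h m n"
      using governsD[OF gov[OF Q'(2,3)] mn(1-3)] by blast
    have "w \<rhd> y = y \<or> (h \<otimes> w \<otimes> inv h) \<rhd> y = y"
      if h: "h \<in> H" "displaces h u v" and y: "p' < y" "y < q'" for h y
    proof (rule ccontr)
      assume "\<not> ?thesis"
      then have mv: "w \<rhd> y \<noteq> y" "w \<rhd> inv h \<rhd> y \<noteq> inv h \<rhd> y" using wc h H_carrier by (auto simp: act_mult)
      have "m \<le> inv h \<rhd> y" "inv h \<rhd> y \<le> n"
        using mn(4)[OF H_preserves[OF Q'(2) H_inv[OF h(1)] y] mv(2)] by auto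
      then have "h \<rhd> m \<le> y" "y \<le> h \<rhd> n" using h H_carrier by (metis act_inv2 act_le_iff)+
      then show False using uv(4)[OF h] mn(4)[OF y mv(1)] unfolding displaces_def by linarith
    qed
    then show ?thesis using uv Q' by auto
  qed
  then obtain u v where uv: "\<And>Q. Q \<in> Act \<Longrightarrow> p < u Q \<and> u Q \<le> v Q \<and> v Q < q \<and> (\<forall>h\<in>H. displaces h (u Q) (v Q) \<longrightarrow>
      (\<forall>y. fst Q < y \<and> y < snd Q \<longrightarrow> w \<rhd> y = y \<or> (h \<otimes> w \<otimes> inv h) \<rhd> y = y))"
    by metis
  \<comment> \<open>Besides the governing intervals, \<open>[c, d]\<close> has to contain
    \<open>x\<close>, \<open>z\<close> and the support of \<open>w\<close> on
    \<open>(p, q)\<close>.\<close>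
  define c where "c = Min (insert x (insert su (u ` Act)))"
  define d where "d = Max (insert z (insert sv (v ` Act)))"
  have cle: "c \<le> y" if "y \<in> insert x (insert su (u ` Act))" for y
    unfolding c_def by (rule Min_le[OF _ that]) (use finA in simp)
  have dge: "y \<le> d" if "y \<in> insert z (insert sv (v ` Act))" for y
    unfolding d_def by (rule Max_ge[OF _ that]) (use finA in simp)
  have c: "c \<le> x" "c \<le> su" "\<And>Q. Q \<in> Act \<Longrightarrow> c \<le> u Q" by (rule cle, blast)+
  have d: "z \<le> d" "sv \<le> d" "\<And>Q. Q \<in> Act \<Longrightarrow> v Q \<le> d" by (rule dge, blast)+
  have "p < c" unfolding c_def using finA x sup uv by (subst Min_gr_iff) auto
  have "d < q" unfolding d_def using finA z sup uv by (subst Max_less_iff) auto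
  obtain s where s: "s \<in> H" "x < s \<rhd> c" "s \<rhd> d < z"
    using contract[OF o f k(1), of x c d] x c d \<open>p < c\<close> \<open>d < q\<close> by (auto simp: z_def)
  have comm: "(h \<otimes> w \<otimes> inv h) \<otimes> w = w \<otimes> (h \<otimes> w \<otimes> inv h)" if h: "h \<in> H" "displaces h c d" for h
  proof -
    let ?v = "h \<otimes> w \<otimes> inv h"
    have hc: "h \<in> carrier L" "?v \<in> carrier L" using h wc H_carrier by auto
    have disj: "w \<rhd> y = y \<or> ?v \<rhd> y = y" for y
    proof (cases "w \<rhd> y = y")
      case False
      then obtain g where "g \<in> Y" "g \<rhd> y \<noteq> y" using generate_fixed[OF Y wH] by blast
      then obtain p' q' where o': "orb Y p' q'" "p' < y" "y < q'" using orb_exists[OF Y] by blast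
      then have A: "(p', q') \<in> Act" using False by (auto simp: Act_def active_def)
      have "displaces h (u (p', q')) (v (p', q'))"
        by (rule displaces_mono[OF hc(1) h(2)]) (use c d A in auto)
      then show ?thesis using uv[OF A] h o' by auto
    qed simp
    have "w \<rhd> ?v \<rhd> y = ?v \<rhd> w \<rhd> y" for y by (rule commute_at[OF wc hc(2) disj disj disj])
    then have "(inv (w \<otimes> ?v) \<otimes> (?v \<otimes> w)) \<rhd> y = y" for y
      using wc hc(2) by (simp add: act_mult inv_act_eq)
    then have "inv (w \<otimes> ?v) \<otimes> (?v \<otimes> w) = \<one>" using wc hc(2) by (intro faithful) auto
    then show ?thesis using wc hc(2) by (metis inv_equality inv_inv inv_closed m_closed)
  qed
  have supp: "c \<le> y \<and> y \<le> d" if "p < y" "y < q" "w \<rhd> y \<noteq> y" for y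
    using sup(4)[OF that] c d by linarith
  show ?thesis
    by (rule that[of w s p q c x z d]) (fact wH s o \<open>p < c\<close> c x d \<open>d < q\<close> z supp comm)+
qed

end

section \<open>Groups satisfying the relations of Brin's group\<close>

context group begin

lemma conj_group_hom: "t \<in> carrier G \<Longrightarrow> group_hom G G (\<lambda>a. t \<otimes> a \<otimes> inv t)"
proof
  assume t: "t \<in> carrier G"
  have "t \<otimes> (a \<otimes> b) \<otimes> inv t = t \<otimes> a \<otimes> inv t \<otimes> (t \<otimes> b \<otimes> inv t)" if "a \<in> carrier G" "b \<in> carrier G" for a b
    using t that by (simp add: m_assoc) (simp add: m_assoc[symmetric])
  with t show "(\<lambda>a. t \<otimes> a \<otimes> inv t) \<in> hom G G" by (intro homI) auto
qed

lemma generate_conj: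
  "\<lbrakk>t \<in> carrier G; A \<subseteq> carrier G\<rbrakk> \<Longrightarrow>
    generate G ((\<lambda>a. t \<otimes> a \<otimes> inv t) ` A) = (\<lambda>a. t \<otimes> a \<otimes> inv t) ` generate G A"
  using group_hom.generate_img[OF conj_group_hom] by blast

lemma commute_if_commutator_trivial:
  assumes "a \<in> carrier G" "b \<in> carrier G" "inv a \<otimes> inv b \<otimes> a \<otimes> b = \<one>"
  shows "a \<otimes> b = b \<otimes> a"
proof -
  have "inv (b \<otimes> a) \<otimes> (a \<otimes> b) = \<one>" using assms by (simp add: inv_mult_group m_assoc)
  then show ?thesis using assms by (metis inv_equality inv_inv inv_closed m_closed)
qed

lemma generate_finite_subset:
  assumes "x \<in> generate G A"
  obtains F where "finite F" "F \<subseteq> A" "x \<in> generate G F"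
proof -
  from assms have "\<exists>F. finite F \<and> F \<subseteq> A \<and> x \<in> generate G F"
  proof induction
    case one
    show ?case by (rule exI[of _ "{}"]) (simp add: generate.one)
  next
    case (incl h)
    then show ?case by (intro exI[of _ "{h}"]) (simp add: generate.incl)
  next
    case (inv h)
    then show ?case by (intro exI[of _ "{h}"]) (simp add: generate.inv)
  next
    case (eng g h)
    then obtain F F' where F: "finite F" "F \<subseteq> A" "g \<in> generate G F" "finite F'" "F' \<subseteq> A" "h \<in> generate G F'" by blast
    have "g \<in> generate G (F \<union> F')" by (rule subsetD[OF mono_generate F(3)]) blast
    moreover have "h \<in> generate G (F \<union> F')" by (rule subsetD[OF mono_generate F(6)]) blast
    ultimately have "g \<otimes> h \<in> generate G (F \<union> F')" by (rule generate.eng)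
    then show ?case using F by (intro exI[of _ "F \<union> F'"]) auto
  qed
  with that show ?thesis by blast
qed

lemma generate_commute:
  assumes A: "A \<subseteq> carrier G" and D: "D \<subseteq> carrier G"
    and comm: "\<And>a d. \<lbrakk>a \<in> A; d \<in> D\<rbrakk> \<Longrightarrow> a \<otimes> d = d \<otimes> a"
    and x: "x \<in> generate G A" and y: "y \<in> generate G D"
  shows "x \<otimes> y = y \<otimes> x"
proof -
  have inv_comm: "inv a \<otimes> b = b \<otimes> inv a" if "a \<in> carrier G" "b \<in> carrier G" "a \<otimes> b = b \<otimes> a" for a b
  proof -
    have "inv a \<otimes> (a \<otimes> b) = b" using that(1,2) by (simp flip: m_assoc)
    then have "b = inv a \<otimes> b \<otimes> a" using that by (simp add: m_assoc)
    then show ?thesis using that inv_solve_right[of "inv a \<otimes> b" b a] by simp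
  qed
  have step: "x \<otimes> d = d \<otimes> x" if d: "d \<in> carrier G" "\<And>a. a \<in> A \<Longrightarrow> a \<otimes> d = d \<otimes> a" for d
    using x
  proof induction
    case (inv a)
    then show ?case using inv_comm[of a d] A d by auto
  next
    case (eng g h)
    have c: "g \<in> carrier G" "h \<in> carrier G" using eng generate_in_carrier[OF A] by auto
    have "g \<otimes> (d \<otimes> h) = g \<otimes> d \<otimes> h" using c d by (simp add: m_assoc)
    also have "\<dots> = d \<otimes> (g \<otimes> h)" using c d eng by (simp add: m_assoc)
    finally show ?case using c d eng by (simp add: m_assoc)
  qed (use d in auto)
  have xc: "x \<in> carrier G" using generate_in_carrier[OF A x] .
  from y show ?thesis
  proof induction
    case (incl d)
    then show ?case using step[of d] comm D by auto
  next
    case (inv d)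
    then have "x \<otimes> d = d \<otimes> x" "d \<in> carrier G" using step[of d] comm D by auto
    then show ?case using inv_comm[of d x] xc by simp
  next
    case (eng g h)
    have c: "g \<in> carrier G" "h \<in> carrier G" using eng generate_in_carrier[OF D] by auto
    have "x \<otimes> (g \<otimes> h) = g \<otimes> x \<otimes> h" using c xc eng by (simp add: m_assoc[symmetric])
    then show ?case using c xc eng by (simp add: m_assoc)
  qed (use xc in auto)
qed

lemma generate_Un_commuting:
  assumes A: "A \<subseteq> carrier G" and D: "D \<subseteq> carrier G"
    and comm: "\<And>a d. \<lbrakk>a \<in> A; d \<in> D\<rbrakk> \<Longrightarrow> a \<otimes> d = d \<otimes> a"
    and x: "x \<in> generate G (A \<union> D)"
  obtains a d where "a \<in> generate G A" "d \<in> generate G D" "x = a \<otimes> d"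
proof -
  from x have "\<exists>a\<in>generate G A. \<exists>d\<in>generate G D. x = a \<otimes> d"
  proof induction
    case one
    show ?case by (rule bexI[OF _ generate.one], rule bexI[OF _ generate.one]) simp
  next
    case (incl h)
    then show ?case
    proof
      assume h: "h \<in> A"
      then show ?thesis using A by (intro bexI[OF _ generate.incl[OF h]] bexI[OF _ generate.one]) auto
    next
      assume h: "h \<in> D"
      then show ?thesis using D by (intro bexI[OF _ generate.one] bexI[OF _ generate.incl[OF h]]) auto
    qed
  next
    case (inv h)
    then show ?case
    proof
      assume h: "h \<in> A"
      then show ?thesis using A by (intro bexI[OF _ generate.inv[OF h]] bexI[OF _ generate.one]) auto
    next
      assume h: "h \<in> D"
      then show ?thesis using D by (intro bexI[OF _ generate.one] bexI[OF _ generate.inv[OF h]]) auto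
    qed
  next
    case (eng g h)
    then obtain a d a' d' where ad: "a \<in> generate G A" "d \<in> generate G D" "g = a \<otimes> d"
      "a' \<in> generate G A" "d' \<in> generate G D" "h = a' \<otimes> d'" by blast
    have c: "a \<in> carrier G" "d \<in> carrier G" "a' \<in> carrier G" "d' \<in> carrier G"
      using ad generate_in_carrier[OF A] generate_in_carrier[OF D] by auto
    have "a' \<otimes> d = d \<otimes> a'" by (rule generate_commute[OF A D comm ad(4,2)])
    then have "g \<otimes> h = a \<otimes> (a' \<otimes> d) \<otimes> d'" using ad c by (simp add: m_assoc)
    then have "g \<otimes> h = (a \<otimes> a') \<otimes> (d \<otimes> d')" using c by (simp add: m_assoc)
    moreover have "a \<otimes> a' \<in> generate G A" "d \<otimes> d' \<in> generate G D" using ad by (auto intro: generate.eng)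
    ultimately show ?case by blast
  qed
  with that show ?thesis by blast
qed

text \<open>Powers of \<open>t\<close> can be collected on the left because \<open>t\<close>
  normalizes the subgroup generated by \<open>A\<close>. Both directions are assumed, since
  conjugation could map a subgroup properly into itself.\<close>

lemma generate_insert_normalizing:
  assumes t: "t \<in> carrier G" and A: "A \<subseteq> carrier G"
    and norm: "\<And>a. a \<in> A \<Longrightarrow> t \<otimes> a \<otimes> inv t \<in> generate G A" "\<And>a. a \<in> A \<Longrightarrow> inv t \<otimes> a \<otimes> t \<in> generate G A"
    and x: "x \<in> generate G (insert t A)"
  obtains n :: int and c where "c \<in> generate G A" "x = t [^] n \<otimes> c"
proof -
  have sub: "(\<lambda>a. s \<otimes> a \<otimes> inv s) ` generate G A \<subseteq> generate G A"
    if s: "s \<in> carrier G" "\<And>a. a \<in> A \<Longrightarrow> s \<otimes> a \<otimes> inv s \<in> generate G A" for s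
    unfolding generate_conj[OF s(1) A, symmetric]
    by (rule generate_subgroup_incl[OF _ generate_is_subgroup[OF A]]) (use s in auto)
  have conj1: "t \<otimes> c \<otimes> inv t \<in> generate G A" if "c \<in> generate G A" for c
    using sub[OF t norm(1)] that by blast
  have conj2: "inv t \<otimes> c \<otimes> t \<in> generate G A" if "c \<in> generate G A" for c
    using sub[of "inv t"] t norm(2) that by auto
  have pow: "inv (t [^] n) \<otimes> c \<otimes> t [^] n \<in> generate G A" if "c \<in> generate G A" for c and n :: int
  proof -
    have up: "inv (t [^] k) \<otimes> c \<otimes> t [^] k \<in> generate G A" if "c \<in> generate G A" for c and k :: nat
      using that
    proof (induction k arbitrary: c)
      case 0
      then show ?case using generate_in_carrier[OF A] by simp
    next
      case (Suc k)
      have c: "c \<in> carrier G" using Suc generate_in_carrier[OF A] by auto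
      have "inv (t [^] Suc k) \<otimes> c \<otimes> t [^] Suc k = inv t \<otimes> (inv (t [^] k) \<otimes> c \<otimes> t [^] k) \<otimes> t"
        using t c by (simp add: inv_mult_group m_assoc)
      then show ?case using conj2 Suc by simp
    qed
    have down: "t [^] k \<otimes> c \<otimes> inv (t [^] k) \<in> generate G A" if "c \<in> generate G A" for c and k :: nat
      using that
    proof (induction k arbitrary: c)
      case 0
      then show ?case using generate_in_carrier[OF A] by simp
    next
      case (Suc k)
      have c: "c \<in> carrier G" using Suc generate_in_carrier[OF A] by auto
      have "t [^] Suc k \<otimes> c \<otimes> inv (t [^] Suc k) = t [^] k \<otimes> (t \<otimes> c \<otimes> inv t) \<otimes> inv (t [^] k)"
        using t c by (simp add: inv_mult_group m_assoc)
      then show ?case using conj1 Suc by simp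
    qed
    show ?thesis
    proof (cases "n < 0")
      case True
      then have "t [^] n = inv (t [^] nat (- n))" by (subst int_pow_def2) simp
      then show ?thesis using down[OF that, of "nat (- n)"] t by simp
    next
      case False
      then have "t [^] n = t [^] nat n" by (subst int_pow_def2) simp
      then show ?thesis using up[OF that, of "nat n"] by simp
    qed
  qed
  have tA: "insert t A \<subseteq> carrier G" using t A by blast
  from x have "\<exists>n::int. \<exists>c\<in>generate G A. x = t [^] n \<otimes> c"
  proof induction
    case one
    show ?case by (intro exI[of _ 0] bexI[OF _ generate.one]) simp
  next
    case (incl h)
    then show ?case
    proof
      assume "h = t"
      then show ?thesis using t by (intro exI[of _ 1] bexI[OF _ generate.one]) simp
    next
      assume h: "h \<in> A"
      then show ?thesis using A by (intro exI[of _ 0] bexI[OF _ generate.incl[OF h]]) auto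
    qed
  next
    case (inv h)
    then show ?case
    proof
      assume "h = t"
      then show ?thesis using t by (intro exI[of _ "-1"] bexI[OF _ generate.one]) (simp add: int_pow_neg)
    next
      assume h: "h \<in> A"
      then show ?thesis using A by (intro exI[of _ 0] bexI[OF _ generate.inv[OF h]]) auto
    qed
  next
    case (eng g h)
    then obtain n m :: int and c d where *: "g = t [^] n \<otimes> c" "h = t [^] m \<otimes> d"
      "c \<in> generate G A" "d \<in> generate G A" by blast
    have car: "c \<in> carrier G" "d \<in> carrier G" "t [^] n \<in> carrier G" "t [^] m \<in> carrier G"
      using * generate_in_carrier[OF A] t by auto
    define e where "e = inv (t [^] m) \<otimes> c \<otimes> t [^] m"
    have e: "e \<in> generate G A" "e \<in> carrier G" using pow[OF *(3)] car by (auto simp: e_def)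
    have "t [^] m \<otimes> e = c \<otimes> t [^] m" using car by (simp add: e_def flip: m_assoc)
    then have "g \<otimes> h = t [^] n \<otimes> (t [^] m \<otimes> e) \<otimes> d" using car * by (simp add: m_assoc)
    then have "g \<otimes> h = t [^] (n + m) \<otimes> (e \<otimes> d)" using car e t by (simp add: int_pow_mult m_assoc)
    moreover have "e \<otimes> d \<in> generate G A" by (rule generate.eng[OF e(1) *(4)])
    ultimately show ?case by blast
  qed
  with that show ?thesis by blast
qed

end

text \<open>The relations alone give a homomorphism from Brin's group; generation, split off into
  \<open>brin_like\<close>, is what the normal forms need.\<close>

locale brin_relations = group B for B (structure) +
  fixes w :: "int \<Rightarrow> 'a" and s :: 'a
  assumes w_closed: "w i \<in> carrier B" and s_closed: "s \<in> carrier B"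
    and shift: "inv s \<otimes> w i \<otimes> s = w (i + 1)"
    and commuting: "\<lbrakk>i < k; j < k; m \<noteq> (0::int)\<rbrakk> \<Longrightarrow>
      (inv (w k [^] m) \<otimes> w i \<otimes> w k [^] m) \<otimes> w j = w j \<otimes> (inv (w k [^] m) \<otimes> w i \<otimes> w k [^] m)"

locale brin_like = brin_relations +
  assumes generates: "generate B (insert s (range w)) = carrier B"
begin

lemma unshift: "s \<otimes> w i \<otimes> inv s = w (i - 1)"
proof -
  have "s \<otimes> (inv s \<otimes> w (i - 1) \<otimes> s) \<otimes> inv s = w (i - 1)"
    using s_closed w_closed by (simp add: m_assoc) (simp add: m_assoc[symmetric])
  then show ?thesis using shift[of "i - 1"] by simp
qed

lemma unshift_pow: "s [^] (n::nat) \<otimes> w i \<otimes> inv (s [^] n) = w (i - int n)"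
proof (induction n arbitrary: i)
  case (Suc n)
  have "s [^] Suc n \<otimes> w i \<otimes> inv (s [^] Suc n) = s [^] n \<otimes> (s \<otimes> w i \<otimes> inv s) \<otimes> inv (s [^] n)"
    using s_closed w_closed by (simp add: inv_mult_group m_assoc)
  also have "\<dots> = w (i - int (Suc n))" using Suc[of "i - 1"] by (simp add: unshift algebra_simps)
  finally show ?case .
qed (use w_closed in simp)

text \<open>Levels of an iterated wreath product: conjugated by \<open>s\<close>, an element of
  \<open>low (Suc N)\<close> is a power of \<open>w 0\<close> times an element of the base, a
  product of commuting copies of \<open>low N\<close> indexed by exponents of \<open>w 0\<close>.
  \<open>block\<close> consists of generators of one copy, \<open>blocks\<close> is the subgroup
  generated by several.\<close>

definition low :: "nat \<Rightarrow> 'a set" where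
  "low N = generate B (w ` {- int N..<0})"

definition block :: "nat \<Rightarrow> int \<Rightarrow> 'a set" where
  "block N m = (\<lambda>a. w 0 [^] m \<otimes> a \<otimes> inv (w 0 [^] m)) ` w ` {- int N..<0}"

definition blocks :: "nat \<Rightarrow> int set \<Rightarrow> 'a set" where
  "blocks N M = generate B (\<Union>m\<in>M. block N m)"

lemma block_closed: "block N m \<subseteq> carrier B"
  using w_closed by (auto simp: block_def)

lemma low_closed: "low N \<subseteq> carrier B"
  unfolding low_def using generate_incl[of "w ` {- int N..<0}"] w_closed by blast

lemma blocks_closed: "blocks N M \<subseteq> carrier B"
  unfolding blocks_def using generate_incl[of "\<Union>m\<in>M. block N m"] block_closed by blast

text \<open>Undoing the conjugation of \<open>b\<close> leaves a defining relation with
  \<open>k = 0\<close> and exponent \<open>n - m\<close>.\<close>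

lemma block_commute:
  assumes "m \<noteq> n" "a \<in> block N m" "b \<in> block N n"
  shows "a \<otimes> b = b \<otimes> a"
proof -
  obtain i j where ij: "i < 0" "j < 0" "a = w 0 [^] m \<otimes> w i \<otimes> inv (w 0 [^] m)" "b = w 0 [^] n \<otimes> w j \<otimes> inv (w 0 [^] n)"
    using assms by (auto simp: block_def)
  let ?P = "\<lambda>l::int. w 0 [^] l"
  have c: "?P l \<in> carrier B" "w i \<in> carrier B" "w j \<in> carrier B" for l using w_closed by auto
  define A where "A = inv (?P (n - m)) \<otimes> w i \<otimes> ?P (n - m)"
  have Ac: "A \<in> carrier B" using c by (simp add: A_def)
  have comm: "A \<otimes> w j = w j \<otimes> A" unfolding A_def by (rule commuting) (use ij assms in auto)
  have 1: "?P n \<otimes> inv (?P (n - m)) = ?P m"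
    using int_pow_mult[OF w_closed[of 0], of n "- (n - m)"] int_pow_neg[OF w_closed[of 0], of "n - m"] by simp
  have 2: "?P (n - m) \<otimes> inv (?P n) = inv (?P m)"
    using arg_cong[OF 1, of "\<lambda>x. inv x"] c by (simp add: inv_mult_group)
  have "?P n \<otimes> A \<otimes> inv (?P n) = (?P n \<otimes> inv (?P (n - m))) \<otimes> w i \<otimes> (?P (n - m) \<otimes> inv (?P n))"
    using c by (simp add: A_def m_assoc)
  then have a: "a = ?P n \<otimes> A \<otimes> inv (?P n)" using 1 2 ij by simp
  interpret h: group_hom B B "\<lambda>x. ?P n \<otimes> x \<otimes> inv (?P n)" by (rule conj_group_hom) (rule c)
  show ?thesis unfolding a ij(4) using comm h.hom_mult[OF Ac c(3)] h.hom_mult[OF c(3) Ac] by simp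
qed

text \<open>Powers of \<open>s\<close> are collected on the left. The remaining word involves
  finitely many \<open>w i\<close>, and conjugation by a high power of \<open>s\<close> makes all
  indices negative.\<close>

lemma decompose:
  assumes "b \<in> carrier B"
  obtains n :: int and r N :: nat and c where "c \<in> low N" "b = s [^] n \<otimes> (inv (s [^] r) \<otimes> c \<otimes> s [^] r)"
proof -
  have wc: "range w \<subseteq> carrier B" using w_closed by blast
  obtain n :: int and c where nc: "c \<in> generate B (range w)" "b = s [^] n \<otimes> c"
  proof (rule generate_insert_normalizing[OF s_closed wc, of b])
    show "b \<in> generate B (insert s (range w))" using assms generates by simp
  qed (auto simp: shift unshift intro: generate.incl)
  obtain F where F: "finite F" "F \<subseteq> range w" "c \<in> generate B F" using generate_finite_subset[OF nc(1)] .
  obtain I where I: "finite I" "F = w ` I" using finite_subset_image[OF F(1,2)] by blast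
  define K where "K = Max (insert 0 ((\<lambda>i. nat \<bar>i\<bar>) ` I))"
  have K: "\<bar>i\<bar> \<le> int K" if "i \<in> I" for i
  proof -
    have "nat \<bar>i\<bar> \<le> K" unfolding K_def using I that by (intro Max_ge) auto
    then show ?thesis by simp
  qed
  \<comment> \<open>\<open>r\<close> exceeds the absolute value of every index \<open>i\<close>, so
    \<open>i - r\<close> is negative and at least \<open>- 2 r\<close>.\<close>
  define r where "r = Suc K"
  have Fc: "F \<subseteq> carrier B" using F wc by blast
  have cc: "c \<in> carrier B" using generate_in_carrier[OF Fc F(3)] .
  have "(\<lambda>a. s [^] r \<otimes> a \<otimes> inv (s [^] r)) ` F \<subseteq> w ` {- int (2 * r)..<0}"
  proof (rule image_subsetI)
    fix a assume "a \<in> F"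
    then obtain i where i: "i \<in> I" "a = w i" using I by blast
    then show "s [^] r \<otimes> a \<otimes> inv (s [^] r) \<in> w ` {- int (2 * r)..<0}"
    proof -
      have "s [^] r \<otimes> a \<otimes> inv (s [^] r) = w (i - int r)" using i by (simp only: unshift_pow)
      moreover have "i - int r \<in> {- int (2 * r)..<0}"
      proof -
        have "int r = int K + 1" "int (2 * r) = 2 * int r" by (simp_all add: r_def)
        moreover have "i \<le> int K" "- i \<le> int K" using K[OF i(1)] by linarith+
        ultimately show ?thesis unfolding atLeastLessThan_iff by linarith
      qed
      ultimately show ?thesis by simp
    qed
  qed
  then have "generate B ((\<lambda>a. s [^] r \<otimes> a \<otimes> inv (s [^] r)) ` F) \<subseteq> low (2 * r)"
    unfolding low_def by (rule mono_generate)
  then have "s [^] r \<otimes> c \<otimes> inv (s [^] r) \<in> low (2 * r)"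
    using generate_conj[of "s [^] r" F] Fc F(3) s_closed by auto
  moreover have "inv (s [^] r) \<otimes> (s [^] r \<otimes> c \<otimes> inv (s [^] r)) \<otimes> s [^] r = c"
    using cc s_closed by (simp add: m_assoc) (simp add: m_assoc[symmetric])
  ultimately show ?thesis using that[of _ "2 * r" n r] nc by metis
qed

text \<open>Conjugation by \<open>s\<close> raises indices by one, so only the top generator becomes
  \<open>w 0\<close>, and its powers permute the blocks of the others.\<close>

lemma decompose_low:
  assumes b: "b \<in> low (Suc N)"
  obtains k :: int and M c where "finite M" "c \<in> blocks N M" "inv s \<otimes> b \<otimes> s = w 0 [^] k \<otimes> c"
proof -
  have "inv s \<otimes> b \<otimes> inv (inv s) \<in> (\<lambda>a. inv s \<otimes> a \<otimes> inv (inv s)) ` low (Suc N)" using b by blast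
  also have "\<dots> = generate B ((\<lambda>a. inv s \<otimes> a \<otimes> inv (inv s)) ` w ` {- int (Suc N)..<0})"
    unfolding low_def by (rule generate_conj[symmetric]) (use s_closed w_closed in auto)
  also have "\<dots> \<subseteq> generate B (insert (w 0) (\<Union>m. block N m))"
  proof (rule mono_generate, rule subsetI)
    fix x assume "x \<in> (\<lambda>a. inv s \<otimes> a \<otimes> inv (inv s)) ` w ` {- int (Suc N)..<0}"
    then obtain i where i: "- int (Suc N) \<le> i" "i < 0" "x = w (i + 1)" using s_closed by (auto simp: shift)
    show "x \<in> insert (w 0) (\<Union>m. block N m)"
    proof (cases "i = -1")
      case False
      then have "x \<in> block N 0" using i w_closed unfolding block_def by (auto intro!: image_eqI[of _ _ "x"])
      then show ?thesis by blast
    qed (use i in simp)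
  qed
  finally have x: "inv s \<otimes> b \<otimes> s \<in> generate B (insert (w 0) (\<Union>m. block N m))" using s_closed by simp
  have norm: "w 0 [^] l \<otimes> a \<otimes> inv (w 0 [^] l) \<in> block N (l + m)" if "a \<in> block N m" for a and l m :: int
  proof -
    obtain y where y: "y \<in> w ` {- int N..<0}" "a = w 0 [^] m \<otimes> y \<otimes> inv (w 0 [^] m)" using \<open>a \<in> block N m\<close> by (auto simp: block_def)
    have "w 0 [^] l \<otimes> a \<otimes> inv (w 0 [^] l) = w 0 [^] (l + m) \<otimes> y \<otimes> inv (w 0 [^] (l + m))"
      using y w_closed by (auto simp: int_pow_mult inv_mult_group m_assoc)
    with y show ?thesis by (auto simp: block_def)
  qed
  obtain k :: int and c where kc: "c \<in> generate B (\<Union>m. block N m)" "inv s \<otimes> b \<otimes> s = w 0 [^] k \<otimes> c"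
  proof (rule generate_insert_normalizing[OF w_closed _ _ _ x])
    show "(\<Union>m. block N m) \<subseteq> carrier B" using block_closed by blast
    fix a assume "a \<in> (\<Union>m. block N m)"
    then obtain m where m: "a \<in> block N m" by blast
    show "w 0 \<otimes> a \<otimes> inv (w 0) \<in> generate B (\<Union>m. block N m)"
      using norm[OF m, of 1] w_closed by (auto intro!: generate.incl)
    show "inv (w 0) \<otimes> a \<otimes> w 0 \<in> generate B (\<Union>m. block N m)"
      using norm[OF m, of "-1"] w_closed by (auto intro!: generate.incl simp: int_pow_neg)
  qed blast
  obtain F where F: "finite F" "F \<subseteq> (\<Union>m. block N m)" "c \<in> generate B F" using generate_finite_subset[OF kc(1)] .
  obtain M where M: "finite M" "F \<subseteq> (\<Union>m\<in>M. block N m)" using finite_subset_Union[OF F(1), of "range (block N)"] F(2)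
    by (metis finite_subset_image subset_UNIV)
  have "c \<in> blocks N M" unfolding blocks_def by (rule subsetD[OF mono_generate[OF M(2)] F(3)])
  with M kc that show ?thesis by blast
qed

lemma decompose_blocks:
  assumes c: "c \<in> blocks N (insert m M)" and m: "m \<notin> M"
  obtains c1 a where "c1 \<in> blocks N M" "a \<in> low N" "c = c1 \<otimes> (w 0 [^] m \<otimes> a \<otimes> inv (w 0 [^] m))"
proof -
  have "(\<Union>m\<in>insert m M. block N m) = (\<Union>m\<in>M. block N m) \<union> block N m" by blast
  then have c': "c \<in> generate B ((\<Union>m\<in>M. block N m) \<union> block N m)" using c by (simp add: blocks_def)
  obtain c1 d where cd: "c1 \<in> generate B (\<Union>m\<in>M. block N m)" "d \<in> generate B (block N m)" "c = c1 \<otimes> d"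
  proof (rule generate_Un_commuting[OF _ block_closed _ c'])
    show "(\<Union>m\<in>M. block N m) \<subseteq> carrier B" using block_closed by blast
    fix a d assume "a \<in> (\<Union>m\<in>M. block N m)" "d \<in> block N m"
    then obtain n where "n \<in> M" "a \<in> block N n" "d \<in> block N m" by blast
    moreover from this have "n \<noteq> m" using m by blast
    ultimately show "a \<otimes> d = d \<otimes> a" using block_commute[of n m a N d] by simp
  qed (rule that)
  have img: "generate B (block N m) = (\<lambda>a. w 0 [^] m \<otimes> a \<otimes> inv (w 0 [^] m)) ` low N"
    unfolding block_def low_def by (rule generate_conj) (use w_closed in auto)
  from cd(2)[unfolded img] obtain a where "d = w 0 [^] m \<otimes> a \<otimes> inv (w 0 [^] m)" "a \<in> low N"
    by (rule imageE)
  with cd(3) show ?thesis using that[OF cd(1)[folded blocks_def]] by simp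
qed

end

text \<open>Everything happens inside \<open>(p, q)\<close>: \<open>[c, d]\<close> carries the
  support of \<open>w 0\<close>, \<open>s\<close> squeezes it between \<open>x\<close> and
  \<open>z\<close>, and nonzero powers of \<open>w 0\<close> move \<open>[x, z]\<close> off itself.
  The generators with negative index are thereby confined to \<open>(x, z)\<close>.\<close>

locale brin_action = pl_action L act + brin: brin_like B w s + hom: group_hom B L \<phi>
  for L :: "('a, 'm) monoid_scheme" (structure) and act :: "'a \<Rightarrow> real \<Rightarrow> real" (infixr "\<rhd>" 72)
    and B :: "('b, 'n) monoid_scheme" and w :: "int \<Rightarrow> 'b" and s :: 'b and \<phi> :: "'b \<Rightarrow> 'a" +
  fixes p q c d x z :: real
  assumes w_ends: "\<phi> (w 0) \<rhd> p = p" "\<phi> (w 0) \<rhd> q = q"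
    and s_ends: "\<phi> s \<rhd> p = p" "\<phi> s \<rhd> q = q"
    and points: "p < c" "c \<le> x" "x < z" "z \<le> d" "d < q"
    and contracts: "x < \<phi> s \<rhd> c" "\<phi> s \<rhd> d < z"
    and support: "\<lbrakk>p < y; y < q; \<phi> (w 0) \<rhd> y \<noteq> y\<rbrakk> \<Longrightarrow> c \<le> y \<and> y \<le> d"
    and displaced: "m \<noteq> (0::int) \<Longrightarrow> displaces (\<phi> (w 0) [^] m) x z"
begin

lemma hom_closed_simp [simp]: "b \<in> carrier B \<Longrightarrow> \<phi> b \<in> carrier L"
  by (rule hom.hom_closed)

lemmas [simp] = brin.w_closed brin.s_closed

lemma hom_fixed:
  assumes "A \<subseteq> carrier B" "b \<in> generate B A" "\<And>a. a \<in> A \<Longrightarrow> \<phi> a \<rhd> y = y"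
  shows "\<phi> b \<rhd> y = y"
proof (rule generate_fixed)
  show "\<phi> b \<in> generate L (\<phi> ` A)" using hom.generate_img[OF assms(1)] assms(2) by blast
qed (use assms in auto)

lemma ends_fixed:
  assumes b: "b \<in> carrier B"
  shows "\<phi> b \<rhd> p = p" "\<phi> b \<rhd> q = q"
proof -
  have all: "\<phi> b \<rhd> y = y" if w: "\<phi> (w 0) \<rhd> y = y" and s: "\<phi> s \<rhd> y = y" for y
  proof (rule hom_fixed)
    show "b \<in> generate B (insert s (range w))" using b brin.generates by simp
    have si: "inv (\<phi> s) \<rhd> y = y" using s by (simp add: inv_act_eq)
    have "\<phi> (w i) \<rhd> y = y" for i
    proof (induction i rule: int_induct[where k = 0])
      case base
      then show ?case by (rule w)
    next
      case (step1 i)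
      then show ?case using brin.shift[of i, symmetric] s si by (simp add: act_mult)
    next
      case (step2 i)
      then show ?case using brin.unshift[of i, symmetric] s si by (simp add: act_mult)
    qed
    then show "\<phi> a \<rhd> y = y" if "a \<in> insert s (range w)" for a using that s by auto
  qed auto
  show "\<phi> b \<rhd> p = p" "\<phi> b \<rhd> q = q" using all w_ends s_ends by auto
qed

lemma act_inside:
  assumes b: "b \<in> carrier B" and y: "p < y" "y < q"
  shows "p < \<phi> b \<rhd> y" "\<phi> b \<rhd> y < q"
proof -
  have "\<phi> b \<rhd> p < \<phi> b \<rhd> y" "\<phi> b \<rhd> y < \<phi> b \<rhd> q" using b y by simp_all
  then show "p < \<phi> b \<rhd> y" "\<phi> b \<rhd> y < q" using ends_fixed[OF b] by auto
qed

lemma contracts_pow: "x < \<phi> s [^] Suc n \<rhd> c" "\<phi> s [^] Suc n \<rhd> d < z"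
proof -
  have "x < \<phi> s [^] Suc n \<rhd> c \<and> \<phi> s [^] Suc n \<rhd> d < z"
  proof (induction n)
    case 0
    then show ?case using contracts by simp
  next
    case (Suc n)
    have "c < \<phi> s \<rhd> c" "\<phi> s \<rhd> d < d" using contracts points by linarith+
    then have lt: "\<phi> s [^] Suc n \<rhd> c < \<phi> s [^] Suc n \<rhd> \<phi> s \<rhd> c" "\<phi> s [^] Suc n \<rhd> \<phi> s \<rhd> d < \<phi> s [^] Suc n \<rhd> d"
      by simp_all
    have "\<phi> s [^] Suc (Suc n) \<rhd> y = \<phi> s [^] Suc n \<rhd> \<phi> s \<rhd> y" for y
      using nat_pow_Suc[of "\<phi> s" "Suc n"] by (simp add: act_mult del: nat_pow_Suc)
    then show ?case using lt Suc by (simp only:) linarith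
  qed
  then show "x < \<phi> s [^] Suc n \<rhd> c" "\<phi> s [^] Suc n \<rhd> d < z" by auto
qed

text \<open>For negative \<open>i\<close> the support is the image of that of \<open>w 0\<close>
  under a positive power of \<open>s\<close>, which lies between \<open>x\<close> and
  \<open>z\<close>.\<close>

lemma w_fixes_outside:
  assumes "i < 0" "p < y" "y < q" "y \<le> x \<or> z \<le> y"
  shows "\<phi> (w i) \<rhd> y = y"
proof (rule ccontr)
  assume no: "\<phi> (w i) \<rhd> y \<noteq> y"
  \<comment> \<open>The form \<open>0 - int (Suc n)\<close> matches \<open>unshift_pow\<close> and
    guarantees at least one contraction.\<close>
  obtain n where n: "i = 0 - int (Suc n)" using assms(1) by (metis diff_0 int_cases3 nat.exhaust of_nat_0 order_less_irrefl zero_less_imp_eq_int less_le_not_le neg_0_less_iff_less minus_minus gr0_implies_Suc)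
  define g where "g = s [^]\<^bsub>B\<^esub> Suc n"
  have g: "g \<in> carrier B" unfolding g_def using brin.nat_pow_closed[OF brin.s_closed] .
  have "w i = g \<otimes>\<^bsub>B\<^esub> w 0 \<otimes>\<^bsub>B\<^esub> inv\<^bsub>B\<^esub> g" unfolding n g_def by (rule brin.unshift_pow[symmetric])
  then have mv: "\<phi> (w 0) \<rhd> inv (\<phi> g) \<rhd> y \<noteq> inv (\<phi> g) \<rhd> y"
    using no g by (auto simp: act_mult)
  have "p < inv (\<phi> g) \<rhd> y" "inv (\<phi> g) \<rhd> y < q"
    using act_inside[of "inv\<^bsub>B\<^esub> g"] g assms by (auto)
  then have "c \<le> inv (\<phi> g) \<rhd> y" "inv (\<phi> g) \<rhd> y \<le> d" using support mv by auto
  then have "\<phi> g \<rhd> c \<le> y" "y \<le> \<phi> g \<rhd> d" using g hom_closed_simp by (metis act_inv2 act_le_iff)+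
  moreover have "\<phi> g = \<phi> s [^] Suc n" unfolding g_def by (rule hom.hom_nat_pow) simp
  ultimately show False using contracts_pow[of n] assms by auto
qed

lemma low_fixes_outside:
  assumes "a \<in> brin.low N" "p < y" "y < q" "y \<le> x \<or> z \<le> y"
  shows "\<phi> a \<rhd> y = y"
  using assms(1) unfolding brin.low_def
  by (rule hom_fixed[rotated]) (use w_fixes_outside assms in auto)

lemma low_preserves:
  assumes a: "a \<in> brin.low N" and y: "x < y" "y < z"
  shows "x < \<phi> a \<rhd> y" "\<phi> a \<rhd> y < z"
proof -
  have ac: "a \<in> carrier B" using a brin.low_closed by blast
  have "\<phi> a \<rhd> x = x" "\<phi> a \<rhd> z = z" using low_fixes_outside[OF a] points by auto
  moreover have "\<phi> a \<rhd> x < \<phi> a \<rhd> y" "\<phi> a \<rhd> y < \<phi> a \<rhd> z" using ac y by simp_all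
  ultimately show "x < \<phi> a \<rhd> y" "\<phi> a \<rhd> y < z" by auto
qed

lemma pow_leaves:
  assumes "m \<noteq> (0::int)" "x \<le> y" "y \<le> z"
  shows "\<phi> (w 0) [^] m \<rhd> y \<le> x \<or> z \<le> \<phi> (w 0) [^] m \<rhd> y"
proof -
  have "\<phi> (w 0) [^] m \<rhd> x \<le> \<phi> (w 0) [^] m \<rhd> y" "\<phi> (w 0) [^] m \<rhd> y \<le> \<phi> (w 0) [^] m \<rhd> z" using assms by auto
  then show ?thesis using displaced[OF assms(1)] unfolding displaces_def by linarith
qed

lemma blocks_fix:
  assumes b: "b \<in> brin.blocks N M" and y: "p < y" "y < q"
    and out: "\<And>m. m \<in> M \<Longrightarrow> \<phi> (w 0) [^] (- m) \<rhd> y \<le> x \<or> z \<le> \<phi> (w 0) [^] (- m) \<rhd> y"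
  shows "\<phi> b \<rhd> y = y"
proof (rule hom_fixed)
  show "b \<in> generate B (\<Union>m\<in>M. brin.block N m)" using b by (simp add: brin.blocks_def)
  show "(\<Union>m\<in>M. brin.block N m) \<subseteq> carrier B" using brin.block_closed by blast
  fix a assume "a \<in> (\<Union>m\<in>M. brin.block N m)"
  then obtain m i where a: "m \<in> M" "i < 0" "a = w 0 [^]\<^bsub>B\<^esub> m \<otimes>\<^bsub>B\<^esub> w i \<otimes>\<^bsub>B\<^esub> inv\<^bsub>B\<^esub> (w 0 [^]\<^bsub>B\<^esub> m)"
    by (auto simp: brin.block_def)
  have P: "\<phi> (w 0 [^]\<^bsub>B\<^esub> l) = \<phi> (w 0) [^] l" for l :: int by (rule hom.hom_int_pow) simp
  have "p < \<phi> (w 0 [^]\<^bsub>B\<^esub> (- m)) \<rhd> y" "\<phi> (w 0 [^]\<^bsub>B\<^esub> (- m)) \<rhd> y < q" using act_inside[OF _ y] by auto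
  then have "\<phi> (w i) \<rhd> \<phi> (w 0) [^] (- m) \<rhd> y = \<phi> (w 0) [^] (- m) \<rhd> y"
    using w_fixes_outside[OF a(2)] out[OF a(1)] P by simp
  then show "\<phi> a \<rhd> y = y" using a(3) P by (simp add: act_mult int_pow_neg)
qed

text \<open>The copies act on disjoint translates of \<open>(x, z)\<close>, so on the translate by
  the \<open>m\<close>-th power of \<open>w 0\<close> only the factor with index \<open>m\<close> is
  visible. It must be trivial and can be split off.\<close>

lemma blocks_trivial:
  assumes IH: "\<And>a. \<lbrakk>a \<in> brin.low N; \<And>y. \<lbrakk>x < y; y < z\<rbrakk> \<Longrightarrow> \<phi> a \<rhd> y = y\<rbrakk> \<Longrightarrow> a = \<one>\<^bsub>B\<^esub>"
    and "finite M" "b \<in> brin.blocks N M" "\<And>y. \<lbrakk>c \<le> y; y \<le> d\<rbrakk> \<Longrightarrow> \<phi> b \<rhd> y = y"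
  shows "b = \<one>\<^bsub>B\<^esub>"
  using assms(2-)
proof (induction M arbitrary: b)
  case empty
  then show ?case by (simp add: brin.blocks_def brin.generate_empty)
next
  case (insert m M)
  obtain b1 a where ba: "b1 \<in> brin.blocks N M" "a \<in> brin.low N"
    "b = b1 \<otimes>\<^bsub>B\<^esub> (w 0 [^]\<^bsub>B\<^esub> m \<otimes>\<^bsub>B\<^esub> a \<otimes>\<^bsub>B\<^esub> inv\<^bsub>B\<^esub> (w 0 [^]\<^bsub>B\<^esub> m))"
    using brin.decompose_blocks[OF insert.prems(1) insert.hyps(2)] by blast
  have car: "b1 \<in> carrier B" "a \<in> carrier B" using ba brin.blocks_closed brin.low_closed by blast+
  have P: "\<phi> (w 0 [^]\<^bsub>B\<^esub> l) = \<phi> (w 0) [^] l" for l :: int by (rule hom.hom_int_pow) simp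
  let ?P = "\<lambda>l::int. \<phi> (w 0) [^] l"
  have Pc: "?P l \<in> carrier L" for l by simp
  have PP: "?P k \<rhd> ?P l \<rhd> y = ?P (k + l) \<rhd> y" for k l y by (simp add: int_pow_mult act_mult)
  have "a = \<one>\<^bsub>B\<^esub>"
  proof (rule IH[OF ba(2)])
    fix y assume y: "x < y" "y < z"
    have ypq: "p < y" "y < q" using y points by auto
    \<comment> \<open>Triviality of \<open>b\<close> is known on \<open>[c, d]\<close> only. If
      \<open>w 0\<close> moves \<open>y\<close>, it also moves \<open>?P m \<rhd> y\<close>, which
      then lies in the support; if it fixes \<open>y\<close>, so does its power.\<close>
    have cd: "c \<le> ?P m \<rhd> y" "?P m \<rhd> y \<le> d"
    proof -
      have "c \<le> ?P m \<rhd> y \<and> ?P m \<rhd> y \<le> d"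
      proof (cases "\<phi> (w 0) \<rhd> y = y")
        case True
        have "?P m \<rhd> y = y"
          by (rule generate_fixed[of "{\<phi> (w 0)}"]) (use True generate_pow[of "\<phi> (w 0)"] in auto)
        then show ?thesis using y points by simp
      next
        case False
        have "?P 1 \<rhd> ?P m \<rhd> y = ?P m \<rhd> ?P 1 \<rhd> y" by (simp add: PP add.commute del: int_pow_1)
        then have "\<phi> (w 0) \<rhd> ?P m \<rhd> y \<noteq> ?P m \<rhd> y" using False by simp
        then show ?thesis using support act_inside[of "w 0 [^]\<^bsub>B\<^esub> m", OF _ ypq] P by simp
      qed
      then show "c \<le> ?P m \<rhd> y" "?P m \<rhd> y \<le> d" by auto
    qed
    have "\<phi> b \<rhd> ?P m \<rhd> y = ?P m \<rhd> y" by (rule insert.prems(2)[OF cd])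
    moreover have "\<phi> b \<rhd> ?P m \<rhd> y = \<phi> b1 \<rhd> ?P m \<rhd> \<phi> a \<rhd> y"
      using ba(3) car P by (simp add: act_mult)
    moreover have "\<phi> b1 \<rhd> ?P m \<rhd> \<phi> a \<rhd> y = ?P m \<rhd> \<phi> a \<rhd> y"
    proof (rule blocks_fix[OF ba(1)])
      have in1: "x < \<phi> a \<rhd> y" "\<phi> a \<rhd> y < z" using low_preserves[OF ba(2) y] by auto
      then have "p < \<phi> a \<rhd> y" "\<phi> a \<rhd> y < q" using points by auto
      then show "p < ?P m \<rhd> \<phi> a \<rhd> y" "?P m \<rhd> \<phi> a \<rhd> y < q"
        using act_inside[of "w 0 [^]\<^bsub>B\<^esub> m"] P by auto
      fix n assume "n \<in> M"
      then have "- n + m \<noteq> 0" using insert.hyps(2) by auto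
      then show "?P (- n) \<rhd> ?P m \<rhd> \<phi> a \<rhd> y \<le> x \<or> z \<le> ?P (- n) \<rhd> ?P m \<rhd> \<phi> a \<rhd> y"
        unfolding PP by (rule pow_leaves) (use in1 in auto)
    qed
    ultimately have "?P m \<rhd> \<phi> a \<rhd> y = ?P m \<rhd> y" by simp
    then show "\<phi> a \<rhd> y = y" using act_eq_iff[OF Pc[of m], of "\<phi> a \<rhd> y" y] by simp
  qed
  then have "b = b1" using ba(3) car by simp
  then show ?case using insert.IH[OF ba(1)] insert.prems(2) by simp
qed

text \<open>Conjugation by \<open>s\<close> turns triviality on \<open>(x, z)\<close> into
  triviality on \<open>[c, d]\<close>. The base part \<open>e\<close> fixes \<open>x\<close>, an end
  of \<open>(x, z)\<close> that no power of \<open>w 0\<close> carries inside. Hence the power of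
  \<open>w 0\<close> fixes \<open>x\<close> too, and its exponent is zero.\<close>

lemma low_trivial:
  "\<lbrakk>b \<in> brin.low N; \<And>y. \<lbrakk>x < y; y < z\<rbrakk> \<Longrightarrow> \<phi> b \<rhd> y = y\<rbrakk> \<Longrightarrow> b = \<one>\<^bsub>B\<^esub>"
proof (induction N arbitrary: b)
  case 0
  then show ?case by (simp add: brin.low_def brin.generate_empty)
next
  case (Suc N)
  obtain k :: int and M e where e: "finite M" "e \<in> brin.blocks N M"
    "inv\<^bsub>B\<^esub> s \<otimes>\<^bsub>B\<^esub> b \<otimes>\<^bsub>B\<^esub> s = w 0 [^]\<^bsub>B\<^esub> k \<otimes>\<^bsub>B\<^esub> e"
    by (rule brin.decompose_low[OF Suc.prems(1)])
  have car: "b \<in> carrier B" "e \<in> carrier B" using Suc.prems e brin.low_closed brin.blocks_closed by blast+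
  have P: "\<phi> (w 0 [^]\<^bsub>B\<^esub> l) = \<phi> (w 0) [^] l" for l :: int by (rule hom.hom_int_pow) simp
  have triv: "\<phi> (w 0) [^] k \<rhd> \<phi> e \<rhd> y = y" if y: "c \<le> y" "y \<le> d" for y
  proof -
    have "\<phi> s \<rhd> c \<le> \<phi> s \<rhd> y" "\<phi> s \<rhd> y \<le> \<phi> s \<rhd> d" using y by simp_all
    then have "x < \<phi> s \<rhd> y" "\<phi> s \<rhd> y < z" using contracts by linarith+
    then have "\<phi> (inv\<^bsub>B\<^esub> s \<otimes>\<^bsub>B\<^esub> b \<otimes>\<^bsub>B\<^esub> s) \<rhd> y = y" using Suc.prems(2) car by (simp add: act_mult)
    then show ?thesis using car P unfolding e(3) by (simp add: act_mult)
  qed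
  have "\<phi> e \<rhd> x = x"
  proof (rule blocks_fix[OF e(2)])
    fix m :: int
    show "\<phi> (w 0) [^] (- m) \<rhd> x \<le> x \<or> z \<le> \<phi> (w 0) [^] (- m) \<rhd> x"
      by (cases "m = 0") (use pow_leaves[of "- m" x] points act_one in auto)
  qed (use points in auto)
  then have "\<phi> (w 0) [^] k \<rhd> x = x" using triv[of x] points by simp
  then have "k = 0" using displaced[of k] not_displaces_fixed[of "\<phi> (w 0) [^] k" x x z] points by auto
  then have "\<phi> e \<rhd> y = y" if "c \<le> y" "y \<le> d" for y using triv[OF that] by (simp add: act_one)
  then have "e = \<one>\<^bsub>B\<^esub>" using blocks_trivial[OF Suc.IH e(1,2)] by blast
  then have "inv\<^bsub>B\<^esub> s \<otimes>\<^bsub>B\<^esub> b \<otimes>\<^bsub>B\<^esub> s = \<one>\<^bsub>B\<^esub>" using e(3) \<open>k = 0\<close> by simp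
  then have "s \<otimes>\<^bsub>B\<^esub> (inv\<^bsub>B\<^esub> s \<otimes>\<^bsub>B\<^esub> b \<otimes>\<^bsub>B\<^esub> s) \<otimes>\<^bsub>B\<^esub> inv\<^bsub>B\<^esub> s = \<one>\<^bsub>B\<^esub>" by simp
  moreover have "s \<otimes>\<^bsub>B\<^esub> (inv\<^bsub>B\<^esub> s \<otimes>\<^bsub>B\<^esub> b \<otimes>\<^bsub>B\<^esub> s) \<otimes>\<^bsub>B\<^esub> inv\<^bsub>B\<^esub> s = b"
    using car by (simp add: brin.m_assoc) (simp flip: brin.m_assoc)
  ultimately show ?case by simp
qed

text \<open>Positive powers of \<open>s\<close> raise \<open>x\<close>, whereas elements of
  \<open>low N\<close> fix it. So a kernel element has exponent \<open>n = 0\<close> and is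
  conjugate to an element of some \<open>low N\<close> that acts trivially.\<close>

lemma injective: "inj_on \<phi> (carrier B)"
  unfolding hom.inj_on_one_iff
proof (intro allI impI)
  fix b assume b: "b \<in> carrier B" "\<phi> b = \<one>"
  obtain n :: int and r N :: nat and e where e: "e \<in> brin.low N"
    "b = s [^]\<^bsub>B\<^esub> n \<otimes>\<^bsub>B\<^esub> (inv\<^bsub>B\<^esub> (s [^]\<^bsub>B\<^esub> r) \<otimes>\<^bsub>B\<^esub> e \<otimes>\<^bsub>B\<^esub> s [^]\<^bsub>B\<^esub> r)"
    by (rule brin.decompose[OF b(1)])
  have ec: "e \<in> carrier B" using e brin.low_closed by blast
  let ?R = "s [^]\<^bsub>B\<^esub> r"
  have Rc: "?R \<in> carrier B" by simp
  have powc: "s [^]\<^bsub>B\<^esub> n \<in> carrier B" by simp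
  have rn: "?R = s [^]\<^bsub>B\<^esub> int r" by (simp add: int_pow_int)
  have "?R \<otimes>\<^bsub>B\<^esub> s [^]\<^bsub>B\<^esub> n = s [^]\<^bsub>B\<^esub> n \<otimes>\<^bsub>B\<^esub> ?R"
    unfolding rn by (simp add: brin.int_pow_mult[symmetric] add.commute)
  then have "?R \<otimes>\<^bsub>B\<^esub> b = s [^]\<^bsub>B\<^esub> n \<otimes>\<^bsub>B\<^esub> ?R \<otimes>\<^bsub>B\<^esub> (inv\<^bsub>B\<^esub> ?R \<otimes>\<^bsub>B\<^esub> e \<otimes>\<^bsub>B\<^esub> ?R)"
    using ec Rc powc e(2) by (simp add: brin.m_assoc flip: brin.m_assoc)
  also have "\<dots> = s [^]\<^bsub>B\<^esub> n \<otimes>\<^bsub>B\<^esub> e \<otimes>\<^bsub>B\<^esub> ?R"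
  proof -
    have "?R \<otimes>\<^bsub>B\<^esub> (inv\<^bsub>B\<^esub> ?R \<otimes>\<^bsub>B\<^esub> e \<otimes>\<^bsub>B\<^esub> ?R) = e \<otimes>\<^bsub>B\<^esub> ?R" using ec Rc by (simp flip: brin.m_assoc)
    then show ?thesis using ec Rc powc by (simp add: brin.m_assoc)
  qed
  finally have eq: "?R \<otimes>\<^bsub>B\<^esub> b = s [^]\<^bsub>B\<^esub> n \<otimes>\<^bsub>B\<^esub> e \<otimes>\<^bsub>B\<^esub> ?R" .
  have triv: "\<phi> (s [^]\<^bsub>B\<^esub> n) \<rhd> \<phi> e \<rhd> y = y" for y
  proof -
    have "\<phi> (?R \<otimes>\<^bsub>B\<^esub> b) = \<phi> ?R" using b Rc by (simp only: hom.hom_mult hom_closed_simp r_one)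
    then have "\<phi> ?R = \<phi> (s [^]\<^bsub>B\<^esub> n) \<otimes> \<phi> e \<otimes> \<phi> ?R" using eq ec Rc powc by (simp only: hom.hom_mult brin.m_closed)
    then have "\<phi> ?R \<rhd> inv (\<phi> ?R) \<rhd> y = (\<phi> (s [^]\<^bsub>B\<^esub> n) \<otimes> \<phi> e \<otimes> \<phi> ?R) \<rhd> inv (\<phi> ?R) \<rhd> y" by simp
    then show ?thesis using ec hom_closed_simp[OF Rc] hom_closed_simp[OF powc] hom_closed_simp[OF ec]
      by (simp only: act_mult m_closed act_inv2)
  qed
  have "\<phi> e \<rhd> x = x" using low_fixes_outside[OF e(1), of x] points by auto
  then have fx: "\<phi> (s [^]\<^bsub>B\<^esub> n) \<rhd> x = x" using triv[of x] by simp
  have up: "x < \<phi> s [^] Suc k \<rhd> x" for k :: nat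
  proof -
    have "\<phi> s [^] Suc k \<rhd> c \<le> \<phi> s [^] Suc k \<rhd> x" by (subst act_le_iff) (use points in auto)
    then show ?thesis using contracts_pow(1)[of k] by linarith
  qed
  have "n = 0"
  proof (rule ccontr)
    assume "n \<noteq> 0"
    then obtain k where k: "nat \<bar>n\<bar> = Suc k" by (cases "nat \<bar>n\<bar>") auto
    have "\<phi> (s [^]\<^bsub>B\<^esub> n) = \<phi> s [^] n" by (rule hom.hom_int_pow) simp
    moreover have "\<phi> s [^] n = \<phi> s [^] Suc k \<or> \<phi> s [^] n = inv (\<phi> s [^] Suc k)"
      using k \<open>n \<noteq> 0\<close> by (cases "n < 0") (simp_all add: int_pow_def2)
    moreover have "\<phi> s [^] Suc k \<in> carrier L" by (rule nat_pow_closed) simp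
    ultimately have "\<phi> s [^] Suc k \<rhd> x = x" using fx by (metis inv_act_eq)
    then show False using up[of k] by simp
  qed
  then have "\<phi> e \<rhd> y = y" for y using triv[of y] by (simp add: act_one)
  then have "e = \<one>\<^bsub>B\<^esub>" using low_trivial[OF e(1)] by blast
  then show "b = \<one>\<^bsub>B\<^esub>" using e(2) \<open>n = 0\<close> Rc by simp
qed

end

section \<open>The universal property of a presentation\<close>

definition word_value :: "('g, 'm) monoid_scheme \<Rightarrow> ('x \<Rightarrow> 'g) \<Rightarrow> ('x \<times> bool) list \<Rightarrow> 'g" where
  "word_value K \<gamma> u =
    foldr (\<lambda>(x, e) g. (if e then \<gamma> x else inv\<^bsub>K\<^esub> \<gamma> x) \<otimes>\<^bsub>K\<^esub> g) u \<one>\<^bsub>K\<^esub>"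

text \<open>Equivalent words have equal values, so the chosen representative does not
  matter.\<close>

definition free_hom :: "('g, 'm) monoid_scheme \<Rightarrow> ('x \<Rightarrow> 'g) \<Rightarrow> ('x \<times> bool) list set \<Rightarrow> 'g" where
  "free_hom K \<gamma> A = word_value K \<gamma> (SOME u. u \<in> A)"

context group begin

context
  fixes \<gamma> :: "'x \<Rightarrow> 'a"
  assumes \<gamma>: "\<And>x. \<gamma> x \<in> carrier G"
begin

lemma word_value_closed: "word_value G \<gamma> u \<in> carrier G"
  unfolding word_value_def by (induction u) (auto simp: \<gamma>)

lemma word_value_append: "word_value G \<gamma> (u @ v) = word_value G \<gamma> u \<otimes> word_value G \<gamma> v"
proof (induction u)
  case Nil
  then show ?case using word_value_closed[of v] by (simp add: word_value_def)
next
  case (Cons a u)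
  obtain x e where a: "a = (x, e)" by force
  have step: "word_value G \<gamma> (a # t) = (if e then \<gamma> x else inv \<gamma> x) \<otimes> word_value G \<gamma> t" for t
    by (simp add: word_value_def a)
  show ?case using Cons word_value_closed[of u] word_value_closed[of v] \<gamma>[of x]
    by (simp add: step m_assoc)
qed

lemma word_value_eq: "word_eq u v \<Longrightarrow> word_value G \<gamma> u = word_value G \<gamma> v"
proof (induction rule: word_eq.induct)
  case (cancel u x e v)
  have "word_value G \<gamma> ((x, e) # (x, \<not> e) # v) = word_value G \<gamma> v"
    using word_value_closed[of v] \<gamma>[of x] by (simp add: word_value_def flip: m_assoc)
  then show ?case by (simp add: word_value_append)
qed auto

lemma free_hom_class: "free_hom G \<gamma> {v. word_eq u v} = word_value G \<gamma> u"
proof -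
  have "word_eq u (SOME v. v \<in> {v. word_eq u v})"
    using someI[of "\<lambda>v. v \<in> {v. word_eq u v}" u] word_eq.refl by auto
  then show ?thesis unfolding free_hom_def by (rule word_value_eq[symmetric])
qed

lemma free_hom_gen: "free_hom G \<gamma> (free_gen x) = \<gamma> x"
  unfolding free_gen_def free_hom_class by (simp add: word_value_def \<gamma>)

lemma group_hom_free: "group_hom free_group G (free_hom G \<gamma>)"
proof -
  have "free_hom G \<gamma> \<in> hom free_group G"
    by (rule homI) (auto simp: carrier_free_group free_hom_class word_value_closed mult_free_group word_value_append)
  then show ?thesis
    by (intro group_hom.intro group_hom_axioms.intro group_free_group is_group)
qed

end

end

lemma generate_free_gen:
  "generate free_group (range free_gen) = (carrier free_group :: ('x \<times> bool) list set set)"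
    (is "?G = ?C")
proof
  interpret F: group "free_group :: ('x \<times> bool) list set monoid" by (rule group_free_group)
  show "?G \<subseteq> ?C"
    by (rule F.generate_incl) (auto simp: free_gen_closed)
  have "{v. word_eq u v} \<in> generate free_group (range free_gen)" for u :: "('x \<times> bool) list"
  proof (induction u)
    case Nil
    then show ?case using generate.one[of free_group] by (simp add: one_free_group)
  next
    case (Cons a u)
    obtain x e where a: "a = (x, e)" by force
    have gen: "{v. word_eq [(x, True)] v} \<in> generate free_group (range free_gen)"
    proof -
      have "{v. word_eq [(x, True)] v} = free_gen x" by (simp add: free_gen_def)
      then show ?thesis by (simp only:) (intro generate.incl rangeI)
    qed
    have "{v. word_eq [a] v} \<in> generate free_group (range free_gen)"
    proof (cases e)
      case False
      have "word_eq [(x, False), (x, True)] []" using word_eq.cancel[of "[]" x False "[]"] by simp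
      then have "{v. word_eq [(x, False), (x, True)] v} = {v. word_eq [] v}"
        using word_eq.sym word_eq.trans by blast
      then have "{v. word_eq [(x, False)] v} \<otimes>\<^bsub>free_group\<^esub> free_gen x = \<one>\<^bsub>free_group\<^esub>"
        by (simp add: free_gen_def mult_free_group one_free_group)
      then have "inv\<^bsub>free_group\<^esub> free_gen x = {v. word_eq [(x, False)] v}"
        by (rule F.inv_equality[OF _ free_gen_closed]) (auto simp: carrier_free_group)
      then show ?thesis using generate.inv[of "free_gen x"] False a by (metis rangeI)
    qed (use gen a in simp)
    from generate.eng[OF this Cons] show ?case by (simp add: mult_free_group)
  qed
  then show "?C \<subseteq> ?G" by (auto simp: carrier_free_group)
qed

definition presented_gen :: "('x \<times> bool) list set set \<Rightarrow> 'x \<Rightarrow> ('x \<times> bool) list set set" where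
  "presented_gen R x = normal_closure free_group R #>\<^bsub>free_group\<^esub> free_gen x"

context
  fixes R :: "('x \<times> bool) list set set"
  assumes R: "R \<subseteq> carrier free_group"
begin

interpretation F: group "free_group :: ('x \<times> bool) list set monoid" by (rule group_free_group)

lemma group_hom_presented:
  "group_hom free_group (presented_group R) (\<lambda>a. normal_closure free_group R #>\<^bsub>free_group\<^esub> a)"
  unfolding presented_group_def
  by (intro group_hom.intro group_hom_axioms.intro group_free_group
      normal.r_coset_hom_Mod[OF F.normal_closure_normal[OF R]]
      normal.factorgroup_is_group[OF F.normal_closure_normal[OF R]])

lemma relator_trivial:
  assumes "r \<in> R"
  shows "normal_closure free_group R #>\<^bsub>free_group\<^esub> r = \<one>\<^bsub>presented_group R\<^esub>"
proof -
  have r: "r \<in> carrier free_group" using assms R by blast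
  have "\<one>\<^bsub>free_group\<^esub> \<otimes>\<^bsub>free_group\<^esub> r \<otimes>\<^bsub>free_group\<^esub> inv\<^bsub>free_group\<^esub> \<one>\<^bsub>free_group\<^esub> \<in>
    {g \<otimes>\<^bsub>free_group\<^esub> r \<otimes>\<^bsub>free_group\<^esub> inv\<^bsub>free_group\<^esub> g | g r. g \<in> carrier free_group \<and> r \<in> R}"
    using assms F.one_closed by blast
  then have "r \<in> normal_closure free_group R"
    unfolding normal_closure_def using r by (intro generate.incl) simp
  then show ?thesis
    using F.coset_join2[OF r normal_imp_subgroup[OF F.normal_closure_normal[OF R]]]
    by (simp add: presented_group_def)
qed

lemma generate_presented_gen:
  "generate (presented_group R) (range (presented_gen R)) = carrier (presented_group R)"
proof -
  interpret q: group_hom free_group "presented_group R" "\<lambda>a. normal_closure free_group R #>\<^bsub>free_group\<^esub> a"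
    by (rule group_hom_presented)
  have sub: "range free_gen \<subseteq> (carrier free_group :: ('x \<times> bool) list set set)"
    by (rule image_subsetI) (rule free_gen_closed)
  have "range (presented_gen R) = (\<lambda>a. normal_closure free_group R #>\<^bsub>free_group\<^esub> a) ` range free_gen"
    by (auto simp: presented_gen_def)
  then have "generate (presented_group R) (range (presented_gen R)) =
      (\<lambda>a. normal_closure free_group R #>\<^bsub>free_group\<^esub> a) ` generate free_group (range free_gen)"
    using q.generate_img[OF sub] by simp
  also have "\<dots> = carrier (presented_group R)"
    by (simp add: generate_free_gen presented_group_def carrier_FactGroup)
  finally show ?thesis .
qed

text \<open>The kernel of the homomorphism on the free group contains all conjugates of relators,
  hence their normal closure, and the map factors through the quotient.\<close>

lemma presented_universal:
  assumes K: "group K" and \<gamma>: "\<And>x. \<gamma> x \<in> carrier K"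
    and rel: "\<And>r. r \<in> R \<Longrightarrow> free_hom K \<gamma> r = \<one>\<^bsub>K\<^esub>"
  obtains \<phi> where "group_hom (presented_group R) K \<phi>" "\<And>x. \<phi> (presented_gen R x) = \<gamma> x"
proof -
  interpret f: group_hom free_group K "free_hom K \<gamma>" by (rule group.group_hom_free[OF K \<gamma>])
  have ker: "subgroup (kernel free_group K (free_hom K \<gamma>)) free_group" by (rule f.subgroup_kernel)
  have "normal_closure free_group R \<subseteq> kernel free_group K (free_hom K \<gamma>)"
    unfolding normal_closure_def
  proof (rule F.generate_subgroup_incl[OF subsetI ker])
    fix y assume "y \<in> {g \<otimes>\<^bsub>free_group\<^esub> r \<otimes>\<^bsub>free_group\<^esub> inv\<^bsub>free_group\<^esub> g | g r. g \<in> carrier free_group \<and> r \<in> R}"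
    then obtain g r where y: "y = g \<otimes>\<^bsub>free_group\<^esub> r \<otimes>\<^bsub>free_group\<^esub> inv\<^bsub>free_group\<^esub> g"
      "g \<in> carrier free_group" "r \<in> R" by blast
    then have "r \<in> carrier free_group" using R by blast
    then show "y \<in> kernel free_group K (free_hom K \<gamma>)" using y rel[OF y(3)] by (simp add: kernel_def)
  qed
  then obtain \<phi> where \<phi>: "\<phi> \<in> hom (presented_group R) K"
    "\<And>a. a \<in> carrier free_group \<Longrightarrow> \<phi> (normal_closure free_group R #>\<^bsub>free_group\<^esub> a) = free_hom K \<gamma> a"
    using f.FactGroup_universal_kernel[OF F.normal_closure_normal[OF R]] unfolding presented_group_def by metis
  show ?thesis
  proof (rule that)
    show "group_hom (presented_group R) K \<phi>"
      by (intro group_hom.intro group_hom_axioms.intro group_presented_group[OF R] K \<phi>(1))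
    show "\<phi> (presented_gen R x) = \<gamma> x" for x
      unfolding presented_gen_def by (simp add: \<phi>(2) free_gen_closed group.free_hom_gen[OF K \<gamma>])
  qed
qed

end

lemma brin_relators_closed: "brin_relators \<subseteq> carrier free_group"
proof -
  interpret group "free_group :: (brin_gen \<times> bool) list set monoid" by (rule group_free_group)
  show ?thesis by (auto simp: brin_relators_def Let_def conjugate_def commutator_def free_gen_closed)
qed

lemma brin_like_brin_group:
  "brin_like brin_group (\<lambda>i. presented_gen brin_relators (W i)) (presented_gen brin_relators S)"
proof -
  let ?F = "free_group :: (brin_gen \<times> bool) list set monoid"
  let ?q = "\<lambda>a. normal_closure ?F brin_relators #>\<^bsub>?F\<^esub> a"
  interpret q: group_hom ?F brin_group ?q
    unfolding brin_group_def by (rule group_hom_presented[OF brin_relators_closed])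
  note [simp] = free_gen_closed
  have triv: "?q r = \<one>\<^bsub>brin_group\<^esub>" if "r \<in> brin_relators" for r
    unfolding brin_group_def by (rule relator_trivial[OF brin_relators_closed that])
  have gen: "presented_gen brin_relators x = ?q (free_gen x)" for x by (simp add: presented_gen_def)
  have closed: "?q (free_gen x) \<in> carrier brin_group" for x by (rule q.hom_closed) simp
  show ?thesis
  proof (unfold_locales, unfold gen)
    fix i
    show "?q (free_gen (W i)) \<in> carrier brin_group" by (rule closed)
    show "?q (free_gen S) \<in> carrier brin_group" by (rule closed)
    have "conjugate ?F (free_gen (W i)) (free_gen S) \<otimes>\<^bsub>?F\<^esub> inv\<^bsub>?F\<^esub> (free_gen (W (i + 1))) \<in> brin_relators"
      unfolding brin_relators_def Let_def by blast
    from triv[OF this]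
    have "inv\<^bsub>brin_group\<^esub> ?q (free_gen S) \<otimes>\<^bsub>brin_group\<^esub> ?q (free_gen (W i)) \<otimes>\<^bsub>brin_group\<^esub> ?q (free_gen S)
        \<otimes>\<^bsub>brin_group\<^esub> inv\<^bsub>brin_group\<^esub> ?q (free_gen (W (i + 1))) = \<one>\<^bsub>brin_group\<^esub>"
      by (simp add: conjugate_def)
    then show "inv\<^bsub>brin_group\<^esub> ?q (free_gen S) \<otimes>\<^bsub>brin_group\<^esub> ?q (free_gen (W i)) \<otimes>\<^bsub>brin_group\<^esub> ?q (free_gen S)
        = ?q (free_gen (W (i + 1)))"
      using closed by (metis q.H.inv_equality q.H.inv_inv q.H.inv_closed q.H.m_closed)
  next
    fix i j k m :: int assume ijk: "i < k" "j < k" "m \<noteq> 0"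
    let ?A = "conjugate ?F (free_gen (W i)) (free_gen (W k) [^]\<^bsub>?F\<^esub> m)"
    have Ac: "?A \<in> carrier ?F" by (simp add: conjugate_def)
    have "commutator ?F ?A (free_gen (W j)) \<in> brin_relators"
      unfolding brin_relators_def Let_def using ijk by blast
    from triv[OF this]
    have 1: "inv\<^bsub>brin_group\<^esub> ?q ?A \<otimes>\<^bsub>brin_group\<^esub> inv\<^bsub>brin_group\<^esub> ?q (free_gen (W j)) \<otimes>\<^bsub>brin_group\<^esub> ?q ?A
        \<otimes>\<^bsub>brin_group\<^esub> ?q (free_gen (W j)) = \<one>\<^bsub>brin_group\<^esub>"
      using Ac by (simp add: commutator_def)
    have "?q ?A = inv\<^bsub>brin_group\<^esub> (?q (free_gen (W k)) [^]\<^bsub>brin_group\<^esub> m) \<otimes>\<^bsub>brin_group\<^esub> ?q (free_gen (W i))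
        \<otimes>\<^bsub>brin_group\<^esub> ?q (free_gen (W k)) [^]\<^bsub>brin_group\<^esub> m"
      using q.hom_int_pow[of "free_gen (W k)" m] by (simp add: conjugate_def)
    with q.H.commute_if_commutator_trivial[OF q.hom_closed[OF Ac] closed 1]
    show "(inv\<^bsub>brin_group\<^esub> (?q (free_gen (W k)) [^]\<^bsub>brin_group\<^esub> m) \<otimes>\<^bsub>brin_group\<^esub> ?q (free_gen (W i))
        \<otimes>\<^bsub>brin_group\<^esub> ?q (free_gen (W k)) [^]\<^bsub>brin_group\<^esub> m) \<otimes>\<^bsub>brin_group\<^esub> ?q (free_gen (W j)) =
      ?q (free_gen (W j)) \<otimes>\<^bsub>brin_group\<^esub> (inv\<^bsub>brin_group\<^esub> (?q (free_gen (W k)) [^]\<^bsub>brin_group\<^esub> m)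
        \<otimes>\<^bsub>brin_group\<^esub> ?q (free_gen (W i)) \<otimes>\<^bsub>brin_group\<^esub> ?q (free_gen (W k)) [^]\<^bsub>brin_group\<^esub> m)" by simp
  next
    have "insert (?q (free_gen S)) (range (\<lambda>i. ?q (free_gen (W i)))) = range (presented_gen brin_relators)"
    proof -
      have "(UNIV :: brin_gen set) = insert S (range W)" by (auto intro: brin_gen.exhaust)
      then have "range (presented_gen brin_relators) = presented_gen brin_relators ` insert S (range W)" by simp
      then show ?thesis unfolding gen by auto
    qed
    then show "generate brin_group (insert (?q (free_gen S)) (range (\<lambda>i. ?q (free_gen (W i))))) = carrier brin_group"
      using generate_presented_gen[OF brin_relators_closed] by (simp add: brin_group_def)
  qed
qed

lemma (in brin_relations) brin_group_hom:
  obtains \<phi> where "group_hom brin_group B \<phi>"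
    "\<And>i. \<phi> (presented_gen brin_relators (W i)) = w i" "\<phi> (presented_gen brin_relators S) = s"
proof -
  define \<gamma> where "\<gamma> x = (case x of W i \<Rightarrow> w i | S \<Rightarrow> s)" for x
  have \<gamma>: "\<gamma> x \<in> carrier B" for x using w_closed s_closed by (cases x) (auto simp: \<gamma>_def)
  interpret f: group_hom free_group B "free_hom B \<gamma>" by (rule group_hom_free[OF \<gamma>])
  note [simp] = free_gen_closed
  have gen: "free_hom B \<gamma> (free_gen (W i)) = w i" "free_hom B \<gamma> (free_gen S) = s" for i
    by (simp_all add: free_hom_gen[OF \<gamma>]) (simp_all add: \<gamma>_def)
  have rel: "free_hom B \<gamma> r = \<one>" if "r \<in> brin_relators" for r
    using that unfolding brin_relators_def Let_def
  proof
    assume "r \<in> {conjugate free_group (free_gen (W i)) (free_gen S) \<otimes>\<^bsub>free_group\<^esub> inv\<^bsub>free_group\<^esub> free_gen (W (i + 1)) | i. True}"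
    then obtain i where "r = conjugate free_group (free_gen (W i)) (free_gen S) \<otimes>\<^bsub>free_group\<^esub> inv\<^bsub>free_group\<^esub> free_gen (W (i + 1))" by blast
    then show ?thesis using shift[of i] w_closed s_closed by (simp add: conjugate_def gen)
  next
    assume "r \<in> {commutator free_group (conjugate free_group (free_gen (W i)) (free_gen (W k) [^]\<^bsub>free_group\<^esub> m)) (free_gen (W j)) | i j k m.
      i < k \<and> j < k \<and> m \<noteq> (0::int)}"
    then obtain i j k and m :: int where r: "r = commutator free_group (conjugate free_group (free_gen (W i)) (free_gen (W k) [^]\<^bsub>free_group\<^esub> m)) (free_gen (W j))"
      "i < k" "j < k" "m \<noteq> 0" by blast
    let ?A = "conjugate free_group (free_gen (W i)) (free_gen (W k) [^]\<^bsub>free_group\<^esub> m)"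
    define A where "A = inv (w k [^] m) \<otimes> w i \<otimes> w k [^] m"
    have Ac: "A \<in> carrier B" using w_closed by (simp add: A_def)
    have comm: "A \<otimes> w j = w j \<otimes> A" unfolding A_def by (rule commuting[OF r(2-4)])
    have A: "free_hom B \<gamma> ?A = A" using f.hom_int_pow[of "free_gen (W k)" m] by (simp add: conjugate_def gen A_def)
    have "?A \<in> carrier free_group" by (simp add: conjugate_def)
    then have "free_hom B \<gamma> r = inv A \<otimes> inv w j \<otimes> A \<otimes> w j" unfolding r(1) by (simp add: commutator_def A gen)
    also have "\<dots> = inv (w j \<otimes> A) \<otimes> (A \<otimes> w j)" using Ac w_closed by (simp add: inv_mult_group m_assoc)
    also have "\<dots> = \<one>" unfolding comm using Ac w_closed by simp
    finally show ?thesis .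
  qed
  obtain \<phi> where \<phi>: "group_hom (presented_group brin_relators) B \<phi>" "\<And>x. \<phi> (presented_gen brin_relators x) = \<gamma> x"
    using presented_universal[OF brin_relators_closed is_group \<gamma> rel] by blast
  show ?thesis by (rule that[of \<phi>]) (use \<phi> in \<open>simp_all add: brin_group_def \<gamma>_def\<close>)
qed

section \<open>Brin's group is not soluble\<close>

text \<open>A permutation model, needed because nontriviality cannot be read off the presentation.\<close>

definition bump :: "int \<Rightarrow> int \<Rightarrow> (int \<Rightarrow> int) \<Rightarrow> int \<Rightarrow> int" where
  "bump k m c = (if \<forall>j>k. c j = 0 then c(k := c k + m) else c)"

definition translate :: "(int \<Rightarrow> int) \<Rightarrow> int \<Rightarrow> int" where
  "translate c = (\<lambda>j. c (j + 1))"

abbreviation seq_perms :: "((int \<Rightarrow> int) \<Rightarrow> int \<Rightarrow> int) monoid" where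
  "seq_perms \<equiv> BijGroup UNIV"

lemma seq_perms_carrier: "carrier seq_perms = {f. bij f}"
  by (auto simp: BijGroup_def Bij_def extensional_def)

lemma seq_perms_mult: "\<lbrakk>bij f; bij g\<rbrakk> \<Longrightarrow> f \<otimes>\<^bsub>seq_perms\<^esub> g = f \<circ> g"
  by (auto simp: BijGroup_def Bij_def extensional_def compose_def fun_eq_iff)

lemma seq_perms_one: "\<one>\<^bsub>seq_perms\<^esub> = id"
  by (auto simp: BijGroup_def fun_eq_iff)

interpretation seq_perms: group seq_perms
  by (rule group_BijGroup)

lemma bump_bump: "bump k m (bump k n c) = bump k (m + n) c"
  by (auto simp: bump_def fun_eq_iff)

lemma bump_zero: "bump k 0 = id"
  by (auto simp: bump_def fun_eq_iff)

lemma bump_bij: "bij (bump k m)"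
  by (rule o_bij[of "bump k (- m)"]) (auto simp: fun_eq_iff bump_bump bump_zero)

lemma translate_bij: "bij translate"
  by (rule o_bij[of "\<lambda>c j. c (j - 1)"]) (auto simp: fun_eq_iff translate_def)

lemma inv_bump: "inv\<^bsub>seq_perms\<^esub> (bump k m) = bump k (- m)"
  by (rule seq_perms.inv_equality)
    (auto simp: seq_perms_carrier bump_bij seq_perms_mult seq_perms_one bump_bump bump_zero fun_eq_iff)

lemma bump_pow: "bump k 1 [^]\<^bsub>seq_perms\<^esub> (m::int) = bump k m"
proof -
  have nat: "bump k 1 [^]\<^bsub>seq_perms\<^esub> n = bump k (int n)" for n :: nat
  proof (induction n)
    case (Suc n)
    then show ?case
      by (simp add: seq_perms_mult bump_bij) (auto simp: fun_eq_iff bump_bump add.commute)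
  qed (simp add: bump_zero seq_perms_one)
  show ?thesis by (cases "m < 0") (simp_all add: int_pow_def2 nat inv_bump)
qed

text \<open>An iterated wreath product of infinite cyclic groups acting on integer sequences. The
  conjugate of \<open>bump i 1\<close> by \<open>bump k m\<close> moves only sequences whose entry
  at \<open>k\<close> is \<open>- m\<close>, while for \<open>j < k\<close> the map
  \<open>bump j 1\<close> moves only sequences whose entry at \<open>k\<close> is \<open>0\<close>.
  The supports are disjoint for nonzero \<open>m\<close>.\<close>

lemma brin_relations_sequences: "brin_relations seq_perms (\<lambda>k. bump k 1) translate"
proof unfold_locales
  note [simp] = seq_perms_mult bump_bij translate_bij bij_comp
  fix i j k :: int
  show "bump i 1 \<in> carrier seq_perms" "translate \<in> carrier seq_perms"
    by (simp_all add: seq_perms_carrier)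
  have invt: "inv\<^bsub>seq_perms\<^esub> translate = (\<lambda>c j. c (j - 1))"
  proof (rule seq_perms.inv_equality)
    have "bij (\<lambda>c (j::int). c (j - 1) :: int)"
      by (rule o_bij[of translate]) (auto simp: fun_eq_iff translate_def)
    then show "(\<lambda>c j. c (j - 1)) \<in> carrier seq_perms"
      and "(\<lambda>c j. c (j - 1)) \<otimes>\<^bsub>seq_perms\<^esub> translate = \<one>\<^bsub>seq_perms\<^esub>"
      by (auto simp: seq_perms_carrier seq_perms_one fun_eq_iff translate_def)
  qed (simp add: seq_perms_carrier)
  have bijt: "bij (\<lambda>c (j::int). c (j - 1) :: int)"
    by (rule o_bij[of translate]) (auto simp: fun_eq_iff translate_def)
  have shifted: "bump i 1 (translate c) (j - 1) = bump (i + 1) 1 c j" for c j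
  proof -
    have "(\<forall>j>i. c (j + 1) = 0) \<longleftrightarrow> (\<forall>j>i + 1. c j = 0)"
      by (metis add_less_cancel_right diff_add_cancel)
    then show ?thesis by (auto simp: bump_def translate_def)
  qed
  show "inv\<^bsub>seq_perms\<^esub> translate \<otimes>\<^bsub>seq_perms\<^esub> bump i 1 \<otimes>\<^bsub>seq_perms\<^esub> translate = bump (i + 1) 1"
    by (simp add: invt bijt shifted fun_eq_iff)
  fix m :: int
  assume ijk: "i < k" "j < k" "m \<noteq> 0"
  have conj: "bump k (- m) (bump i 1 (bump k m c)) =
      (if (\<forall>l>k. c l = 0) \<and> c k = - m \<and> (\<forall>l. i < l \<and> l < k \<longrightarrow> c l = 0) then c(i := c i + 1) else c)" for c
  proof (cases "\<forall>l>k. c l = 0")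
    case True
    have "(\<forall>l>i. (c(k := c k + m)) l = 0) \<longleftrightarrow> c k = - m \<and> (\<forall>l. i < l \<and> l < k \<longrightarrow> c l = 0)"
    proof (intro iffI conjI allI impI)
      assume *: "\<forall>l>i. (c(k := c k + m)) l = 0"
      show "c k = - m" using *[rule_format, of k] ijk by simp
      show "c l = 0" if "i < l \<and> l < k" for l using *[rule_format, of l] that by simp
    next
      fix l assume "c k = - m \<and> (\<forall>l. i < l \<and> l < k \<longrightarrow> c l = 0)" "l > i"
      then show "(c(k := c k + m)) l = 0" using True by (cases l k rule: linorder_cases) auto
    qed
    then show ?thesis using True ijk by (auto simp: bump_def fun_eq_iff)
  next
    case False
    then obtain l where l: "l > k" "c l \<noteq> 0" by blast
    have "bump k n c = c" for n unfolding bump_def using l by auto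
    moreover have "bump i 1 c = c" unfolding bump_def using l ijk(1) by (auto intro: less_trans)
    ultimately show ?thesis using l by auto
  qed
  have "bump k (- m) (bump i 1 (bump k m (bump j 1 c))) = bump j 1 (bump k (- m) (bump i 1 (bump k m c)))" for c
  proof (cases "\<forall>l>j. c l = 0")
    case True
    then have "c k = 0" using ijk by simp
    then show ?thesis unfolding conj using ijk by (auto simp: bump_def)
  next
    case False
    then have c: "bump j 1 c = c" unfolding bump_def by (rule if_not_P)
    show ?thesis unfolding conj c using False ijk by (auto simp: bump_def)
  qed
  then show "inv\<^bsub>seq_perms\<^esub> (bump k 1 [^]\<^bsub>seq_perms\<^esub> m) \<otimes>\<^bsub>seq_perms\<^esub> bump i 1 \<otimes>\<^bsub>seq_perms\<^esub> bump k 1 [^]\<^bsub>seq_perms\<^esub> m \<otimes>\<^bsub>seq_perms\<^esub> bump j 1 =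
     bump j 1 \<otimes>\<^bsub>seq_perms\<^esub> (inv\<^bsub>seq_perms\<^esub> (bump k 1 [^]\<^bsub>seq_perms\<^esub> m) \<otimes>\<^bsub>seq_perms\<^esub> bump i 1 \<otimes>\<^bsub>seq_perms\<^esub> bump k 1 [^]\<^bsub>seq_perms\<^esub> m)"
    by (simp add: bump_pow inv_bump fun_eq_iff)
qed

text \<open>Every term of the derived series still contains elements acting like a generator on
  sequences that vanish above a given level. The bound \<open>K\<close> on the support tells at
  which higher level a second element has to act so that the commutator behaves like the
  first.\<close>

theorem brin_group_not_solvable: "\<not> solvable brin_group"
proof
  assume sol: "solvable brin_group"
  interpret M: brin_relations seq_perms "\<lambda>k. bump k 1" translate by (rule brin_relations_sequences)
  obtain \<phi> where \<phi>: "group_hom brin_group seq_perms \<phi>"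
    "\<And>i. \<phi> (presented_gen brin_relators (W i)) = bump i 1"
    using M.brin_group_hom by metis
  interpret \<phi>: group_hom brin_group seq_perms \<phi> by (rule \<phi>(1))
  interpret B: brin_like brin_group "\<lambda>i. presented_gen brin_relators (W i)" "presented_gen brin_relators S"
    by (rule brin_like_brin_group)
  let ?D = "\<lambda>n. (derived brin_group ^^ n) (carrier brin_group)"
  have bij: "bij (\<phi> u)" if "u \<in> carrier brin_group" for u
    using \<phi>.hom_closed[OF that] by (simp add: seq_perms_carrier)
  have mult: "\<phi> (u \<otimes>\<^bsub>brin_group\<^esub> v) c = \<phi> u (\<phi> v c)" if "u \<in> carrier brin_group" "v \<in> carrier brin_group" for u v c
    using that bij by (simp add: seq_perms_mult)
  have inv: "\<phi> (inv\<^bsub>brin_group\<^esub> u) (\<phi> u c) = c" if "u \<in> carrier brin_group" for u c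
    using mult[of "inv\<^bsub>brin_group\<^esub> u" u c] that by (simp add: seq_perms_one)
  text \<open>An element acting like \<open>W (K + 1)\<close> displaces every sequence vanishing beyond \<open>K\<close>, hence the
    support of \<open>u\<close>.\<close>
  have deep: "\<exists>u\<in>?D n. \<exists>K\<ge>k. (\<forall>c. (\<forall>j>k. c j = 0) \<longrightarrow> \<phi> u c = c(k := c k + 1)) \<and>
      (\<forall>c. (\<exists>j>K. c j \<noteq> 0) \<longrightarrow> \<phi> u c = c)" for n and k :: int
  proof (induction n arbitrary: k)
    case 0
    show ?case
      by (intro bexI[of _ "presented_gen brin_relators (W k)"] exI[of _ k])
        (auto simp: \<phi>(2) bump_def B.w_closed)
  next
    case (Suc n)
    obtain u K where u: "u \<in> ?D n" "K \<ge> k" "\<And>c. (\<forall>j>k. c j = 0) \<Longrightarrow> \<phi> u c = c(k := c k + 1)"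
      "\<And>c. (\<exists>j>K. c j \<noteq> 0) \<Longrightarrow> \<phi> u c = c" using Suc[of k] by blast
    obtain t K' where t: "t \<in> ?D n" "K' \<ge> K + 1" "\<And>c. (\<forall>j>K + 1. c j = 0) \<Longrightarrow> \<phi> t c = c(K + 1 := c (K + 1) + 1)"
      "\<And>c. (\<exists>j>K'. c j \<noteq> 0) \<Longrightarrow> \<phi> t c = c" using Suc[of "K + 1"] by blast
    have c: "u \<in> carrier brin_group" "t \<in> carrier brin_group"
      using u t \<phi>.G.exp_of_derived_in_carrier[of "carrier brin_group" n] by auto
    let ?v = "u \<otimes>\<^bsub>brin_group\<^esub> t \<otimes>\<^bsub>brin_group\<^esub> inv\<^bsub>brin_group\<^esub> u \<otimes>\<^bsub>brin_group\<^esub> inv\<^bsub>brin_group\<^esub> t"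
    have "?v \<in> derived brin_group (?D n)" unfolding derived_def[of brin_group "?D n"]
      by (rule generate.incl) (intro UN_I[OF u(1)] UN_I[OF t(1)] singletonI)
    then have v: "?v \<in> ?D (Suc n)" by simp
    have val: "\<phi> ?v a = \<phi> u (\<phi> t (\<phi> (inv\<^bsub>brin_group\<^esub> u) (\<phi> (inv\<^bsub>brin_group\<^esub> t) a)))" for a
      using c by (simp only: mult \<phi>.G.m_closed \<phi>.G.inv_closed)
    have "\<phi> ?v a = a(k := a k + 1)" if a: "\<forall>j>k. a j = 0" for a
    proof -
      \<comment> \<open>\<open>b\<close> is the preimage of \<open>a\<close> under \<open>t\<close>.
        Its entry at \<open>K + 1\<close> is nonzero, so \<open>u\<close> fixes it, and
        \<open>u t u^-1 t^-1\<close> acts on \<open>a\<close> as \<open>u\<close> does.\<close>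
      define b where "b = a(K + 1 := - 1)"
      have aK: "a (K + 1) = 0" "\<forall>j>K + 1. a j = 0" using a u(2) by auto
      have "\<forall>j>K + 1. b j = 0" using aK by (simp add: b_def)
      then have tb: "\<phi> t b = a" using t(3)[of b] aK(1) by (auto simp: b_def fun_eq_iff)
      have "\<phi> u b = b" by (rule u(4)) (intro exI[of _ "K + 1"], simp add: b_def)
      then have "\<phi> (inv\<^bsub>brin_group\<^esub> u) b = b" using inv[OF c(1), of b] by simp
      moreover have "\<phi> (inv\<^bsub>brin_group\<^esub> t) a = b" using inv[OF c(2), of b] tb by simp
      ultimately show ?thesis using val[of a] tb u(3)[OF a] by simp
    qed
    moreover have "\<phi> ?v a = a" if a: "\<exists>j>K'. a j \<noteq> 0" for a
    proof -
      have "\<exists>j>K. a j \<noteq> 0" using a t(2) by force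
      then have ua: "\<phi> u a = a" by (rule u(4))
      have ta: "\<phi> t a = a" by (rule t(4)[OF a])
      show ?thesis using val[of a] ua ta inv[OF c(1), of a] inv[OF c(2), of a] by simp
    qed
    ultimately show ?case using v u(2) t(2) by (intro bexI[OF _ v] exI[of _ K']) auto
  qed
  obtain n where n: "?D n = {\<one>\<^bsub>brin_group\<^esub>}" using sol \<phi>.G.solvable_iff_trivial_derived_seq by blast
  obtain u where u: "u \<in> ?D n" "\<And>c. (\<forall>j>0. c j = 0) \<Longrightarrow> \<phi> u c = c(0 := c 0 + 1)" using deep[of n 0] by blast
  then have "u = \<one>\<^bsub>brin_group\<^esub>" using n by blast
  then have "\<phi> u (\<lambda>_. 0) = (\<lambda>_. 0)" by (simp add: seq_perms_one)
  then show False using u(2)[of "\<lambda>_. 0"] by (auto simp: fun_eq_iff split: if_splits dest: spec[of _ 0])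
qed

section \<open>Embedding Brin's group\<close>

context pl_fin_gen begin

text \<open>Conjugation by a power of \<open>s\<close> brings the top index of a commutation
  relation to \<open>0\<close>; what remains is an instance of the displacement criterion for
  \<open>w\<close>.\<close>

lemma brin_group_embeds:
  assumes "orb Y p0 q0" "f0 \<in> H" "orb {f0} p0 b0" "b0 < q0"
  obtains \<phi> where "group_hom brin_group L \<phi>" "inj_on \<phi> (carrier brin_group)"
proof -
  obtain w s p q c d x z where wH: "w \<in> H" and sH: "s \<in> H" and o: "orb Y p q"
    and pts: "p < c" "c \<le> x" "x < z" "z \<le> d" "d < q" and con: "x < s \<rhd> c" "s \<rhd> d < z" and "w \<rhd> z \<noteq> z"
    and supp: "\<And>y. \<lbrakk>p < y; y < q; w \<rhd> y \<noteq> y\<rbrakk> \<Longrightarrow> c \<le> y \<and> y \<le> d"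
    and disp: "\<And>m::int. m \<noteq> 0 \<Longrightarrow> displaces (w [^] m) x z"
    and comm: "\<And>h. \<lbrakk>h \<in> H; displaces h c d\<rbrakk> \<Longrightarrow> (h \<otimes> w \<otimes> inv h) \<otimes> w = w \<otimes> (h \<otimes> w \<otimes> inv h)"
    by (rule ex_contracting_pair[OF assms]) blast
  have wc: "w \<in> carrier L" and sc: "s \<in> carrier L" using wH sH H_carrier by auto
  define \<omega> where "\<omega> i = inv (s [^] i) \<otimes> w \<otimes> s [^] i" for i :: int
  have \<omega>c: "\<omega> i \<in> carrier L" for i using wc sc by (simp add: \<omega>_def)
  have Hpow: "g [^] (m::int) \<in> H" if "g \<in> H" for g m
    using subgroup_int_pow_closed[OF generate_is_subgroup[OF Y] that] .
  have shrink: "x < s [^] a \<rhd> c" "s [^] a \<rhd> d < z" if "a > 0" for a :: nat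
  proof -
    have "x < s [^] a \<rhd> c \<and> s [^] a \<rhd> d < z" using that
    proof (induction a rule: nat_induct_non_zero)
      case 1
      then show ?case using con sc by simp
    next
      case (Suc a)
      have lt: "c < s \<rhd> c" "s \<rhd> d < d" using con pts by linarith+
      then have lt': "s [^] a \<rhd> c < s [^] a \<rhd> s \<rhd> c" "s [^] a \<rhd> s \<rhd> d < s [^] a \<rhd> d" using sc by simp_all
      have "s [^] Suc a \<rhd> y = s [^] a \<rhd> s \<rhd> y" for y using sc by (simp add: act_mult)
      then show ?case using lt' Suc.IH by (simp only:) linarith
    qed
    then show "x < s [^] a \<rhd> c" "s [^] a \<rhd> d < z" by auto
  qed
  have conj: "inv (s [^] k) \<otimes> \<omega> i \<otimes> s [^] k = \<omega> (i + k)" for i k :: int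
    using wc sc by (simp add: \<omega>_def int_pow_mult inv_mult_group m_assoc)
  have comm0: "(inv (w [^] m) \<otimes> \<omega> i \<otimes> w [^] m) \<otimes> \<omega> j = \<omega> j \<otimes> (inv (w [^] m) \<otimes> \<omega> i \<otimes> w [^] m)"
    if ij: "i < 0" "j < 0" and m: "m \<noteq> 0" for i j m :: int
  proof -
    define a where "a = nat (- i)"
    define b where "b = nat (- j)"
    have ab: "a > 0" "b > 0" "i = - int a" "j = - int b" using ij by (auto simp: a_def b_def)
    define A where "A = s [^] a"
    define T where "T = s [^] b"
    define P where "P = w [^] m"
    have c: "A \<in> carrier L" "T \<in> carrier L" "P \<in> carrier L" using sc wc by (simp_all add: A_def T_def P_def)
    have H3: "A \<in> H" "T \<in> H" "P \<in> H"
      using Hpow[OF sH, of "int a"] Hpow[OF sH, of "int b"] Hpow[OF wH, of m]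
      by (simp_all add: A_def T_def P_def int_pow_int)
    have \<omega>i: "\<omega> i = A \<otimes> w \<otimes> inv A" "\<omega> j = T \<otimes> w \<otimes> inv T"
      using sc by (simp_all add: \<omega>_def ab A_def T_def int_pow_neg int_pow_int)
    \<comment> \<open>Conjugation by \<open>inv T\<close> turns the two elements into
      \<open>h w h^-1\<close> and \<open>w\<close>. \<open>A\<close> carries \<open>[c, d]\<close>
      into \<open>(x, z)\<close>, then \<open>inv P\<close> moves it off \<open>[x, z]\<close>,
      hence off \<open>T [c, d]\<close>; so \<open>h\<close> displaces
      \<open>[c, d]\<close>.\<close>
    define h where "h = inv T \<otimes> (inv P \<otimes> A)"
    have h: "h \<in> H" unfolding h_def by (intro H_mult H_inv H3)
    have hc: "h \<in> carrier L" using H_carrier[OF h] .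
    have e: "x < A \<rhd> c" "A \<rhd> d < z" "x < T \<rhd> c" "T \<rhd> d < z"
      using shrink[OF ab(1)] shrink[OF ab(2)] by (simp_all add: A_def T_def)
    have "displaces (inv P) x z" using disp[OF m] displaces_inv[of P] c by (simp add: P_def)
    then have "displaces h c d"
      unfolding displaces_def
    proof
      assume *: "inv P \<rhd> z < x"
      have "inv P \<rhd> A \<rhd> d < inv P \<rhd> z" using e c by simp
      then have "inv P \<rhd> A \<rhd> d < T \<rhd> c" using * e by linarith
      then show "h \<rhd> d < c \<or> d < h \<rhd> c" using c by (simp add: h_def act_mult inv_act_less)
    next
      assume *: "z < inv P \<rhd> x"
      have "inv P \<rhd> x < inv P \<rhd> A \<rhd> c" using e c by simp
      then have "T \<rhd> d < inv P \<rhd> A \<rhd> c" using * e by linarith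
      then show "h \<rhd> d < c \<or> d < h \<rhd> c" using c by (simp add: h_def act_mult less_inv_act)
    qed
    from comm[OF h this] have hw: "(h \<otimes> w \<otimes> inv h) \<otimes> w = w \<otimes> (h \<otimes> w \<otimes> inv h)" .
    interpret t: group_hom L L "\<lambda>y. T \<otimes> y \<otimes> inv T" by (rule conj_group_hom) (rule c)
    have "T \<otimes> h = inv P \<otimes> A" using c by (simp add: h_def flip: m_assoc)
    moreover from this have "inv h \<otimes> inv T = inv A \<otimes> P" using c hc by (metis inv_closed inv_inv inv_mult_group)
    moreover have "T \<otimes> (h \<otimes> w \<otimes> inv h) \<otimes> inv T = (T \<otimes> h) \<otimes> w \<otimes> (inv h \<otimes> inv T)"
      using c hc wc by (simp add: m_assoc)
    ultimately have "T \<otimes> (h \<otimes> w \<otimes> inv h) \<otimes> inv T = inv P \<otimes> \<omega> i \<otimes> P"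
      using c wc by (simp add: \<omega>i m_assoc)
    moreover have "h \<otimes> w \<otimes> inv h \<in> carrier L" using hc wc by simp
    ultimately show ?thesis
      using t.hom_mult[OF _ wc, of "h \<otimes> w \<otimes> inv h"] t.hom_mult[OF wc, of "h \<otimes> w \<otimes> inv h"] hw
      by (simp add: \<omega>i(2) P_def)
  qed
  interpret rel: brin_relations L \<omega> s
  proof
    show "inv s \<otimes> \<omega> i \<otimes> s = \<omega> (i + 1)" for i using conj[of 1 i] sc by simp
    fix i j k m :: int assume ijk: "i < k" "j < k" "m \<noteq> 0"
    interpret t: group_hom L L "\<lambda>y. inv (s [^] k) \<otimes> y \<otimes> inv (inv (s [^] k))"
      by (rule conj_group_hom) (use sc in simp)
    have t: "inv (s [^] k) \<otimes> \<omega> l \<otimes> inv (inv (s [^] k)) = \<omega> (l + k)" for l using conj[of k l] sc by simp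
    define A where "A = inv (\<omega> 0 [^] m) \<otimes> \<omega> (i - k) \<otimes> \<omega> 0 [^] m"
    have Ac: "A \<in> carrier L" using \<omega>c by (simp add: A_def)
    have "\<omega> 0 = w" using wc by (simp add: \<omega>_def)
    then have eq: "A \<otimes> \<omega> (j - k) = \<omega> (j - k) \<otimes> A" unfolding A_def using comm0[of "i - k" "j - k" m] ijk by simp
    have tA: "inv (s [^] k) \<otimes> A \<otimes> inv (inv (s [^] k)) = inv (\<omega> k [^] m) \<otimes> \<omega> i \<otimes> \<omega> k [^] m"
    proof -
      have "inv (s [^] k) \<otimes> \<omega> 0 [^] m \<otimes> inv (inv (s [^] k)) = \<omega> k [^] m"
        using t.hom_int_pow[OF \<omega>c[of 0], of m] t[of 0] by simp
      moreover have "inv (s [^] k) \<otimes> A \<otimes> inv (inv (s [^] k)) =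
          inv (inv (s [^] k) \<otimes> \<omega> 0 [^] m \<otimes> inv (inv (s [^] k))) \<otimes>
          (inv (s [^] k) \<otimes> \<omega> (i - k) \<otimes> inv (inv (s [^] k))) \<otimes>
          (inv (s [^] k) \<otimes> \<omega> 0 [^] m \<otimes> inv (inv (s [^] k)))"
        unfolding A_def using \<omega>c by (simp only: t.hom_mult t.hom_inv int_pow_closed inv_closed m_closed)
      ultimately show ?thesis using t[of "i - k"] by simp
    qed
    show "(inv (\<omega> k [^] m) \<otimes> \<omega> i \<otimes> \<omega> k [^] m) \<otimes> \<omega> j = \<omega> j \<otimes> (inv (\<omega> k [^] m) \<otimes> \<omega> i \<otimes> \<omega> k [^] m)"
      using t.hom_mult[OF Ac \<omega>c[of "j - k"]] t.hom_mult[OF \<omega>c[of "j - k"] Ac] eq t[of "j - k"] tA by simp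
  qed (rule \<omega>c sc)+
  obtain \<phi> where \<phi>: "group_hom brin_group L \<phi>"
    "\<And>i. \<phi> (presented_gen brin_relators (W i)) = \<omega> i" "\<phi> (presented_gen brin_relators S) = s"
    using rel.brin_group_hom by metis
  have \<phi>0: "\<phi> (presented_gen brin_relators (W 0)) = w" using \<phi>(2)[of 0] wc by (simp add: \<omega>_def)
  have ends: "g \<rhd> p = p" "g \<rhd> q = q" if "g \<in> H" for g
    using generate_fixed[OF Y that] o by (auto simp: orb_def)
  interpret \<phi>: group_hom brin_group L \<phi> by (rule \<phi>(1))
  interpret emb: brin_action L act brin_group "\<lambda>i. presented_gen brin_relators (W i)" "presented_gen brin_relators S" \<phi> p q c d x z
  proof (intro brin_action.intro brin_action_axioms.intro brin_like_brin_group \<phi>(1) pl_action_axioms, unfold \<phi>0 \<phi>(3))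
  qed (use ends wH sH pts con supp disp in auto)
  from \<phi>(1) emb.injective that show ?thesis by blast
qed

end

lemma (in pl_action) brin_group_embeds_if_crossing:
  assumes crossing
  obtains \<phi> where "group_hom brin_group L \<phi>" "inj_on \<phi> (carrier brin_group)"
proof -
  obtain Z f p q b where Z: "finite Z" "Z \<subseteq> carrier L" "f \<in> Z" "orb Z p q" "orb {f} p b" "b < q"
    using assms unfolding crossing_def by blast
  interpret pl_fin_gen L act Z by unfold_locales (use Z in auto)
  show ?thesis using brin_group_embeds[OF Z(4) generate.incl[OF Z(3)] Z(5,6)] that by blast
qed

section \<open>The concrete action of subgroups of \<open>PL_plus\<close> on the line\<close>

definition extended_action :: "(real \<Rightarrow> real) \<Rightarrow> real \<Rightarrow> real" where
  "extended_action f x = (if 0 \<le> x \<and> x \<le> 1 then f x else x)"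

lemma PL_plusD:
  assumes "f \<in> carrier PL_plus"
  shows "f \<in> Bij {0..1}" "f \<in> extensional {0..1}" "strict_mono_on {0..1} f" "piecewise_linear_on 0 1 f"
    "f 0 = 0" "f 1 = 1" "\<And>x. \<lbrakk>0 \<le> x; x \<le> 1\<rbrakk> \<Longrightarrow> 0 \<le> f x \<and> f x \<le> 1"
proof -
  show B: "f \<in> Bij {0..1}" using assms subgroup.subset[OF PL_plus_subgroup] by (auto simp: BijGroup_def)
  show "f \<in> extensional {0..1}" "piecewise_linear_on 0 1 f" and mono: "strict_mono_on {0..1} f"
    using assms by (auto simp: PL_plus_def)
  have im: "f ` {0..1} = {0..1}" using B by (simp add: Bij_def bij_betw_def)
  then show rng: "0 \<le> f x \<and> f x \<le> 1" if "0 \<le> x" "x \<le> 1" for x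
    using that by (metis atLeastAtMost_iff imageI)
  obtain u where u: "u \<in> {0..1}" "f u = 0" using im by (metis atLeastAtMost_iff imageE order_refl zero_le_one)
  obtain v where v: "v \<in> {0..1}" "f v = 1" using im by (metis atLeastAtMost_iff imageE order_refl zero_le_one)
  have "\<not> 0 < u" using strict_mono_onD[OF mono, of 0 u] u rng[of 0] by auto
  then have "u = 0" using u by auto
  then show "f 0 = 0" using u by simp
  have "\<not> v < 1" using strict_mono_onD[OF mono, of v 1] v rng[of 1] by auto
  then have "v = 1" using v by auto
  then show "f 1 = 1" using v by simp
qed

lemma extended_action_mono:
  assumes f: "f \<in> carrier PL_plus" and xy: "x < y"
  shows "extended_action f x < extended_action f y"
proof -
  note P = PL_plusD[OF f]
  consider "x < 0" | "0 \<le> x" "y \<le> 1" | "1 < y" "0 \<le> x" by linarith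
  then show ?thesis
  proof cases
    case 1
    then show ?thesis using P(7)[of y] xy by (auto simp: extended_action_def)
  next
    case 2
    then show ?thesis using strict_mono_onD[OF P(3), of x y] xy by (auto simp: extended_action_def)
  next
    case 3
    then show ?thesis using P(7)[of x] xy by (auto simp: extended_action_def)
  qed
qed

text \<open>Extension by the identity may create breaks at \<open>0\<close> and \<open>1\<close>, so
  these join the given break set. At each point \<open>e\<close> is at most the distance to all
  other members of that set, which leaves the adjacent open intervals free of breaks.\<close>

lemma pl_action_subgroup:
  assumes G: "subgroup G PL_plus"
  shows "pl_action (PL_plus\<lparr>carrier := G\<rparr>) extended_action"
proof -
  interpret PL: group PL_plus by (rule group_PL_plus)
  have sub: "f \<in> carrier PL_plus" if "f \<in> G" for f using subgroup.subset[OF G] that by blast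
  interpret L: group "PL_plus\<lparr>carrier := G\<rparr>" by (rule subgroup.subgroup_is_group[OF G group_PL_plus])
  have avoid: "\<exists>e>0. \<forall>s\<in>insert 0 (insert 1 T). s \<noteq> x \<longrightarrow> e \<le> \<bar>x - s\<bar>" if "finite T" for T :: "real set" and x
    using finite_set_avoid[of "insert 0 (insert 1 T)" x] that by (simp add: dist_real_def)
  show ?thesis
  proof unfold_locales
    fix f g x assume f: "f \<in> carrier (PL_plus\<lparr>carrier := G\<rparr>)" and g: "g \<in> carrier (PL_plus\<lparr>carrier := G\<rparr>)"
    have "f \<otimes>\<^bsub>PL_plus\<^esub> g = compose {0..1} f g"
      using PL_plusD(1)[OF sub] f g by (simp add: PL_plus_def BijGroup_def)
    then show "extended_action (f \<otimes>\<^bsub>PL_plus\<lparr>carrier := G\<rparr>\<^esub> g) x = extended_action f (extended_action g x)"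
      using PL_plusD(7)[OF sub, of g x] g by (auto simp: extended_action_def compose_def)
  next
    fix x :: real show "extended_action \<one>\<^bsub>PL_plus\<lparr>carrier := G\<rparr>\<^esub> x = x"
      by (auto simp: PL_plus_def BijGroup_def extended_action_def)
  next
    fix f x y assume "f \<in> carrier (PL_plus\<lparr>carrier := G\<rparr>)" "(x::real) < y"
    then show "extended_action f x < extended_action f y" using extended_action_mono sub by simp
  next
    fix f and x :: real assume "f \<in> carrier (PL_plus\<lparr>carrier := G\<rparr>)" "x \<le> 0 \<or> 1 \<le> x"
    then show "extended_action f x = x" using PL_plusD(5,6)[OF sub, of f] by (auto simp: extended_action_def)
  next
    fix f assume f: "f \<in> carrier (PL_plus\<lparr>carrier := G\<rparr>)" and fx: "\<And>x. extended_action f x = x"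
    have "f x = (\<lambda>x\<in>{0..1}. x) x" for x
      using fx[of x] PL_plusD(2)[OF sub, of f] f by (auto simp: extended_action_def extensional_def restrict_def)
    then show "f = \<one>\<^bsub>PL_plus\<lparr>carrier := G\<rparr>\<^esub>" by (auto simp: PL_plus_def BijGroup_def fun_eq_iff)
  next
    fix f and x :: real assume f: "f \<in> carrier (PL_plus\<lparr>carrier := G\<rparr>)"
    note P = PL_plusD[OF sub, of f, simplified]
    have "piecewise_linear_on 0 1 f" using P(4) f by simp
    then obtain T where T: "finite T" and aff: "\<And>a b. \<lbrakk>0 \<le> a; a < b; b \<le> 1; {a<..<b} \<inter> T = {}\<rbrakk>
        \<Longrightarrow> \<exists>m c. \<forall>x\<in>{a..b}. f x = m * x + c"
      unfolding piecewise_linear_on_def by blast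
    have f01: "f 0 = 0" "f 1 = 1" using P f by auto
    obtain e where e: "e > 0" "\<And>s. \<lbrakk>s \<in> insert 0 (insert 1 T); s \<noteq> x\<rbrakk> \<Longrightarrow> e \<le> \<bar>x - s\<bar>"
      using avoid[OF T, of x] by blast
    show "\<exists>e>0. \<exists>m c. \<forall>y\<in>{x..x + e}. extended_action f y = m * y + c"
    proof (cases "0 \<le> x \<and> x < 1")
      case True
      then have "x + e \<le> 1" using e(2)[of 1] by auto
      moreover have "{x<..<x + e} \<inter> T = {}" using e(2) by force
      ultimately obtain m c where "\<forall>y\<in>{x..x + e}. f y = m * y + c" using aff[of x "x + e"] True e(1) by auto
      then have "\<forall>y\<in>{x..x + e}. extended_action f y = m * y + c"
        using True \<open>x + e \<le> 1\<close> by (auto simp: extended_action_def)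
      then show ?thesis using e(1) by blast
    next
      case False
      have "extended_action f y = 1 * y + 0" if "y \<in> {x..x + e}" for y
      proof (cases "x < 0")
        case True
        then have "y \<le> 0" using e(2)[of 0] that by auto
        then show ?thesis using f01 by (cases "y = 0") (auto simp: extended_action_def)
      next
        case False
        then have "1 \<le> y" using that \<open>\<not> (0 \<le> x \<and> x < 1)\<close> by auto
        then show ?thesis using f01 by (cases "y = 1") (auto simp: extended_action_def)
      qed
      then show ?thesis using e(1) by blast
    qed
    show "\<exists>e>0. \<exists>m c. \<forall>y\<in>{x - e..x}. extended_action f y = m * y + c"
    proof (cases "0 < x \<and> x \<le> 1")
      case True
      then have "0 \<le> x - e" using e(2)[of 0] by auto
      moreover have "{x - e<..<x} \<inter> T = {}" using e(2) by force
      ultimately obtain m c where "\<forall>y\<in>{x - e..x}. f y = m * y + c" using aff[of "x - e" x] True e(1) by auto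
      then have "\<forall>y\<in>{x - e..x}. extended_action f y = m * y + c"
        using True \<open>0 \<le> x - e\<close> by (auto simp: extended_action_def)
      then show ?thesis using e(1) by blast
    next
      case False
      have "extended_action f y = 1 * y + 0" if "y \<in> {x - e..x}" for y
      proof (cases "1 < x")
        case True
        then have "1 \<le> y" using e(2)[of 1] that by auto
        then show ?thesis using f01 by (cases "y = 1") (auto simp: extended_action_def)
      next
        case False
        then have "y \<le> 0" using that \<open>\<not> (0 < x \<and> x \<le> 1)\<close> by auto
        then show ?thesis using f01 by (cases "y = 0") (auto simp: extended_action_def)
      qed
      then show ?thesis using e(1) by blast
    qed
    have "affine_near (\<lambda>x. extended_action f x) y" if y: "y \<notin> insert 0 (insert 1 T)" for y
    proof -
      obtain e where e: "e > 0" "\<And>s. \<lbrakk>s \<in> insert 0 (insert 1 T); s \<noteq> y\<rbrakk> \<Longrightarrow> e \<le> \<bar>y - s\<bar>"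
        using avoid[OF T, of y] by blast
      have e3: "e \<le> \<bar>y\<bar>" "e \<le> \<bar>y - 1\<bar>" using e(2)[of 0] e(2)[of 1] y by auto
      have near: "\<forall>\<^sub>F u in nhds y. y - e < u \<and> u < y + e"
        using e(1) by (intro eventually_conj eventually_nhds_in_open[of "{y - e<..}" y, simplified] eventually_nhds_in_open[of "{..<y + e}" y, simplified]) auto
      show ?thesis
      proof (cases "0 < y \<and> y < 1")
        case True
        have b: "0 \<le> y - e" "y - e < y + e" "y + e \<le> 1" using e3 e(1) True by auto
        have "{y - e<..<y + e} \<inter> T = {}" using e(2) y by force
        from aff[OF b this] obtain m c where "\<forall>u\<in>{y - e..y + e}. f u = m * u + c" by blast
        then have "\<forall>\<^sub>F u in nhds y. extended_action f u = m * u + c"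
          using near by (auto elim!: eventually_mono simp: extended_action_def) (use b in auto)
        then show ?thesis unfolding affine_near_def by blast
      next
        case False
        then have "y < 0 \<or> 1 < y" using y by auto
        then have "extended_action f u = 1 * u + 0" if "y - e < u \<and> u < y + e" for u
          using that e3 by (auto simp: extended_action_def)
        then have "\<forall>\<^sub>F u in nhds y. extended_action f u = 1 * u + 0"
          using near by (auto elim!: eventually_mono)
        then show ?thesis unfolding affine_near_def by blast
      qed
    qed
    then have "{y. \<not> affine_near (\<lambda>x. extended_action f x) y} \<subseteq> insert 0 (insert 1 T)" by blast
    then show "finite {x. \<not> affine_near (\<lambda>x. extended_action f x) x}" using T finite_subset by blast
  qed
qed

theorem corollary1p1:
  fixes G :: "(real \<Rightarrow> real) set"
  assumes "subgroup G PL_plus"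
    and "\<exists>A. finite A \<and> A \<subseteq> G \<and> generate PL_plus A = G"
  shows "\<not> solvable (PL_plus\<lparr>carrier := G\<rparr>) \<longleftrightarrow>
    (\<exists>H. subgroup H (PL_plus\<lparr>carrier := G\<rparr>) \<and> PL_plus\<lparr>carrier := H\<rparr> \<cong> brin_group)"
proof -
  let ?L = "PL_plus\<lparr>carrier := G\<rparr>"
  interpret PL: group PL_plus by (rule group_PL_plus)
  interpret pl_action ?L extended_action by (rule pl_action_subgroup[OF assms(1)])
  interpret B: group brin_group by (rule group_brin_group)
  obtain A where A: "finite A" "A \<subseteq> G" "generate PL_plus A = G" using assms(2) by blast
  have gen: "generate ?L A = carrier ?L" using PL.generate_consistent[OF A(2) assms(1)] A(3) by simp
  show ?thesis
  proof
    assume "\<not> solvable ?L"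
    then have crossing using solvable_if_not_crossing[OF _ A(1) _ gen] A(2) by auto
    then obtain \<phi> where \<phi>: "group_hom brin_group ?L \<phi>" "inj_on \<phi> (carrier brin_group)"
      by (rule brin_group_embeds_if_crossing)
    interpret \<phi>: group_hom brin_group ?L \<phi> by (rule \<phi>(1))
    let ?H = "\<phi> ` carrier brin_group"
    have H: "subgroup ?H ?L" by (rule \<phi>.img_is_subgroup)
    have "\<phi> \<in> iso brin_group (?L\<lparr>carrier := ?H\<rparr>)"
      using \<phi>(2) \<phi>.hom_mult by (auto simp: iso_def hom_def bij_betw_def)
    then have "brin_group \<cong> PL_plus\<lparr>carrier := ?H\<rparr>" unfolding is_iso_def by auto
    then show "\<exists>H. subgroup H ?L \<and> PL_plus\<lparr>carrier := H\<rparr> \<cong> brin_group" using H B.iso_sym by blast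
  next
    assume "\<exists>H. subgroup H ?L \<and> PL_plus\<lparr>carrier := H\<rparr> \<cong> brin_group"
    then obtain H where H: "subgroup H ?L" "PL_plus\<lparr>carrier := H\<rparr> \<cong> brin_group" by blast
    have "group (?L\<lparr>carrier := H\<rparr>)" by (rule subgroup.subgroup_is_group[OF H(1) is_group])
    then have "brin_group \<cong> PL_plus\<lparr>carrier := H\<rparr>" using group.iso_sym H(2) by fastforce
    then obtain \<psi> where \<psi>: "\<psi> \<in> iso brin_group (PL_plus\<lparr>carrier := H\<rparr>)" unfolding is_iso_def by blast
    have "\<psi> \<in> hom brin_group ?L" "inj_on \<psi> (carrier brin_group)"
      using \<psi> subgroup.subset[OF H(1)] by (auto simp: iso_def hom_def bij_betw_def)
    then have "group_hom brin_group ?L \<psi>"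
      by (intro group_hom.intro group_hom_axioms.intro group_brin_group is_group)
    \<comment> \<open>Solubility is inherited along injective homomorphisms.\<close>
    then show "\<not> solvable ?L"
      using group_hom.inj_hom_imp_solvable \<open>inj_on \<psi> (carrier brin_group)\<close> brin_group_not_solvable by blast
  qed
qed

end
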